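(* Let $(X,\mu)$ be an atomless standard Borel probability space and let $G=\mathrm{Aut}(\mu)$ be the Polish group of measure preserving automorphisms of $(X,\mu)$ with the weak topology. Then the Roelcke compactification and the WAP compactification of $G$ coincide, i.e. $\mathcal{R}o(G)=WAP(G)$. Moreover, every bounded right and left uniformly continuous complex-valued function on $G$ (and hence also every weakly almost periodic function on $G$) can be uniformly approximated by linear combinations of positive definite functions on $G$; in other words, every function in $\mathcal{R}o(G)$ is a Hilbert function, i.e. $\mathcal{R}o(G)=\mathcal{H}(G)$.
   Context: Elements of $\mathrm{Aut}(\mu)$ are invertible measure preserving transformations of $(X,\mu)$, identified when they agree $\mu$-a.e. The weak topology on $G$ is the one for which the Koopman map $T\mapsto U_T$, $U_Tf(x)=f(T^{-1}x)$, is a topological embedding of $G$ into the unitary group of $L_2(\mu)$ with the strong operator topology. For a topological group $G$ with a base $\mathcal{N}$ of neighborhoods of the neutral element, the uniform structures $\mathcal{R}(G)$ and $\mathcal{L}(G)$ have as bases the sets $\{(x,y): xy^{-1}\in U\}$, $U\in\mathcal{N}$, and $\{(x,y): x^{-1}y\in U\}$, $U\in\mathcal{N}$, respectively. - $\mathcal{R}o(G)$ is the algebra of bounded complex-valued functions on $G$ that are both right and left uniformly continuous, i.e. uniformly continuous with respect to both $\mathcal{R}(G)$ and $\mathcal{L}(G)$. The Roelcke compactification of $G$ is the compactification corresponding to $\mathcal{R}o(G)$. - $WAP(G)$ is the algebra of weakly almost periodic complex-valued functions on $G$: bounded continuous functions $f$ whose set of translates under $G$ is relatively weakly compact in the Banach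 space of bounded continuous functions on $G$ with the supremum norm. The WAP compactification of $G$ is the compactification corresponding to $WAP(G)$. - $\mathcal{H}(G)$, the algebra of Hilbert functions on $G$, is the closure in the supremum norm of the algebra of all linear combinations of (continuous) positive definite functions on $G$. For every topological group, $\mathcal{R}o(G)\supseteq WAP(G)\supseteq\mathcal{H}(G)$. *)

theory Defs
  imports "HOL-Probability.Probability" "HOL-Algebra.Group"
begin

section \<open>Function algebras on a topological group\<close>

text \<open>A topological group is given by a group \<open>G\<close> (in the sense of HOL-Algebra) together with a
  topology \<open>T\<close> whose underlying set is \<open>carrier G\<close>. A complex-valued function on the group is
  represented by the total function that vanishes off the carrier, so that equality of functions on
  the group is equality in HOL and the pointwise vector space operations stay inside the
  representation.\<close>

definition functions_on :: "('g, 'b) monoid_scheme \<Rightarrow> ('g \<Rightarrow> complex) set" where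
  "functions_on G = {f. \<forall>x. x \<notin> carrier G \<longrightarrow> f x = 0}"

definition bounded_functions :: "('g, 'b) monoid_scheme \<Rightarrow> ('g \<Rightarrow> complex) set" where
  "bounded_functions G = {f \<in> functions_on G. bounded (f ` carrier G)}"

definition sup_norm :: "('g, 'b) monoid_scheme \<Rightarrow> ('g \<Rightarrow> complex) \<Rightarrow> real" where
  "sup_norm G f = (SUP x\<in>carrier G. cmod (f x))"

subsection \<open>Right and left uniform structures, and the Roelcke algebra\<close>

definition right_uniformity :: "('g, 'b) monoid_scheme \<Rightarrow> 'g topology \<Rightarrow> ('g \<times> 'g) filter" where
  "right_uniformity G T =
    (INF U\<in>{U. openin T U \<and> \<one>\<^bsub>G\<^esub> \<in> U}.
      principal {(x, y). x \<in> carrier G \<and> y \<in> carrier G \<and> x \<otimes>\<^bsub>G\<^esub> inv\<^bsub>G\<^esub> y \<in> U})"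

definition left_uniformity :: "('g, 'b) monoid_scheme \<Rightarrow> 'g topology \<Rightarrow> ('g \<times> 'g) filter" where
  "left_uniformity G T =
    (INF U\<in>{U. openin T U \<and> \<one>\<^bsub>G\<^esub> \<in> U}.
      principal {(x, y). x \<in> carrier G \<and> y \<in> carrier G \<and> inv\<^bsub>G\<^esub> x \<otimes>\<^bsub>G\<^esub> y \<in> U})"

definition uniformly_continuous_wrt :: "('g \<times> 'g) filter \<Rightarrow> ('g \<Rightarrow> complex) \<Rightarrow> bool" where
  "uniformly_continuous_wrt \<U> f \<longleftrightarrow> filterlim (\<lambda>(x, y). (f x, f y)) uniformity \<U>"

definition Roelcke_algebra :: "('g, 'b) monoid_scheme \<Rightarrow> 'g topology \<Rightarrow> ('g \<Rightarrow> complex) set" where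
  "Roelcke_algebra G T =
    {f \<in> bounded_functions G.
      uniformly_continuous_wrt (right_uniformity G T) f \<and>
      uniformly_continuous_wrt (left_uniformity G T) f}"

subsection \<open>Weakly almost periodic functions\<close>

definition bounded_continuous :: "('g, 'b) monoid_scheme \<Rightarrow> 'g topology \<Rightarrow> ('g \<Rightarrow> complex) set" where
  "bounded_continuous G T = {f \<in> bounded_functions G. continuous_map T euclidean f}"

text \<open>The continuous linear functionals on the Banach space of bounded continuous functions. Since
  their values off that space are irrelevant below, they are left unconstrained.\<close>

definition bounded_continuous_dual ::
    "('g, 'b) monoid_scheme \<Rightarrow> 'g topology \<Rightarrow> (('g \<Rightarrow> complex) \<Rightarrow> complex) set" where
  "bounded_continuous_dual G T =
    {\<phi>. (\<forall>f\<in>bounded_continuous G T. \<forall>h\<in>bounded_continuous G T.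
            \<phi> (\<lambda>x. f x + h x) = \<phi> f + \<phi> h) \<and>
         (\<forall>c. \<forall>f\<in>bounded_continuous G T. \<phi> (\<lambda>x. c * f x) = c * \<phi> f) \<and>
         (\<exists>K. \<forall>f\<in>bounded_continuous G T. cmod (\<phi> f) \<le> K * sup_norm G f)}"

definition bounded_continuous_weak ::
    "('g, 'b) monoid_scheme \<Rightarrow> 'g topology \<Rightarrow> ('g \<Rightarrow> complex) topology" where
  "bounded_continuous_weak G T =
    pullback_topology (bounded_continuous G T)
      (\<lambda>f. \<lambda>\<phi>\<in>bounded_continuous_dual G T. \<phi> f)
      (product_topology (\<lambda>_. euclidean) (bounded_continuous_dual G T))"

definition translate :: "('g, 'b) monoid_scheme \<Rightarrow> 'g \<Rightarrow> ('g \<Rightarrow> complex) \<Rightarrow> 'g \<Rightarrow> complex" where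
  "translate G g f = (\<lambda>x. if x \<in> carrier G then f (g \<otimes>\<^bsub>G\<^esub> x) else 0)"

definition WAP_algebra :: "('g, 'b) monoid_scheme \<Rightarrow> 'g topology \<Rightarrow> ('g \<Rightarrow> complex) set" where
  "WAP_algebra G T =
    {f \<in> bounded_continuous G T.
      compactin (bounded_continuous_weak G T)
        (bounded_continuous_weak G T closure_of ((\<lambda>g. translate G g f) ` carrier G))}"

subsection \<open>Hilbert functions\<close>

text \<open>Positive definiteness: all the matrices with entries
  \<open>f (inv (g\<^sub>i) \<otimes> g\<^sub>j)\<close> are positive semidefinite (hence the quadratic form is real).\<close>

definition positive_definite_functions ::
    "('g, 'b) monoid_scheme \<Rightarrow> 'g topology \<Rightarrow> ('g \<Rightarrow> complex) set" where
  "positive_definite_functions G T =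
    {f \<in> functions_on G. continuous_map T euclidean f \<and>
      (\<forall>(n::nat) (g :: nat \<Rightarrow> 'g) (c :: nat \<Rightarrow> complex).
        (\<forall>i<n. g i \<in> carrier G) \<longrightarrow>
        (let q = (\<Sum>i<n. \<Sum>j<n. cnj (c i) * c j * f (inv\<^bsub>G\<^esub> (g i) \<otimes>\<^bsub>G\<^esub> g j))
         in Im q = 0 \<and> 0 \<le> Re q))}"

definition positive_definite_combinations ::
    "('g, 'b) monoid_scheme \<Rightarrow> 'g topology \<Rightarrow> ('g \<Rightarrow> complex) set" where
  "positive_definite_combinations G T =
    {(\<lambda>x. \<Sum>i<n. c i * p i x) | (n::nat) (c :: nat \<Rightarrow> complex) (p :: nat \<Rightarrow> 'g \<Rightarrow> complex).
      \<forall>i<n. p i \<in> positive_definite_functions G T}"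

definition Hilbert_algebra :: "('g, 'b) monoid_scheme \<Rightarrow> 'g topology \<Rightarrow> ('g \<Rightarrow> complex) set" where
  "Hilbert_algebra G T =
    {f \<in> functions_on G.
      \<forall>\<epsilon>>0. \<exists>h\<in>positive_definite_combinations G T. \<forall>x\<in>carrier G. cmod (f x - h x) < \<epsilon>}"

subsection \<open>The compactification corresponding to an algebra of functions\<close>

text \<open>For a closed unital self-adjoint algebra \<open>A\<close> of bounded functions, the corresponding
  compactification is the closure of the image of the group in the product of copies of
  \<open>\<complex>\<close> indexed by \<open>A\<close> (which is the Gelfand space of \<open>A\<close>), together with the
  evaluation map. Two compactifications coincide when they are homeomorphic over the group.\<close>

definition evaluation :: "('g \<Rightarrow> complex) set \<Rightarrow> 'g \<Rightarrow> ('g \<Rightarrow> complex) \<Rightarrow> complex" where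
  "evaluation A x = (\<lambda>f\<in>A. f x)"

definition compactification ::
    "('g, 'b) monoid_scheme \<Rightarrow> ('g \<Rightarrow> complex) set \<Rightarrow> (('g \<Rightarrow> complex) \<Rightarrow> complex) topology" where
  "compactification G A =
    (let P = product_topology (\<lambda>_. euclidean) A
     in subtopology P (P closure_of (evaluation A ` carrier G)))"

definition compactifications_coincide ::
    "('g, 'b) monoid_scheme \<Rightarrow> ('g \<Rightarrow> complex) set \<Rightarrow> ('g \<Rightarrow> complex) set \<Rightarrow> bool" where
  "compactifications_coincide G A B \<longleftrightarrow>
    (\<exists>h. homeomorphic_map (compactification G A) (compactification G B) h \<and>
         (\<forall>x\<in>carrier G. h (evaluation A x) = evaluation B x))"

section \<open>Atomless standard Borel spaces\<close>

definition standard_borel :: "'a measure \<Rightarrow> bool" where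
  "standard_borel M \<longleftrightarrow>
    (\<exists>T. completely_metrizable_space T \<and> second_countable T \<and> topspace T = space M \<and>
         sets M = sigma_sets (space M) {U. openin T U})"

definition atomless :: "'a measure \<Rightarrow> bool" where
  "atomless M \<longleftrightarrow>
    (\<forall>A\<in>sets M. 0 < emeasure M A \<longrightarrow>
      (\<exists>B\<in>sets M. B \<subseteq> A \<and> 0 < emeasure M B \<and> emeasure M B < emeasure M A))"

section \<open>The group of measure preserving automorphisms\<close>

text \<open>The relation of almost everywhere equality on a set \<open>A\<close> of functions on the space of \<open>M\<close>.
  Its classes also identify functions that differ only off \<open>space M\<close>.\<close>

definition ae_rel :: "'a measure \<Rightarrow> ('a \<Rightarrow> 'b) set \<Rightarrow> (('a \<Rightarrow> 'b) \<times> ('a \<Rightarrow> 'b)) set" where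
  "ae_rel M A = {(f, g). f \<in> A \<and> g \<in> A \<and> (AE x in M. f x = g x)}"

definition transformations :: "'a measure \<Rightarrow> ('a \<Rightarrow> 'a) set" where
  "transformations M =
    {t. bij_betw t (space M) (space M) \<and> t \<in> measurable M M \<and>
        inv_into (space M) t \<in> measurable M M \<and> distr M M t = M}"

definition Aut :: "'a measure \<Rightarrow> ('a \<Rightarrow> 'a) set monoid" where
  "Aut M =
    \<lparr>carrier = transformations M // ae_rel M (transformations M),
     mult = (\<lambda>S T. \<Union>s\<in>S. \<Union>t\<in>T. ae_rel M (transformations M) `` {s \<circ> t}),
     one = ae_rel M (transformations M) `` {id}\<rparr>"

subsection \<open>The Koopman representation and the weak topology\<close>

definition square_integrable :: "'a measure \<Rightarrow> ('a \<Rightarrow> complex) set" where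
  "square_integrable M =
    {f \<in> borel_measurable M. integrable M (\<lambda>x. (cmod (f x))\<^sup>2)}"

definition L2 :: "'a measure \<Rightarrow> ('a \<Rightarrow> complex) set set" where
  "L2 M = square_integrable M // ae_rel M (square_integrable M)"

definition L2_dist :: "'a measure \<Rightarrow> ('a \<Rightarrow> complex) set \<Rightarrow> ('a \<Rightarrow> complex) set \<Rightarrow> real" where
  "L2_dist M \<xi> \<eta> =
    sqrt (\<integral>x. (cmod ((SOME f. f \<in> \<xi>) x - (SOME g. g \<in> \<eta>) x))\<^sup>2 \<partial>M)"

definition L2_topology :: "'a measure \<Rightarrow> ('a \<Rightarrow> complex) set topology" where
  "L2_topology M = Metric_space.mtopology (L2 M) (L2_dist M)"

definition Koopman ::
    "'a measure \<Rightarrow> ('a \<Rightarrow> 'a) set \<Rightarrow> ('a \<Rightarrow> complex) set \<Rightarrow> ('a \<Rightarrow> complex) set" where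
  "Koopman M T =
    (\<lambda>\<xi>\<in>L2 M. \<Union>t\<in>T. \<Union>f\<in>\<xi>.
      ae_rel M (square_integrable M) `` {f \<circ> inv_into (space M) t})"

text \<open>The strong operator topology is the topology of pointwise convergence in norm, i.e. the
  restriction of the product topology on all self-maps of \<open>L2 M\<close>. For a standard Borel space the Koopman map is injective, so
  it is an embedding exactly for the topology pulled back along it.\<close>

definition weak_topology :: "'a measure \<Rightarrow> ('a \<Rightarrow> 'a) set topology" where
  "weak_topology M =
    pullback_topology (carrier (Aut M)) (Koopman M)
      (product_topology (\<lambda>_. L2_topology M) (L2 M))"

end

theory Submission
  imports Defs
begin

text \<open>Every function in the Roelcke algebra is Hilbert, every Hilbert function is weakly almost
  periodic, and every weakly almost periodic function is in the Roelcke algebra.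

  The first inclusion is special to \<open>Aut M\<close>. A chart onto the unit interval lets one permute dyadic
  cells by automorphisms, so any two families of disjoint sets with nearly equal measures are matched
  by an automorphism up to small error. Hence, if the numbers \<open>\<mu> (A \<inter> g B)\<close> and \<open>\<mu> (A \<inter> h B)\<close> are
  close for all cells \<open>A\<close>, \<open>B\<close> of a fine partition, then \<open>h = u g v\<close> with \<open>u\<close>, \<open>v\<close> near the identity.
  So a Roelcke uniformly continuous function is almost a continuous function of finitely many numbers
  \<open>\<mu> (A \<inter> g B)\<close>, and Bernstein's approximation makes it a polynomial in these matrix coefficients of
  the Koopman representation.

  The second inclusion is a Banach-Saks argument: along an ultrafilter, suitable averages of translates
  of a positive definite function converge uniformly to the pointwise limit of the translates, so the
  pointwise limit is a weak limit.

  For the third, Grothendieck's double limit property and the Baire category theorem on the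
  pointwise closure of the orbit give a nonempty open set of group elements on which all translates
  oscillate little (Namioka's argument), and this set can be moved to the identity.\<close>

section \<open>Ultrafilters\<close>

text \<open>Ultrafilters on the group replace nets: relative weak compactness of an orbit becomes
  the existence, along each ultrafilter, of one bounded continuous function that all bounded
  functionals see as the limit. The condition is linear in the function and stable under uniform
  limits, so it has to be checked for positive definite functions only.

  Weak almost periodicity is defined by translates on one side, whereas the Roelcke algebra asks for
  both uniformities. The double limit property is symmetric in its two variables and supplies the
  other side.

  Automorphisms are classes, so pointwise arguments use chosen representatives and hold up to null
  sets. This is why sets are compared by the measure of their symmetric difference.

  A Roelcke function is a function of the numbers \<open>\<mu> (A \<inter> g B)\<close> only up to a
  small error. Bernstein weights tolerate this, since they average sampled values. Products of
  positive definite functions enter by multiplication with one coefficient at a time.\<close>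

definition ultrafilter :: "'a filter \<Rightarrow> bool" where
  "ultrafilter U \<longleftrightarrow> U \<noteq> bot \<and> (\<forall>P. eventually P U \<or> eventually (\<lambda>x. \<not> P x) U)"

lemma ultrafilter_not_bot: "ultrafilter U \<Longrightarrow> U \<noteq> bot"
  by (simp add: ultrafilter_def)

lemma ultrafilter_not_eventually:
  "ultrafilter U \<Longrightarrow> \<not> eventually P U \<longleftrightarrow> eventually (\<lambda>x. \<not> P x) U"
  using eventually_conj[of P U "\<lambda>x. \<not> P x"]
  unfolding ultrafilter_def by (metis (full_types) eventually_False eventually_mono)

lemma ultrafilter_filtermap: "ultrafilter U \<Longrightarrow> ultrafilter (filtermap f U)"
  unfolding ultrafilter_def filtermap_bot_iff eventually_filtermap by blast

text \<open>Zorn's lemma among the proper filters below \<open>F\<close>, with finer filters counted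
  as larger: an eventual property of the infimum of a chain already holds eventually in one member,
  so the infimum stays proper. A minimal proper filter is unchanged by restriction to a set that it
  meets, hence it decides every predicate.\<close>

lemma ultrafilter_exists:
  assumes "F \<noteq> bot"
  obtains U where "U \<le> F" "ultrafilter U"
proof -
  let ?A = "{G. G \<le> F \<and> G \<noteq> bot}"
  have "\<exists>m\<in>?A. \<forall>a\<in>?A. m \<ge> a \<longrightarrow> a = m"
  proof (rule predicate_Zorn)
    show "partial_order_on ?A (relation_of (\<ge>) ?A)"
      by (rule partial_order_on_relation_ofI) auto
  next
    fix C assume C: "C \<in> Chains (relation_of (\<ge>) ?A)"
    show "\<exists>u\<in>?A. \<forall>a\<in>C. a \<ge> u"
    proof (cases "C = {}")
      case True
      then show ?thesis using assms by auto
    next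
      case False
      have CA: "C \<subseteq> ?A"
        using C unfolding Chains_def relation_of_def by blast
      have "eventually (\<lambda>_. False) (Inf C) \<longleftrightarrow> (\<exists>b\<in>C. eventually (\<lambda>_. False) b)"
      proof (rule eventually_Inf_base[OF False])
        fix G H assume "G \<in> C" "H \<in> C"
        then have "G \<le> H \<or> H \<le> G"
          using C unfolding Chains_def relation_of_def by blast
        then show "\<exists>x\<in>C. x \<le> inf G H"
          using \<open>G \<in> C\<close> \<open>H \<in> C\<close> by (auto simp: inf.absorb1 inf.absorb2)
      qed
      then have "Inf C \<noteq> bot"
        using CA by (auto simp: eventually_False)
      moreover have "Inf C \<le> F"
      proof -
        obtain G where "G \<in> C" using False by blast
        then have "Inf C \<le> G" "G \<le> F" using CA by (auto intro: Inf_lower)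
        then show ?thesis by (rule order_trans)
      qed
      ultimately have "Inf C \<in> ?A" by blast
      moreover have "\<forall>a\<in>C. Inf C \<le> a" by (simp add: Inf_lower)
      ultimately show ?thesis by (rule rev_bexI)
    qed
  qed
  then obtain U where U: "U \<le> F" "U \<noteq> bot"
    and min: "\<And>G. G \<le> F \<Longrightarrow> G \<noteq> bot \<Longrightarrow> G \<le> U \<Longrightarrow> G = U"
    by auto
  have "eventually P U \<or> eventually (\<lambda>x. \<not> P x) U" for P
  proof (rule disjCI)
    assume "\<not> eventually (\<lambda>x. \<not> P x) U"
    then have "inf U (principal {x. P x}) \<noteq> bot"
      by (auto simp: trivial_limit_def eventually_inf_principal)
    then have "inf U (principal {x. P x}) = U"
      using min U by (meson inf_le1 order_trans)
    then show "eventually P U"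
      by (metis eventually_principal inf_le2 le_filter_def mem_Collect_eq)
  qed
  with U(2) have "ultrafilter U" unfolding ultrafilter_def by blast
  with U(1) show thesis by (rule that)
qed

text \<open>An ultrafilter that does not converge to \<open>k\<close> eventually avoids a
  neighbourhood of \<open>k\<close>; finitely many of these neighbourhoods cover \<open>K\<close>,
  and all of them cannot be avoided.\<close>

lemma compactin_ultrafilter_limit:
  assumes "compactin X K" "ultrafilter U" "eventually (\<lambda>a. u a \<in> K) U"
  obtains k where "k \<in> K" "limitin X u k U"
proof (rule ccontr)
  assume "\<not> thesis"
  then have no: "\<And>k. k \<in> K \<Longrightarrow> \<not> limitin X u k U" using that by blast
  have KX: "K \<subseteq> topspace X" using assms(1) compactin_subset_topspace by blast
  have "\<exists>N. openin X N \<and> k \<in> N \<and> eventually (\<lambda>a. u a \<notin> N) U" if "k \<in> K" for k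
    using no[OF that] KX that ultrafilter_not_eventually[OF assms(2)]
    unfolding limitin_def by auto
  then obtain N where N: "\<And>k. k \<in> K \<Longrightarrow> openin X (N k) \<and> k \<in> N k \<and> eventually (\<lambda>a. u a \<notin> N k) U"
    by metis
  have "\<exists>\<F>. finite \<F> \<and> \<F> \<subseteq> N ` K \<and> K \<subseteq> \<Union>\<F>"
    using assms(1) N by (intro compactinD) auto
  then obtain \<F> where F: "finite \<F>" "\<F> \<subseteq> N ` K" "K \<subseteq> \<Union>\<F>" by blast
  have "eventually (\<lambda>a. \<forall>S\<in>\<F>. u a \<notin> S) U"
    using F N by (intro eventually_ball_finite) auto
  with assms(3) have "eventually (\<lambda>a. False) U"
    by eventually_elim (use F in auto)
  then show False
    using assms(2) by (simp add: ultrafilter_def)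
qed

lemma bounded_ultrafilter_limit:
  fixes u :: "'a \<Rightarrow> complex"
  assumes "ultrafilter U" "eventually (\<lambda>a. cmod (u a) \<le> B) U"
  obtains l where "(u \<longlongrightarrow> l) U"
proof -
  have "compactin euclidean (cball (0::complex) B)" by simp
  moreover have "eventually (\<lambda>a. u a \<in> cball 0 B) U" using assms(2) by simp
  ultimately show thesis
    using that compactin_ultrafilter_limit assms(1) by (metis limitin_canonical_iff)
qed

lemma ultrafilter_Lim:
  fixes u :: "'a \<Rightarrow> complex"
  assumes "ultrafilter U" "eventually (\<lambda>a. cmod (u a) \<le> B) U"
  shows "(u \<longlongrightarrow> Lim U u) U"
  using assms by (metis bounded_ultrafilter_limit tendsto_Lim ultrafilter_not_bot)

text \<open>The ultrafilter lives on the index set \<open>A\<close> and not on the image, so that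
  other families indexed by \<open>A\<close> can be followed along it.\<close>

lemma closure_of_ultrafilter:
  assumes "z \<in> X closure_of (f ` A)"
  obtains U where "ultrafilter U" "eventually (\<lambda>a. a \<in> A) U" "limitin X f z U"
proof -
  let ?F = "inf (filtercomap f (nhdsin X z)) (principal A)"
  have zX: "z \<in> topspace X" using assms by (meson in_closure_of)
  have "?F \<noteq> bot"
  proof
    assume "?F = bot"
    then have "eventually (\<lambda>a. a \<notin> A) (filtercomap f (nhdsin X z))"
      by (simp add: trivial_limit_def eventually_inf_principal)
    then obtain S where "openin X S" "z \<in> S" "\<And>a. f a \<in> S \<Longrightarrow> a \<notin> A"
      using zX by (auto simp: eventually_filtercomap eventually_nhdsin)
    then show False using assms by (auto simp: in_closure_of)
  qed
  then obtain U where U: "U \<le> ?F" "ultrafilter U" using ultrafilter_exists by blast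
  have ev: "eventually P U" if "eventually P ?F" for P
    using U(1) that by (simp add: le_filter_def)
  have "eventually (\<lambda>a. a \<in> A) U"
    by (rule ev) (simp add: eventually_inf_principal)
  moreover have "limitin X f z U"
    unfolding limitin_def
  proof (intro conjI allI impI zX)
    fix S assume "openin X S \<and> z \<in> S"
    then have "eventually (\<lambda>y. y \<in> S) (nhdsin X z)"
      unfolding eventually_nhdsin by blast
    then have "eventually (\<lambda>a. f a \<in> S) (filtercomap f (nhdsin X z))"
      by (rule eventually_filtercomapI)
    then show "eventually (\<lambda>a. f a \<in> S) U"
      by (rule ev[OF filter_leD[OF inf_le1]])
  qed
  ultimately show thesis using that U by blast
qed

text \<open>Serves to bring compactness of a set of evaluations back to the weak topology: open sets
  of the pullback are preimages, so a cover of \<open>S\<close> lifts to a cover of its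
  image.\<close>

lemma compactin_pullback_topology:
  assumes "compactin P (f ` S)" "S \<subseteq> A"
  shows "compactin (pullback_topology A f P) S"
proof -
  have "S \<subseteq> topspace (pullback_topology A f P)"
    using assms compactin_subset_topspace[OF assms(1)] by (auto simp: topspace_pullback_topology)
  moreover have "\<exists>\<F>. finite \<F> \<and> \<F> \<subseteq> \<U> \<and> S \<subseteq> \<Union>\<F>"
    if U: "\<And>V. V \<in> \<U> \<Longrightarrow> openin (pullback_topology A f P) V" "S \<subseteq> \<Union>\<U>" for \<U>
  proof -
    have "\<forall>V\<in>\<U>. \<exists>W. openin P W \<and> V = f -` W \<inter> A"
      using U(1) by (auto simp: openin_pullback_topology)
    then obtain W where W: "\<And>V. V \<in> \<U> \<Longrightarrow> openin P (W V) \<and> V = f -` W V \<inter> A" by metis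
    have "\<exists>\<F>. finite \<F> \<and> \<F> \<subseteq> W ` \<U> \<and> f ` S \<subseteq> \<Union>\<F>"
      using assms(1)
    proof (rule compactinD)
      show "f ` S \<subseteq> \<Union>(W ` \<U>)" using U(2) W by blast
    qed (use W in auto)
    then obtain \<V> where V: "finite \<V>" "\<V> \<subseteq> W ` \<U>" "f ` S \<subseteq> \<Union>\<V>" by blast
    obtain \<F> where F: "finite \<F>" "\<F> \<subseteq> \<U>" "\<V> = W ` \<F>"
      using finite_subset_image[OF V(1,2)] by blast
    note F = F(1,2) V(3)[unfolded F(3)]
    have "x \<in> \<Union>\<F>" if "x \<in> S" for x
    proof -
      have "f x \<in> \<Union>(W ` \<F>)" using F(3) imageI[OF that] by (rule subsetD)
      then obtain V where V: "V \<in> \<F>" "f x \<in> W V" by (rule UN_E)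
      then have "V \<in> \<U>" using F(2) by blast
      have "x \<in> f -` W V \<inter> A" using V that assms(2) by blast
      then have "x \<in> V" using W[OF \<open>V \<in> \<U>\<close>] by simp
      then show ?thesis using V by blast
    qed
    then have "S \<subseteq> \<Union>\<F>" by blast
    with F show ?thesis by blast
  qed
  ultimately show ?thesis unfolding compactin_def by presburger
qed

section \<open>Weakly almost periodic functions\<close>

lemma continuous_map_euclidean_compose:
  assumes "continuous_map X euclidean f" "continuous_on UNIV g"
  shows "continuous_map X euclidean (\<lambda>x. g (f x))"
  using continuous_map_compose[OF assms(1), of euclidean g] assms(2) by (simp add: o_def)

locale semitopological_group = group G for G (structure) +
  fixes T :: "'a topology"
  assumes topspace_eq: "topspace T = carrier G"
    and continuous_left_mult: "a \<in> carrier G \<Longrightarrow> continuous_map T T (\<lambda>x. a \<otimes> x)"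
    and continuous_right_mult: "a \<in> carrier G \<Longrightarrow> continuous_map T T (\<lambda>x. x \<otimes> a)"
begin

abbreviation "BC \<equiv> bounded_continuous G T"
abbreviation "BC_dual \<equiv> bounded_continuous_dual G T"

lemma continuous_map_complex_iff:
  fixes f :: "'a \<Rightarrow> complex"
  shows "continuous_map T euclidean f \<longleftrightarrow>
    (\<forall>x\<in>carrier G. \<forall>e>0. \<exists>U. openin T U \<and> x \<in> U \<and> (\<forall>y\<in>U. cmod (f x - f y) < e))"
  using Met_TC.continuous_map_to_metric[of T f]
  by (simp add: topspace_eq dist_norm)

lemma BC_iff:
  "f \<in> BC \<longleftrightarrow> (\<forall>x. x \<notin> carrier G \<longrightarrow> f x = 0) \<and> (\<exists>B. \<forall>x\<in>carrier G. cmod (f x) \<le> B)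
     \<and> continuous_map T euclidean f"
  by (auto simp: bounded_continuous_def bounded_functions_def functions_on_def bounded_iff)

lemma BC_bounded: "f \<in> BC \<Longrightarrow> \<exists>B. \<forall>x. cmod (f x) \<le> B"
  unfolding BC_iff by (metis norm_zero norm_ge_zero order_trans nle_le)

lemma BC_add: "f \<in> BC \<Longrightarrow> h \<in> BC \<Longrightarrow> (\<lambda>x. f x + h x) \<in> BC"
  unfolding BC_iff
  by (auto intro!: continuous_map_add) (meson add_mono norm_triangle_le)

lemma BC_scale: "f \<in> BC \<Longrightarrow> (\<lambda>x. c * f x) \<in> BC"
proof -
  assume f: "f \<in> BC"
  then obtain B where "\<And>x. cmod (f x) \<le> B" using BC_bounded by blast
  then have "\<forall>x. cmod (c * f x) \<le> cmod c * B" by (simp add: norm_mult mult_left_mono)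
  moreover have "continuous_map T euclidean (\<lambda>x. c * f x)"
    using f continuous_map_euclidean_compose[of T f "\<lambda>z. c * z"] continuous_on_mult_left[OF continuous_on_id]
    unfolding BC_iff by blast
  ultimately show ?thesis using f unfolding BC_iff by auto
qed

lemma BC_diff: "f \<in> BC \<Longrightarrow> h \<in> BC \<Longrightarrow> (\<lambda>x. f x - h x) \<in> BC"
  using BC_add[of f "\<lambda>x. (-1) * h x"] BC_scale[of h "-1"] by simp

lemma BC_zero: "(\<lambda>x. 0) \<in> BC"
  unfolding BC_iff by auto

lemma BC_sum: "(\<And>i. i < n \<Longrightarrow> f i \<in> BC) \<Longrightarrow> (\<lambda>x. \<Sum>i<(n::nat). c i * f i x) \<in> BC"
  by (induction n) (simp_all add: BC_zero BC_add BC_scale)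

lemma BC_translate: "f \<in> BC \<Longrightarrow> g \<in> carrier G \<Longrightarrow> translate G g f \<in> BC"
proof -
  assume f: "f \<in> BC" and g: "g \<in> carrier G"
  have "continuous_map T euclidean (f \<circ> (\<lambda>x. g \<otimes> x))"
    using f continuous_left_mult[OF g] continuous_map_compose unfolding BC_iff by blast
  then have "continuous_map T euclidean (translate G g f)"
    by (rule continuous_map_eq) (auto simp: translate_def topspace_eq)
  then show ?thesis
    using f g unfolding BC_iff by (auto simp: translate_def)
qed

lemma BC_uniform_limit:
  assumes "\<And>x. x \<notin> carrier G \<Longrightarrow> f x = 0"
    and "\<And>e. e > 0 \<Longrightarrow> \<exists>h\<in>BC. \<forall>x\<in>carrier G. cmod (f x - h x) < e"
  shows "f \<in> BC"
proof -
  obtain h where h: "h \<in> BC" "\<And>x. x \<in> carrier G \<Longrightarrow> cmod (f x - h x) < 1"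
    using assms(2)[of 1] by auto
  obtain B where B: "\<And>x. cmod (h x) \<le> B" using BC_bounded[OF h(1)] by auto
  have bound: "cmod (f x) \<le> B + 1" if "x \<in> carrier G" for x
    using norm_triangle_ineq2[of "f x" "h x"] B[of x] h(2)[OF that] by linarith
  have "\<exists>U. openin T U \<and> x \<in> U \<and> (\<forall>y\<in>U. cmod (f x - f y) < e)"
    if x: "x \<in> carrier G" and e: "e > 0" for x and e :: real
  proof -
    obtain h where h: "h \<in> BC" "\<And>x. x \<in> carrier G \<Longrightarrow> cmod (f x - h x) < e/3"
      using assms(2)[of "e/3"] e by auto
    obtain U where U: "openin T U" "x \<in> U" "\<And>y. y \<in> U \<Longrightarrow> cmod (h x - h y) < e/3"
      using h(1) x e unfolding BC_iff continuous_map_complex_iff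
      by (metis zero_less_divide_iff zero_less_numeral)
    have "cmod (f x - f y) < e" if y: "y \<in> U" for y
    proof -
      have "y \<in> carrier G" using U(1) y openin_subset topspace_eq by blast
      then have "cmod (f y - h y) < e/3" using h by blast
      moreover have "cmod (f x - f y) \<le> cmod (f x - h x) + cmod (h x - h y) + cmod (f y - h y)"
        by (smt (verit, ccfv_SIG) norm_diff_triangle_ineq norm_minus_commute
            add_diff_cancel_left' diff_add_cancel norm_triangle_ineq4 norm_triangle_sub)
      ultimately show ?thesis using U(3)[OF y] h(2)[OF x] by linarith
    qed
    then show ?thesis using U by blast
  qed
  then show ?thesis
    unfolding BC_iff continuous_map_complex_iff using assms(1) bound by blast
qed

section \<open>Bounded functionals on the bounded continuous functions\<close>

lemma dual_add: "\<phi> \<in> BC_dual \<Longrightarrow> f \<in> BC \<Longrightarrow> h \<in> BC \<Longrightarrow> \<phi> (\<lambda>x. f x + h x) = \<phi> f + \<phi> h"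
  by (simp add: bounded_continuous_dual_def)

lemma dual_scale: "\<phi> \<in> BC_dual \<Longrightarrow> f \<in> BC \<Longrightarrow> \<phi> (\<lambda>x. c * f x) = c * \<phi> f"
  by (simp add: bounded_continuous_dual_def)

lemma dual_diff: "\<phi> \<in> BC_dual \<Longrightarrow> f \<in> BC \<Longrightarrow> h \<in> BC \<Longrightarrow> \<phi> (\<lambda>x. f x - h x) = \<phi> f - \<phi> h"
  using dual_add[of \<phi> f "\<lambda>x. (-1) * h x"] dual_scale[of \<phi> h "-1"] BC_scale[of h "-1"] by simp

lemma dual_zero: "\<phi> \<in> BC_dual \<Longrightarrow> \<phi> (\<lambda>x. 0) = 0"
  using dual_scale[of \<phi> "\<lambda>x. 0" 0] BC_zero by simp

lemma dual_sum:
  "\<phi> \<in> BC_dual \<Longrightarrow> (\<And>i. i < n \<Longrightarrow> f i \<in> BC) \<Longrightarrow>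
    \<phi> (\<lambda>x. \<Sum>i<(n::nat). c i * f i x) = (\<Sum>i<n. c i * \<phi> (f i))"
proof (induction n)
  case (Suc n)
  then have "\<phi> (\<lambda>x. (\<Sum>i<n. c i * f i x) + c n * f n x) = (\<Sum>i<n. c i * \<phi> (f i)) + c n * \<phi> (f n)"
    by (subst dual_add) (auto intro!: BC_sum BC_scale simp: dual_scale)
  then show ?case by simp
qed (simp add: dual_zero)

lemma sup_norm_le: "(\<And>x. x \<in> carrier G \<Longrightarrow> cmod (f x) \<le> B) \<Longrightarrow> sup_norm G f \<le> B"
  unfolding sup_norm_def by (rule cSUP_least) auto

lemma le_sup_norm: "f \<in> BC \<Longrightarrow> x \<in> carrier G \<Longrightarrow> cmod (f x) \<le> sup_norm G f"
  unfolding sup_norm_def using BC_bounded[of f]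
  by (intro cSUP_upper) (auto simp: bdd_above_def)

text \<open>\<open>K\<close> is made positive so that later estimates can divide by it, and the
  supremum norm gives way to an arbitrary pointwise bound.\<close>

lemma dual_bound:
  assumes "\<phi> \<in> BC_dual"
  obtains K where "K > 0"
    "\<And>f B. f \<in> BC \<Longrightarrow> (\<And>x. x \<in> carrier G \<Longrightarrow> cmod (f x) \<le> B) \<Longrightarrow> cmod (\<phi> f) \<le> K * B"
proof -
  have "\<exists>K. \<forall>f\<in>BC. cmod (\<phi> f) \<le> K * sup_norm G f"
    using assms by (simp add: bounded_continuous_dual_def)
  then obtain K where K: "\<And>f. f \<in> BC \<Longrightarrow> cmod (\<phi> f) \<le> K * sup_norm G f" by blast
  have "cmod (\<phi> f) \<le> (\<bar>K\<bar> + 1) * B"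
    if f: "f \<in> BC" and B: "\<And>x. x \<in> carrier G \<Longrightarrow> cmod (f x) \<le> B" for f B
  proof -
    have s: "0 \<le> sup_norm G f" "sup_norm G f \<le> B"
      using le_sup_norm[OF f one_closed] sup_norm_le[of f B] B norm_ge_zero order_trans by blast+
    have "cmod (\<phi> f) \<le> K * sup_norm G f" by (rule K[OF f])
    also have "\<dots> \<le> (\<bar>K\<bar> + 1) * sup_norm G f" using s by (intro mult_right_mono) auto
    also have "\<dots> \<le> (\<bar>K\<bar> + 1) * B" using s by (intro mult_left_mono) auto
    finally show ?thesis .
  qed
  then show thesis using that[of "\<bar>K\<bar> + 1"] by auto
qed

lemma evaluation_in_dual: "x \<in> carrier G \<Longrightarrow> (\<lambda>f. f x) \<in> BC_dual"
  using le_sup_norm by (auto simp: bounded_continuous_dual_def intro!: exI[of _ 1])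

lemma BC_tendsto_Lim: "f \<in> BC \<Longrightarrow> ultrafilter U \<Longrightarrow> (f \<longlongrightarrow> Lim U f) U"
  using BC_bounded[of f] ultrafilter_Lim[of U f] by (metis always_eventually)

text \<open>Evaluation at an ideal point of the group. Testing weak limits of translates against it
  is what yields the interchange of limits in \<open>double_limit\<close>.\<close>

lemma Lim_in_dual:
  assumes U: "ultrafilter U" "eventually (\<lambda>x. x \<in> carrier G) U"
  shows "(\<lambda>f. Lim U f) \<in> BC_dual"
proof -
  have nb: "U \<noteq> bot" using U ultrafilter_not_bot by blast
  have "cmod (Lim U f) \<le> 1 * sup_norm G f" if "f \<in> BC" for f
  proof -
    have "eventually (\<lambda>x. cmod (f x) \<le> sup_norm G f) U"
      using U(2) by eventually_elim (use le_sup_norm that in auto)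
    then show ?thesis
      using tendsto_upperbound[OF tendsto_norm[OF BC_tendsto_Lim[OF that U(1)]] _ nb] by simp
  qed
  moreover have "Lim U (\<lambda>x. f x + h x) = Lim U f + Lim U h" if "f \<in> BC" "h \<in> BC" for f h
    by (intro tendsto_Lim nb tendsto_add BC_tendsto_Lim that U)
  moreover have "Lim U (\<lambda>x. c * f x) = c * Lim U f" if "f \<in> BC" for f c
    by (intro tendsto_Lim nb tendsto_mult tendsto_const BC_tendsto_Lim that U)
  ultimately show ?thesis
    unfolding bounded_continuous_dual_def by blast
qed

text \<open>Relative weak compactness of the orbit, read along ultrafilters on the group: a limit
  always exists in the bidual, and the point is that some \<open>k\<close> in \<open>BC\<close>
  represents it. With the group element as variable, limits for several functions can be taken along
  one ultrafilter and added.\<close>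

definition orbit_map_converges :: "('a \<Rightarrow> complex) \<Rightarrow> bool" where
  "orbit_map_converges f \<longleftrightarrow>
    (\<forall>U. ultrafilter U \<longrightarrow> eventually (\<lambda>h. h \<in> carrier G) U \<longrightarrow>
      (\<exists>k\<in>BC. \<forall>\<phi>\<in>BC_dual. ((\<lambda>h. \<phi> (translate G h f)) \<longlongrightarrow> \<phi> k) U))"

lemma weak_openin_eval:
  "\<phi> \<in> BC_dual \<Longrightarrow> open S \<Longrightarrow> openin (bounded_continuous_weak G T) {f \<in> BC. \<phi> f \<in> S}"
proof -
  assume phi: "\<phi> \<in> BC_dual" and S: "open S"
  let ?P = "product_topology (\<lambda>_. euclidean :: complex topology) BC_dual"
  have "openin ?P {z \<in> topspace ?P. z \<phi> \<in> S}"
    using S by (intro openin_continuous_map_preimage[OF continuous_map_product_projection[OF phi]]) simp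
  then show ?thesis
    unfolding bounded_continuous_weak_def openin_pullback_topology
    by (rule exI[of _ "{z \<in> topspace ?P. z \<phi> \<in> S}", OF conjI]) (use phi in auto)
qed

lemma topspace_weak: "topspace (bounded_continuous_weak G T) = BC"
  by (auto simp: bounded_continuous_weak_def topspace_pullback_topology)

text \<open>The weak topology is pulled back by evaluation \<open>?J\<close> from a product of
  complex planes. There the closure of the orbit is compact, since it lies in a product of discs;
  \<open>orbit_map_converges\<close> says that this closure consists of evaluations of elements of
  \<open>BC\<close>.\<close>

lemma WAP_iff: "f \<in> WAP_algebra G T \<longleftrightarrow> f \<in> BC \<and> orbit_map_converges f"
proof (intro iffI conjI)
  let ?W = "bounded_continuous_weak G T"
  let ?O = "(\<lambda>g. translate G g f) ` carrier G"
  assume f: "f \<in> WAP_algebra G T"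
  then show fBC: "f \<in> BC" by (simp add: WAP_algebra_def)
  have comp: "compactin ?W (?W closure_of ?O)" using f by (simp add: WAP_algebra_def)
  have sub: "?O \<subseteq> ?W closure_of ?O"
    by (rule closure_of_subset) (auto simp: topspace_weak fBC BC_translate)
  show "orbit_map_converges f"
    unfolding orbit_map_converges_def
  proof (intro allI impI)
    fix U assume U: "ultrafilter U" "eventually (\<lambda>h. h \<in> carrier G) U"
    have "eventually (\<lambda>h. translate G h f \<in> ?W closure_of ?O) U"
      using U(2) by eventually_elim (use sub in blast)
    then obtain k where "k \<in> ?W closure_of ?O" and k: "limitin ?W (\<lambda>h. translate G h f) k U"
      using compactin_ultrafilter_limit[OF comp U(1), of "\<lambda>h. translate G h f"] by blast
    then have "k \<in> BC" by (simp add: limitin_def topspace_weak)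
    moreover have "((\<lambda>h. \<phi> (translate G h f)) \<longlongrightarrow> \<phi> k) U" if "\<phi> \<in> BC_dual" for \<phi>
    proof (rule topological_tendstoI)
      fix S assume S: "open S" "\<phi> k \<in> S"
      then have "eventually (\<lambda>h. translate G h f \<in> {f \<in> BC. \<phi> f \<in> S}) U"
        using k weak_openin_eval[OF that S(1)] \<open>k \<in> BC\<close> by (auto simp: limitin_def)
      then show "eventually (\<lambda>h. \<phi> (translate G h f) \<in> S) U"
        by (rule eventually_mono) auto
    qed
    ultimately show "\<exists>k\<in>BC. \<forall>\<phi>\<in>BC_dual. ((\<lambda>h. \<phi> (translate G h f)) \<longlongrightarrow> \<phi> k) U"
      by blast
  qed
next
  assume "f \<in> BC \<and> orbit_map_converges f"
  then have fBC: "f \<in> BC" and conv: "orbit_map_converges f" by auto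
  let ?W = "bounded_continuous_weak G T"
  let ?O = "(\<lambda>g. translate G g f) ` carrier G"
  let ?P = "product_topology (\<lambda>_. euclidean :: complex topology) BC_dual"
  let ?J = "\<lambda>f. \<lambda>\<phi>\<in>BC_dual. \<phi> f"
  have JO: "?J ` ?O \<subseteq> topspace ?P" by auto
  obtain B where B: "\<And>x. cmod (f x) \<le> B" using BC_bounded[OF fBC] by blast
  have "\<exists>C. \<forall>h\<in>carrier G. cmod (\<phi> (translate G h f)) \<le> C" if phi: "\<phi> \<in> BC_dual" for \<phi>
  proof -
    obtain K where "K > 0"
      "\<And>f B. f \<in> BC \<Longrightarrow> (\<And>x. x \<in> carrier G \<Longrightarrow> cmod (f x) \<le> B) \<Longrightarrow> cmod (\<phi> f) \<le> K * B"
      using dual_bound[OF phi] by blast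
    note K = this(2)
    have "\<forall>h\<in>carrier G. cmod (\<phi> (translate G h f)) \<le> K * B"
      by (intro ballI K BC_translate[OF fBC]) (simp_all add: translate_def B)
    then show ?thesis by blast
  qed
  then obtain C where C: "\<And>\<phi> h. \<phi> \<in> BC_dual \<Longrightarrow> h \<in> carrier G \<Longrightarrow> cmod (\<phi> (translate G h f)) \<le> C \<phi>"
    by metis
  have cpt: "compactin ?P (\<Pi>\<^sub>E \<phi>\<in>BC_dual. cball 0 (C \<phi>))"
    by (simp add: compactin_PiE)
  have "?P closure_of (?J ` ?O) \<subseteq> (\<Pi>\<^sub>E \<phi>\<in>BC_dual. cball 0 (C \<phi>))"
    by (intro closure_of_minimal) (auto simp: C closedin_product_topology)
  then have cl: "compactin ?P (?P closure_of (?J ` ?O))"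
    by (intro closed_compactin[OF cpt]) auto
  have inJ: "?P closure_of (?J ` ?O) \<subseteq> ?J ` BC"
  proof
    fix z assume z: "z \<in> ?P closure_of (?J ` ?O)"
    then have "z \<in> ?P closure_of ((\<lambda>g. ?J (translate G g f)) ` carrier G)"
      by (simp add: image_image)
    then obtain U where U: "ultrafilter U" "eventually (\<lambda>a. a \<in> carrier G) U"
      and lim: "limitin ?P (\<lambda>g. ?J (translate G g f)) z U"
      by (rule closure_of_ultrafilter)
    obtain k where k: "k \<in> BC" "\<And>\<phi>. \<phi> \<in> BC_dual \<Longrightarrow> ((\<lambda>h. \<phi> (translate G h f)) \<longlongrightarrow> \<phi> k) U"
      using conv U unfolding orbit_map_converges_def by blast
    have "z \<phi> = \<phi> k" if "\<phi> \<in> BC_dual" for \<phi>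
    proof -
      have "((\<lambda>h. \<phi> (translate G h f)) \<longlongrightarrow> z \<phi>) U"
        using lim that unfolding limitin_componentwise by auto
      then show ?thesis
        using k(2)[OF that] tendsto_unique U(1) ultrafilter_not_bot by blast
    qed
    moreover have "z \<in> extensional BC_dual"
      using z closure_of_subset_topspace[of ?P] by (auto simp: PiE_def)
    ultimately have "z = ?J k" by (auto simp: extensional_def)
    then show "z \<in> ?J ` BC" using k(1) by blast
  qed
  \<comment> \<open>By \<open>inJ\<close> every point of the closure is an evaluation, so closing up
    before or after evaluation gives the same set.\<close>
  have "?J ` (?W closure_of ?O) = ?P closure_of (?J ` ?O)"
  proof (intro equalityI subsetI)
    fix z assume "z \<in> ?J ` (?W closure_of ?O)"
    then obtain k where k: "k \<in> ?W closure_of ?O" "z = ?J k" by blast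
    have "continuous_map ?W ?P ?J"
      unfolding bounded_continuous_weak_def using continuous_map_pullback[of ?P ?P id BC ?J] by simp
    then show "z \<in> ?P closure_of (?J ` ?O)"
      using k continuous_map_image_closure_subset[of ?W ?P ?J ?O] by blast
  next
    fix z assume z: "z \<in> ?P closure_of (?J ` ?O)"
    then obtain k where k: "k \<in> BC" "z = ?J k" using inJ by blast
    have "k \<in> ?W closure_of ?O"
      unfolding in_closure_of topspace_weak
    proof (intro conjI allI impI k(1))
      fix V assume V: "k \<in> V \<and> openin ?W V"
      then obtain S where S: "openin ?P S" "V = ?J -` S \<inter> BC"
        unfolding bounded_continuous_weak_def openin_pullback_topology by blast
      then have "z \<in> S" using V k by auto
      then obtain h where "h \<in> carrier G" "?J (translate G h f) \<in> S"
        using z S(1) unfolding in_closure_of by blast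
      then show "\<exists>y. y \<in> ?O \<and> y \<in> V"
        using S(2) BC_translate[OF fBC] by blast
    qed
    then show "z \<in> ?J ` (?W closure_of ?O)" using k by blast
  qed
  then have "compactin ?W (?W closure_of ?O)"
    using cl closure_of_subset_topspace[of ?W ?O] topspace_weak
    unfolding bounded_continuous_weak_def
    by (intro compactin_pullback_topology) auto
  then show "f \<in> WAP_algebra G T"
    using fBC by (simp add: WAP_algebra_def)
qed

end

section \<open>Positive definite functions are weakly almost periodic\<close>

lemma sum_lessThan_add:
  fixes f :: "nat \<Rightarrow> 'b::comm_monoid_add"
  shows "(\<Sum>i<m + n. f i) = (\<Sum>i<m. f i) + (\<Sum>i<n. f (m + i))"
  by (induction n) (simp_all add: add.assoc)

text \<open>The terms are chosen one after another: each has to meet finitely many eventual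
  conditions, set by \<open>H\<close> and by its predecessors. The set \<open>H\<close> lets a
  second sequence continue a first one.\<close>

lemma eventually_sequence:
  assumes "F \<noteq> bot" "eventually E F" "\<And>g. E g \<Longrightarrow> eventually (R g) F" "finite H"
    "\<And>g. g \<in> H \<Longrightarrow> eventually (R g) F"
  shows "\<exists>h::nat \<Rightarrow> 'b. (\<forall>i<n. E (h i) \<and> (\<forall>g\<in>H. R g (h i))) \<and> (\<forall>j<n. \<forall>i<j. R (h i) (h j))"
proof (induction n)
  case (Suc n)
  then obtain h where h: "\<And>i. i < n \<Longrightarrow> E (h i)" "\<And>i g. i < n \<Longrightarrow> g \<in> H \<Longrightarrow> R g (h i)"
    "\<And>i j. j < n \<Longrightarrow> i < j \<Longrightarrow> R (h i) (h j)" by blast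
  have "eventually (\<lambda>y. \<forall>g\<in>H. R g y) F" "eventually (\<lambda>y. \<forall>i\<in>{..<n}. R (h i) y) F"
    by (intro eventually_ball_finite ballI assms h; simp)+
  with assms(2) have "eventually (\<lambda>y. E y \<and> (\<forall>g\<in>H. R g y) \<and> (\<forall>i\<in>{..<n}. R (h i) y)) F"
    by eventually_elim blast
  then obtain y where "E y \<and> (\<forall>g\<in>H. R g y) \<and> (\<forall>i\<in>{..<n}. R (h i) y)"
    using eventually_happens assms(1) by blast
  then show ?case
    using h by (intro exI[of _ "h(n := y)"]) (auto simp: less_Suc_eq)
qed simp

context semitopological_group
begin

abbreviation "PD \<equiv> positive_definite_functions G T"

lemma PD_form:
  assumes "p \<in> PD" "\<And>i. i < n \<Longrightarrow> g i \<in> carrier G"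
  shows "Im (\<Sum>i<(n::nat). \<Sum>j<n. cnj (c i) * c j * p (inv (g i) \<otimes> g j)) = 0"
    and "0 \<le> Re (\<Sum>i<n. \<Sum>j<n. cnj (c i) * c j * p (inv (g i) \<otimes> g j))"
proof -
  have "\<forall>(n::nat) (g :: nat \<Rightarrow> 'a) (c :: nat \<Rightarrow> complex). (\<forall>i<n. g i \<in> carrier G) \<longrightarrow>
      (let q = (\<Sum>i<n. \<Sum>j<n. cnj (c i) * c j * p (inv (g i) \<otimes> g j)) in Im q = 0 \<and> 0 \<le> Re q)"
    using assms(1) by (simp add: positive_definite_functions_def)
  from this[rule_format, of n g c] assms(2)
  show "Im (\<Sum>i<(n::nat). \<Sum>j<n. cnj (c i) * c j * p (inv (g i) \<otimes> g j)) = 0"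
    and "0 \<le> Re (\<Sum>i<n. \<Sum>j<n. cnj (c i) * c j * p (inv (g i) \<otimes> g j))"
    by (simp_all add: Let_def)
qed

lemma PD_one: "p \<in> PD \<Longrightarrow> Im (p \<one>) = 0" "p \<in> PD \<Longrightarrow> 0 \<le> Re (p \<one>)"
  using PD_form[of p 1 "\<lambda>_. \<one>" "\<lambda>_. 1"] by auto

text \<open>The quadratic form at two points is real for the coefficient vectors (1, 1) and (1,
  \<i>), which gives the imaginary and the real part of the claim.\<close>

lemma PD_hermitian:
  assumes "p \<in> PD" "a \<in> carrier G" "b \<in> carrier G"
  shows "p (inv a \<otimes> b) = cnj (p (inv b \<otimes> a))"
proof -
  let ?g = "\<lambda>i::nat. if i = 0 then a else b"
  have g: "\<And>i. i < 2 \<Longrightarrow> ?g i \<in> carrier G" using assms by auto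
  have "Im (p (inv a \<otimes> b)) + Im (p (inv b \<otimes> a)) = 0"
    using PD_form(1)[OF assms(1), of 2 ?g "\<lambda>_. 1"] g PD_one(1)[OF assms(1)] assms
    by (simp add: numeral_2_eq_2)
  moreover have "Re (p (inv a \<otimes> b)) = Re (p (inv b \<otimes> a))"
    using PD_form(1)[OF assms(1), of 2 ?g "\<lambda>i. if i = 0 then 1 else \<i>"] g PD_one(1)[OF assms(1)] assms
    by (simp add: numeral_2_eq_2)
  ultimately show ?thesis by (simp add: complex_eq_iff)
qed

text \<open>The factor \<open>Re (p \<one>) + 1\<close> instead of \<open>Re (p \<one>)\<close> saves the case \<open>p \<one> = 0\<close>.\<close>

lemma PD_Cauchy_Schwarz:
  assumes p: "p \<in> PD" and g: "\<And>i. i < n \<Longrightarrow> g i \<in> carrier G" and x: "x \<in> carrier G"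
  shows "(cmod (\<Sum>i<(n::nat). cnj (c i) * p (inv (g i) \<otimes> x)))\<^sup>2
    \<le> (Re (p \<one>) + 1) * Re (\<Sum>i<n. \<Sum>j<n. cnj (c i) * c j * p (inv (g i) \<otimes> g j))"
proof -
  define Q where "Q = (\<Sum>i<n. \<Sum>j<n. cnj (c i) * c j * p (inv (g i) \<otimes> g j))"
  define S where "S = (\<Sum>i<n. cnj (c i) * p (inv (g i) \<otimes> x))"
  define P where "P = Re (p \<one>)"
  \<comment> \<open>With \<open>x\<close> added under the coefficient \<open>t\<close>, the form is
    \<open>Re Q + 2 * Re (t * S) + (cmod t)^2 * P\<close>. Its minimiser \<open>- cnj S / P\<close>
    is used with the shifted denominator.\<close>
  define t where "t = - cnj S / of_real (P + 1)"
  have P: "P \<ge> 0" "p \<one> = of_real P"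
    using PD_one[OF p] by (auto simp: P_def complex_eq_iff)
  let ?g = "g(n := x)" and ?c = "c(n := t)"
  have "0 \<le> Re (\<Sum>i<Suc n. \<Sum>j<Suc n. cnj (?c i) * ?c j * p (inv (?g i) \<otimes> ?g j))"
    by (rule PD_form[OF p]) (auto simp: g x less_Suc_eq)
  also have "(\<Sum>i<Suc n. \<Sum>j<Suc n. cnj (?c i) * ?c j * p (inv (?g i) \<otimes> ?g j))
    = Q + t * S + cnj t * (\<Sum>j<n. c j * p (inv x \<otimes> g j)) + cnj t * t * of_real P"
    using x by (simp add: sum.distrib Q_def S_def sum_distrib_left mult_ac P(2))
  also have "(\<Sum>j<n. c j * p (inv x \<otimes> g j)) = cnj S"
    unfolding S_def by (auto simp: PD_hermitian[OF p x g] intro!: sum.cong)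
  finally have "0 \<le> Re Q + 2 * Re (t * S) + Re (cnj t * t) * P"
    by (simp add: algebra_simps)
  also have "cnj t * t = of_real ((cmod S)\<^sup>2 / (P + 1)\<^sup>2)"
    unfolding of_real_divide complex_norm_square by (simp add: t_def power2_eq_square)
  also have "t * S = of_real (- (cmod S)\<^sup>2 / (P + 1))"
    unfolding of_real_divide of_real_minus complex_norm_square by (simp add: t_def)
  finally have "2 * (cmod S)\<^sup>2 / (P + 1) - (cmod S)\<^sup>2 / (P + 1)\<^sup>2 * P \<le> Re Q"
    by simp
  moreover have "(cmod S)\<^sup>2 / (P + 1)\<^sup>2 * P \<le> (cmod S)\<^sup>2 / (P + 1)"
  proof -
    have "P / (P + 1)\<^sup>2 \<le> (P + 1) / (P + 1)\<^sup>2" by (simp add: divide_right_mono)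
    also have "\<dots> = 1 / (P + 1)" using P by (simp add: power2_eq_square)
    finally have "P / (P + 1)\<^sup>2 \<le> 1 / (P + 1)" .
    from mult_left_mono[OF this zero_le_power2[of "cmod S"]] show ?thesis by simp
  qed
  ultimately have "(cmod S)\<^sup>2 / (P + 1) \<le> Re Q" by simp
  then show ?thesis
    using P unfolding Q_def[symmetric] S_def[symmetric] P_def[symmetric]
    by (simp add: field_simps)
qed

lemma PD_bound:
  assumes "p \<in> PD" "x \<in> carrier G"
  shows "cmod (p x) \<le> Re (p \<one>) + 1"
proof -
  have "(cmod (p x))\<^sup>2 \<le> (Re (p \<one>) + 1) * Re (p \<one>)"
    using PD_Cauchy_Schwarz[OF assms(1) _ assms(2), of 1 "\<lambda>_. \<one>" "\<lambda>_. 1"] assms by simp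
  also have "\<dots> \<le> (Re (p \<one>) + 1)\<^sup>2"
    using PD_one(2)[OF assms(1)] by (simp add: power2_eq_square)
  finally show ?thesis
    using PD_one(2)[OF assms(1)] by (simp add: power2_le_iff_abs_le)
qed

lemma PD_BC: "p \<in> PD \<Longrightarrow> p \<in> BC"
  using PD_bound unfolding BC_iff by (auto simp: positive_definite_functions_def functions_on_def)

text \<open>If \<open>p (h\<^sub>j h\<^sub>i\<inverse>)\<close> is nearly the same number \<open>s\<close> for all \<open>i < j\<close>, then the \<open>h\<^sub>i\<close>-translates are
  nearly orthogonal after subtraction of a common vector, so averages over disjoint blocks of them are
  close in the Hilbert norm given by \<open>p\<close>, and that norm dominates the supremum norm.\<close>

lemma PD_averages_close:
  assumes p: "p \<in> PD" and n: "n > 0" and h: "\<And>i. i < n + n \<Longrightarrow> h i \<in> carrier G"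
    and x: "x \<in> carrier G" and s: "\<bar>s\<bar> \<le> Re (p \<one>) + 1" and d: "d \<ge> 0"
    and close: "\<And>i j. j < n + n \<Longrightarrow> i < j \<Longrightarrow> \<bar>Re (p (h j \<otimes> inv (h i))) - s\<bar> \<le> d"
  shows "(cmod ((\<Sum>i<n. p (h i \<otimes> x)) / of_nat n - (\<Sum>i<n. p (h (n + i) \<otimes> x)) / of_nat n))\<^sup>2
    \<le> (Re (p \<one>) + 1) * (4 * (Re (p \<one>) + 1) / n + 4 * d)"
proof -
  define B where "B = Re (p \<one>) + 1"
  have B: "B > 0" using PD_one(2)[OF p] by (simp add: B_def)
  \<comment> \<open>Opposite signs on the two blocks: the coefficients sum to zero, so the common
    value \<open>s\<close> drops out of the quadratic form.\<close>
  define c :: "nat \<Rightarrow> real" where "c = (\<lambda>i. if i < n then 1 / n else - 1 / n)"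
  have c0: "(\<Sum>i<n + n. c i) = 0"
    by (simp add: sum_lessThan_add c_def)
  have cabs: "\<bar>c i\<bar> = 1 / n" for i by (simp add: c_def)
  have sym: "p (h i \<otimes> inv (h j)) = cnj (p (h j \<otimes> inv (h i)))" if "i < n + n" "j < n + n" for i j
    using PD_hermitian[OF p, of "inv (h i)" "inv (h j)"] h[OF that(1)] h[OF that(2)] by simp
  have ij: "\<bar>Re (p (h i \<otimes> inv (h j))) - s\<bar> \<le> (if i = j then 2 * B else d)"
    if ij: "i < n + n" "j < n + n" for i j
  proof (cases "i = j")
    case True
    have "\<bar>Re (p \<one>)\<bar> \<le> B" using PD_one(2)[OF p] by (simp add: B_def)
    then show ?thesis
      using True s h[OF ij(1)] by (simp add: B_def[symmetric] r_inv)
  next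
    case False
    then show ?thesis
      using close[of j i] close[of i j] sym[OF ij] ij by (cases "i < j") auto
  qed
  have "Re (\<Sum>i<n + n. \<Sum>j<n + n. cnj (c i) * c j * p (inv (inv (h i)) \<otimes> inv (h j)))
      = (\<Sum>i<n + n. \<Sum>j<n + n. c i * c j * Re (p (h i \<otimes> inv (h j))))"
    using h by (auto simp flip: of_real_mult intro!: sum.cong)
  also have "\<dots> = (\<Sum>i<n + n. \<Sum>j<n + n. c i * c j * (Re (p (h i \<otimes> inv (h j))) - s))
      + (\<Sum>i<n + n. \<Sum>j<n + n. c i * c j * s)"
    by (simp add: sum.distrib[symmetric] algebra_simps)
  also have "(\<Sum>i<n + n. \<Sum>j<n + n. c i * c j * s) = (\<Sum>i<n + n. c i) * (\<Sum>j<n + n. c j) * s"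
    unfolding sum_product by (simp only: sum_distrib_right)
  also have "\<dots> = 0" by (simp add: c0)
  \<comment> \<open>Each pair has weight of modulus \<open>1 / n^2\<close>: the \<open>2 * n\<close>
    diagonal pairs give \<open>4 * B / n\<close> in total, and an allowance of \<open>d\<close> for
    each of the \<open>4 * n^2\<close> pairs gives \<open>4 * d\<close>.\<close>
  also have "(\<Sum>i<n + n. \<Sum>j<n + n. c i * c j * (Re (p (h i \<otimes> inv (h j))) - s))
      \<le> (\<Sum>i<n + n. \<Sum>j<n + n. 1 / n^2 * ((if i = j then 2 * B else 0) + d))"
  proof (intro sum_mono)
    fix i j assume ij': "i \<in> {..<n + n}" "j \<in> {..<n + n}"
    have "c i * c j * (Re (p (h i \<otimes> inv (h j))) - s) \<le> \<bar>c i * c j * (Re (p (h i \<otimes> inv (h j))) - s)\<bar>"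
      by simp
    also have "\<dots> = 1 / n^2 * \<bar>Re (p (h i \<otimes> inv (h j))) - s\<bar>"
      by (simp add: abs_mult cabs power2_eq_square)
    also have "\<dots> \<le> 1 / n^2 * ((if i = j then 2 * B else 0) + d)"
      using ij[of i j] ij' d by (intro mult_left_mono) (auto split: if_splits)
    finally show "c i * c j * (Re (p (h i \<otimes> inv (h j))) - s) \<le> \<dots>" .
  qed
  also have "\<dots> = (\<Sum>i<n + n. 1 / n^2 * (2 * B + (n + n) * d))"
  proof (rule sum.cong[OF refl])
    fix i assume "i \<in> {..<n + n}"
    then have "(\<Sum>j<n + n. (if i = j then 2 * B else 0) + d) = 2 * B + (n + n) * d"
      by (simp add: sum.distrib)
    then show "(\<Sum>j<n + n. 1 / n^2 * ((if i = j then 2 * B else 0) + d)) = 1 / n^2 * (2 * B + (n + n) * d)"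
      by (simp only: sum_distrib_left[symmetric])
  qed
  also have "\<dots> = (n + n) * (1 / n^2 * (2 * B + (n + n) * d))"
    by simp
  also have "\<dots> = 4 * B / n + 4 * d"
    using n by (simp add: field_simps power2_eq_square)
  finally have Q: "Re (\<Sum>i<n + n. \<Sum>j<n + n. cnj (c i) * c j * p (inv (inv (h i)) \<otimes> inv (h j)))
    \<le> 4 * B / n + 4 * d" by simp
  have "(\<Sum>i<n + n. cnj (c i) * p (inv (inv (h i)) \<otimes> x)) = (\<Sum>i<n + n. of_real (c i) * p (h i \<otimes> x))"
    using h by (intro sum.cong) auto
  also have "\<dots> = (\<Sum>i<n. p (h i \<otimes> x)) / of_nat n - (\<Sum>i<n. p (h (n + i) \<otimes> x)) / of_nat n"
    by (simp add: sum_lessThan_add c_def sum_divide_distrib sum_negf)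
  finally have "(cmod ((\<Sum>i<n. p (h i \<otimes> x)) / of_nat n - (\<Sum>i<n. p (h (n + i) \<otimes> x)) / of_nat n))\<^sup>2
    \<le> B * Re (\<Sum>i<n + n. \<Sum>j<n + n. cnj (c i) * c j * p (inv (inv (h i)) \<otimes> inv (h j)))"
    using PD_Cauchy_Schwarz[OF p _ x, of "n + n" "\<lambda>i. inv (h i)" "\<lambda>i. of_real (c i)"] h
    by (simp add: B_def)
  also have "\<dots> \<le> B * (4 * B / n + 4 * d)"
    using Q B by (intro mult_left_mono) auto
  finally show ?thesis by (simp add: B_def)
qed

text \<open>For fixed \<open>x\<close>, a second block chosen where \<open>p (h \<otimes> x)\<close>
  is already near \<open>k x\<close> has its average near \<open>k x\<close>. The two-block estimate
  carries this over to the first block, which was chosen without reference to \<open>x\<close>; so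
  the approximation is uniform. The family \<psi> is carried along so that a functional can be
  evaluated on the same translates.\<close>

lemma PD_averages_converge:
  assumes p: "p \<in> PD" and U: "ultrafilter U" "eventually (\<lambda>h. h \<in> carrier G) U"
    and k: "\<And>x. x \<in> carrier G \<Longrightarrow> ((\<lambda>h. p (h \<otimes> x)) \<longlongrightarrow> k x) U"
    and z: "(\<psi> \<longlongrightarrow> (z::complex)) U" and e: "e > 0"
  obtains n h where "n > 0" "\<And>i. i < n \<Longrightarrow> h i \<in> carrier G" "\<And>i. i < n \<Longrightarrow> cmod (\<psi> (h i) - z) < e"
    "\<And>x. x \<in> carrier G \<Longrightarrow> cmod ((\<Sum>i<(n::nat). p (h i \<otimes> x)) / of_nat n - k x) \<le> e"
proof -
  define B where "B = Re (p \<one>) + 1"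
  have B: "B > 0" using PD_one(2)[OF p] by (simp add: B_def)
  have nb: "U \<noteq> bot" using U(1) ultrafilter_not_bot by blast
  have kB: "cmod (k x) \<le> B" if x: "x \<in> carrier G" for x
  proof (rule tendsto_upperbound[OF tendsto_norm[OF k[OF x]] _ nb])
    show "eventually (\<lambda>h. cmod (p (h \<otimes> x)) \<le> B) U"
      using U(2) by eventually_elim (use PD_bound[OF p] x in \<open>simp add: B_def\<close>)
  qed
  \<comment> \<open>The common value is the real part of the iterated limit \<open>s\<close> of
    \<open>p (h \<otimes> inv g)\<close>, first along \<open>h\<close> with value
    \<open>k (inv g)\<close> and then along \<open>g\<close>.\<close>
  have "eventually (\<lambda>h. cmod (k (inv h)) \<le> B) U"
    using U(2) by eventually_elim (use kB in simp)
  then obtain s where s: "((\<lambda>h. k (inv h)) \<longlongrightarrow> s) U" and sB: "cmod s \<le> B"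
    using bounded_ultrafilter_limit[OF U(1)] tendsto_upperbound[OF tendsto_norm _ nb] by metis
  \<comment> \<open>With this \<open>d\<close> and with \<open>n\<close> above
    \<open>32 * B^2 / e^2\<close>, each half of \<open>B * (4 * B / n + 4 * d)\<close> is at most
    \<open>e^2 / 8\<close>.\<close>
  define d where "d = e\<^sup>2 / (32 * B)"
  have d: "d > 0" using e B by (simp add: d_def)
  obtain n :: nat where n: "n > 32 * B\<^sup>2 / e\<^sup>2"
    using reals_Archimedean2 by blast
  have n0: "n > 0" using n B e
    by (metis divide_pos_pos gr0I mult_pos_pos of_nat_0 order_less_asym zero_less_numeral zero_less_power)
  have small: "B * (4 * B / n + 4 * d) \<le> (e / 2)\<^sup>2"
  proof -
    have "32 * B\<^sup>2 / n \<le> e\<^sup>2"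
      using n n0 e by (simp add: field_simps)
    then have "B * (4 * B / n) \<le> e\<^sup>2 / 8" by (simp add: power2_eq_square)
    moreover have "B * (4 * d) = e\<^sup>2 / 8" using B by (simp add: d_def)
    ultimately show ?thesis by (simp add: power_divide distrib_left)
  qed
  define E where "E = (\<lambda>h. h \<in> carrier G \<and> cmod (k (inv h) - s) < d / 2 \<and> cmod (\<psi> h - z) < e)"
  define R where "R = (\<lambda>g h. cmod (p (h \<otimes> inv g) - k (inv g)) < d / 2)"
  have evE: "eventually E U"
    using U(2) tendstoD[OF s half_gt_zero[OF d]] tendstoD[OF z e]
    unfolding E_def by eventually_elim (simp add: dist_norm)
  have evR: "eventually (R g) U" if "E g" for g
    using tendstoD[OF k[of "inv g"] half_gt_zero[OF d]] that by (simp add: R_def E_def dist_norm)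
  have ER: "\<bar>Re (p (h \<otimes> inv g)) - Re s\<bar> \<le> d" if "E g" "R g h" for g h
  proof -
    have "\<bar>Re (p (h \<otimes> inv g) - s)\<bar> \<le> cmod ((p (h \<otimes> inv g) - k (inv g)) + (k (inv g) - s))"
      using abs_Re_le_cmod[of "p (h \<otimes> inv g) - s"] by simp
    also have "\<dots> \<le> d / 2 + d / 2"
      using that by (intro norm_triangle_le) (auto simp: E_def R_def)
    finally show ?thesis by simp
  qed
  obtain h where h: "\<And>i. i < n \<Longrightarrow> E (h i)" "\<And>i j. j < n \<Longrightarrow> i < j \<Longrightarrow> R (h i) (h j)"
  proof -
    have "\<exists>h. (\<forall>i<n. E (h i) \<and> (\<forall>g\<in>{}. R g (h i))) \<and> (\<forall>j<n. \<forall>i<j. R (h i) (h j))"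
      by (rule eventually_sequence[OF nb evE evR]) auto
    then show thesis using that by blast
  qed
  have "cmod ((\<Sum>i<n. p (h i \<otimes> x)) / of_nat n - k x) \<le> e" if x: "x \<in> carrier G" for x
  proof -
    define E' where "E' = (\<lambda>h. E h \<and> cmod (p (h \<otimes> x) - k x) < e / 2)"
    have "eventually E' U"
      using evE tendstoD[OF k[OF x] half_gt_zero[OF e]] unfolding E'_def
      by eventually_elim (simp add: dist_norm)
    then have "\<exists>y. (\<forall>i<n. E' (y i) \<and> (\<forall>g\<in>h ` {..<n}. R g (y i))) \<and> (\<forall>j<n. \<forall>i<j. R (y i) (y j))"
      by (rule eventually_sequence[OF nb]) (use h(1) evR in \<open>auto simp: E'_def\<close>)
    then obtain y where y: "\<And>i. i < n \<Longrightarrow> E' (y i)" "\<And>i g. i < n \<Longrightarrow> g \<in> h ` {..<n} \<Longrightarrow> R g (y i)"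
      "\<And>i j. j < n \<Longrightarrow> i < j \<Longrightarrow> R (y i) (y j)" by blast
    define w where "w = (\<lambda>i. if i < n then h i else y (i - n))"
    have Ew: "E (w i)" if "i < n + n" for i
      using h(1)[of i] y(1)[of "i - n"] that by (auto simp: w_def E'_def)
    have Rw: "R (w i) (w j)" if "j < n + n" "i < j" for i j
      using h(2)[of j i] y(3)[of "j - n" "i - n"] y(2)[of "j - n" "h i"] that by (auto simp: w_def)
    have "(cmod ((\<Sum>i<n. p (w i \<otimes> x)) / of_nat n - (\<Sum>i<n. p (w (n + i) \<otimes> x)) / of_nat n))\<^sup>2
        \<le> B * (4 * B / n + 4 * d)"
      unfolding B_def
    proof (rule PD_averages_close[OF p n0 _ x, where s = "Re s"])
      show "w i \<in> carrier G" if "i < n + n" for i using Ew[OF that] by (simp add: E_def)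
      show "\<bar>Re s\<bar> \<le> Re (p \<one>) + 1" using abs_Re_le_cmod[of s] sB by (simp add: B_def)
      show "0 \<le> d" using d by simp
      show "\<bar>Re (p (w j \<otimes> inv (w i))) - Re s\<bar> \<le> d" if "j < n + n" "i < j" for i j
        using ER Ew[of i] Rw[OF that] that by simp
    qed
    with small have "cmod ((\<Sum>i<n. p (w i \<otimes> x)) / of_nat n - (\<Sum>i<n. p (w (n + i) \<otimes> x)) / of_nat n) \<le> e / 2"
      by (smt (verit) e power2_le_imp_le divide_pos_pos)
    then have 1: "cmod ((\<Sum>i<n. p (h i \<otimes> x)) / of_nat n - (\<Sum>i<n. p (y i \<otimes> x)) / of_nat n) \<le> e / 2"
      by (simp add: w_def)
    have "(\<Sum>i<n. p (y i \<otimes> x)) / of_nat n - k x = (\<Sum>i<n. p (y i \<otimes> x) - k x) / of_nat n"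
      using n0 by (simp add: sum_subtractf diff_divide_distrib)
    moreover have "cmod (\<Sum>i<n. p (y i \<otimes> x) - k x) \<le> (\<Sum>i<n. e / 2)"
      using y(1) by (intro sum_norm_le) (auto simp: E'_def less_imp_le)
    ultimately have 2: "cmod ((\<Sum>i<n. p (y i \<otimes> x)) / of_nat n - k x) \<le> e / 2"
      using n0 by (simp add: norm_divide divide_le_eq mult.commute)
    show ?thesis
      using norm_triangle_le[OF order_trans[OF add_mono[OF 1 2]]] by simp
  qed
  with that[OF n0, of h] h(1) show thesis by (simp add: E_def)
qed

lemma translate_sum: "translate G h (\<lambda>x. \<Sum>i<(n::nat). c i * p i x) = (\<lambda>x. \<Sum>i<n. c i * translate G h (p i) x)"
  by (auto simp: translate_def)

text \<open>Averages of translates approximate the pointwise limit \<open>k\<close> uniformly, which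
  puts \<open>k\<close> into \<open>BC\<close>. If the values of \<phi> on the translates tend to
  \<open>z\<close>, a block whose values are near \<open>z\<close> has an average whose value is
  near both \<open>z\<close> and \<open>\<phi> k\<close>.\<close>

lemma PD_orbit_map_converges:
  assumes p: "p \<in> PD"
  shows "orbit_map_converges p"
  unfolding orbit_map_converges_def
proof (intro allI impI)
  fix U assume U: "ultrafilter U" "eventually (\<lambda>h. h \<in> carrier G) U"
  define B where "B = Re (p \<one>) + 1"
  define k where "k = (\<lambda>x. if x \<in> carrier G then Lim U (\<lambda>h. p (h \<otimes> x)) else 0)"
  have k: "((\<lambda>h. p (h \<otimes> x)) \<longlongrightarrow> k x) U" if x: "x \<in> carrier G" for x
  proof -
    have "eventually (\<lambda>h. cmod (p (h \<otimes> x)) \<le> B) U"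
      using U(2) by eventually_elim (use PD_bound[OF p] x in \<open>simp add: B_def\<close>)
    then show ?thesis using ultrafilter_Lim[OF U(1)] x by (simp add: k_def)
  qed
  have avg: "(\<lambda>x. \<Sum>i<n. (1 / of_nat n) * translate G (h i) p x) \<in> BC"
    if "\<And>i. i < n \<Longrightarrow> h i \<in> carrier G" for n :: nat and h
    using that by (intro BC_sum BC_translate PD_BC p)
  have avg_eq: "(\<Sum>i<n. (1 / of_nat n) * translate G (h i) p x) = (\<Sum>i<n. p (h i \<otimes> x)) / of_nat n"
    if "x \<in> carrier G" for n :: nat and h x
    using that by (simp add: translate_def sum_divide_distrib)
  have kBC: "k \<in> BC"
  proof (rule BC_uniform_limit)
    show "k x = 0" if "x \<notin> carrier G" for x using that by (simp add: k_def)
    fix e :: real assume e: "e > 0"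
    have e2: "e / 2 > 0" using e by simp
    obtain n h where "n > 0" and h: "\<And>i. i < n \<Longrightarrow> h i \<in> carrier G"
      and *: "\<And>x. x \<in> carrier G \<Longrightarrow> cmod ((\<Sum>i<(n::nat). p (h i \<otimes> x)) / of_nat n - k x) \<le> e / 2"
      by (rule PD_averages_converge[OF p U k, of "\<lambda>_. 0" 0 "e / 2"]) (use e2 in auto)
    show "\<exists>h\<in>BC. \<forall>x\<in>carrier G. cmod (k x - h x) < e"
    proof (rule bexI[OF _ avg[OF h]], intro ballI)
      fix x assume x: "x \<in> carrier G"
      show "cmod (k x - (\<Sum>i<n. (1 / of_nat n) * translate G (h i) p x)) < e"
        unfolding avg_eq[OF x] using *[OF x] e by (simp add: norm_minus_commute)
    qed
  qed
  have "((\<lambda>h. \<phi> (translate G h p)) \<longlongrightarrow> \<phi> k) U" if phi: "\<phi> \<in> BC_dual" for \<phi>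
  proof -
    obtain K where K: "K > 0"
      "\<And>f B. f \<in> BC \<Longrightarrow> (\<And>x. x \<in> carrier G \<Longrightarrow> cmod (f x) \<le> B) \<Longrightarrow> cmod (\<phi> f) \<le> K * B"
      using dual_bound[OF phi] by blast
    have ev: "eventually (\<lambda>h. cmod (\<phi> (translate G h p)) \<le> K * B) U"
      using U(2)
    proof eventually_elim
      case (elim h)
      show ?case
        by (rule K(2)[OF BC_translate[OF PD_BC[OF p] elim]])
          (use elim PD_bound[OF p] in \<open>simp add: translate_def B_def\<close>)
    qed
    obtain z where z: "((\<lambda>h. \<phi> (translate G h p)) \<longlongrightarrow> z) U"
      by (rule bounded_ultrafilter_limit[OF U(1) ev])
    have "cmod (z - \<phi> k) \<le> (K + 1) * e" if e: "e > 0" for e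
    proof -
      obtain n h where n: "n > 0" and h: "\<And>i. i < n \<Longrightarrow> h i \<in> carrier G"
        and close: "\<And>i. i < n \<Longrightarrow> cmod (\<phi> (translate G (h i) p) - z) < e"
        and *: "\<And>x. x \<in> carrier G \<Longrightarrow> cmod ((\<Sum>i<(n::nat). p (h i \<otimes> x)) / of_nat n - k x) \<le> e"
        by (rule PD_averages_converge[OF p U k z e]) auto
      let ?A = "\<lambda>x. \<Sum>i<n. (1 / of_nat n) * translate G (h i) p x"
      have A: "?A \<in> BC" by (rule avg[OF h])
      have "cmod (\<phi> (\<lambda>x. ?A x - k x)) \<le> K * e"
        by (rule K(2)[OF BC_diff[OF A kBC]]) (simp only: avg_eq *)
      then have 1: "cmod (\<phi> ?A - \<phi> k) \<le> K * e"
        by (simp only: dual_diff[OF phi A kBC])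
      have "\<phi> ?A = (\<Sum>i<n. (1 / of_nat n) * \<phi> (translate G (h i) p))"
        by (rule dual_sum[OF phi]) (intro BC_translate PD_BC p h)
      then have "z - \<phi> ?A = (\<Sum>i<n. (1 / of_nat n) * (z - \<phi> (translate G (h i) p)))"
        using n by (simp add: right_diff_distrib sum_subtractf)
      moreover have "cmod (\<Sum>i<n. (1 / of_nat n) * (z - \<phi> (translate G (h i) p))) \<le> (\<Sum>i<n. (1 / n) * e)"
        using close n by (intro sum_norm_le)
          (auto simp: norm_mult norm_divide norm_minus_commute divide_right_mono less_imp_le)
      ultimately have 2: "cmod (z - \<phi> ?A) \<le> e" using n by simp
      show ?thesis
        using norm_triangle_le[OF order_trans[OF add_mono[OF 2 1]]] by (simp add: algebra_simps)
    qed
    then have "cmod (z - \<phi> k) \<le> e" if "e > 0" for e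
      using that K(1) by (metis divide_pos_pos add_pos_pos zero_less_one nonzero_mult_div_cancel_left
          times_divide_eq_right less_irrefl)
    then have "z = \<phi> k" by (metis dense_ge eq_iff_diff_eq_0 norm_le_zero_iff)
    with z show ?thesis by simp
  qed
  with kBC show "\<exists>k\<in>BC. \<forall>\<phi>\<in>BC_dual. ((\<lambda>h. \<phi> (translate G h p)) \<longlongrightarrow> \<phi> k) U" by blast
qed

lemma PD_combinations_orbit_map_converges:
  assumes "f \<in> positive_definite_combinations G T"
  shows "f \<in> BC" "orbit_map_converges f"
proof -
  obtain n :: nat and c p where f: "f = (\<lambda>x. \<Sum>i<n. c i * p i x)" and p: "\<And>i. i < n \<Longrightarrow> p i \<in> PD"
    using assms unfolding positive_definite_combinations_def by blast
  show fBC: "f \<in> BC" unfolding f by (intro BC_sum PD_BC p)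
  show "orbit_map_converges f"
    unfolding orbit_map_converges_def
  proof (intro allI impI)
    fix U assume U: "ultrafilter U" "eventually (\<lambda>h. h \<in> carrier G) U"
    have "\<exists>k\<in>BC. \<forall>\<phi>\<in>BC_dual. ((\<lambda>h. \<phi> (translate G h (p i))) \<longlongrightarrow> \<phi> k) U" if "i < n" for i
      using PD_orbit_map_converges[OF p[OF that]] U unfolding orbit_map_converges_def by blast
    then obtain k where k: "\<And>i. i < n \<Longrightarrow> k i \<in> BC"
      "\<And>i \<phi>. i < n \<Longrightarrow> \<phi> \<in> BC_dual \<Longrightarrow> ((\<lambda>h. \<phi> (translate G h (p i))) \<longlongrightarrow> \<phi> (k i)) U"
      by metis
    have "((\<lambda>h. \<phi> (translate G h f)) \<longlongrightarrow> \<phi> (\<lambda>x. \<Sum>i<n. c i * k i x)) U" if phi: "\<phi> \<in> BC_dual" for \<phi>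
    proof -
      have "((\<lambda>h. \<Sum>i<n. c i * \<phi> (translate G h (p i))) \<longlongrightarrow> (\<Sum>i<n. c i * \<phi> (k i))) U"
        using phi by (intro tendsto_sum tendsto_mult tendsto_const k) auto
      moreover have "eventually (\<lambda>h. (\<Sum>i<n. c i * \<phi> (translate G h (p i))) = \<phi> (translate G h f)) U"
        using U(2)
      proof eventually_elim
        case (elim h)
        show ?case unfolding f translate_sum
          by (rule dual_sum[OF phi, symmetric]) (intro BC_translate PD_BC p elim)
      qed
      ultimately have "((\<lambda>h. \<phi> (translate G h f)) \<longlongrightarrow> (\<Sum>i<n. c i * \<phi> (k i))) U"
        using filterlim_cong[OF refl refl] by fast
      then show ?thesis using dual_sum[OF phi, of n k c] k(1) by simp
    qed
    then show "\<exists>k\<in>BC. \<forall>\<phi>\<in>BC_dual. ((\<lambda>h. \<phi> (translate G h f)) \<longlongrightarrow> \<phi> k) U"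
      using BC_sum[of n k c] k(1) by blast
  qed
qed

text \<open>The weak limit for an approximant is as close to the pointwise limit \<open>k\<close>
  for \<open>f\<close> as the approximant is to \<open>f\<close>. This puts \<open>k\<close> into
  \<open>BC\<close> and lets bounded functionals pass to the limit.\<close>

lemma orbit_map_converges_uniform_limit:
  assumes f: "\<And>x. x \<notin> carrier G \<Longrightarrow> f x = 0"
    and approx: "\<And>e. e > 0 \<Longrightarrow> \<exists>h\<in>BC. orbit_map_converges h \<and> (\<forall>x\<in>carrier G. cmod (f x - h x) < e)"
  shows "f \<in> BC" "orbit_map_converges f"
proof -
  show fBC: "f \<in> BC"
    using f approx by (intro BC_uniform_limit) blast+
  obtain B where B: "\<And>x. cmod (f x) \<le> B" using BC_bounded[OF fBC] by blast
  show "orbit_map_converges f"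
    unfolding orbit_map_converges_def
  proof (intro allI impI)
    fix U assume U: "ultrafilter U" "eventually (\<lambda>h. h \<in> carrier G) U"
    have nb: "U \<noteq> bot" using U(1) ultrafilter_not_bot by blast
    define k where "k = (\<lambda>x. if x \<in> carrier G then Lim U (\<lambda>h. f (h \<otimes> x)) else 0)"
    have k: "((\<lambda>h. f (h \<otimes> x)) \<longlongrightarrow> k x) U" if x: "x \<in> carrier G" for x
      using ultrafilter_Lim[OF U(1), of "\<lambda>h. f (h \<otimes> x)" B] B x by (simp add: k_def)
    have step: "\<exists>q\<in>BC. \<exists>l\<in>BC. (\<forall>x\<in>carrier G. cmod (f x - q x) \<le> e) \<and> (\<forall>x\<in>carrier G. cmod (k x - l x) \<le> e)
        \<and> (\<forall>\<phi>\<in>BC_dual. ((\<lambda>h. \<phi> (translate G h q)) \<longlongrightarrow> \<phi> l) U)" if e: "e > 0" for e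
    proof -
      obtain q where q: "q \<in> BC" "orbit_map_converges q" "\<And>x. x \<in> carrier G \<Longrightarrow> cmod (f x - q x) < e"
        using approx[OF e] by blast
      obtain l where l: "l \<in> BC" "\<And>\<phi>. \<phi> \<in> BC_dual \<Longrightarrow> ((\<lambda>h. \<phi> (translate G h q)) \<longlongrightarrow> \<phi> l) U"
        using q(2) U unfolding orbit_map_converges_def by blast
      \<comment> \<open>Point evaluations are bounded functionals, so the weak limit
        \<open>l\<close> is also a pointwise limit.\<close>
      have "cmod (k x - l x) \<le> e" if x: "x \<in> carrier G" for x
      proof (rule tendsto_upperbound[OF tendsto_norm[OF tendsto_diff[OF k[OF x] l(2)[OF evaluation_in_dual[OF x]]]] _ nb])
        show "eventually (\<lambda>h. cmod (f (h \<otimes> x) - translate G h q x) \<le> e) U"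
          using U(2) by eventually_elim (use q(3) x in \<open>auto simp: translate_def less_imp_le\<close>)
      qed
      then show ?thesis using q l by (meson less_imp_le)
    qed
    have kBC: "k \<in> BC"
    proof (rule BC_uniform_limit)
      show "k x = 0" if "x \<notin> carrier G" for x using that by (simp add: k_def)
      fix e :: real assume "e > 0"
      then obtain l where "l \<in> BC" "\<forall>x\<in>carrier G. cmod (k x - l x) \<le> e / 2" using step[of "e / 2"] by auto
      then show "\<exists>h\<in>BC. \<forall>x\<in>carrier G. cmod (k x - h x) < e" using \<open>e > 0\<close> by (intro bexI[of _ l]) force+
    qed
    have "((\<lambda>h. \<phi> (translate G h f)) \<longlongrightarrow> \<phi> k) U" if phi: "\<phi> \<in> BC_dual" for \<phi>
    proof (rule tendstoI)
      fix e :: real assume e: "e > 0"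
      obtain K where K: "K > 0"
        "\<And>f B. f \<in> BC \<Longrightarrow> (\<And>x. x \<in> carrier G \<Longrightarrow> cmod (f x) \<le> B) \<Longrightarrow> cmod (\<phi> f) \<le> K * B"
        using dual_bound[OF phi] by blast
      have "e / (3 * K) > 0" using e K by simp
      then obtain q l where q: "q \<in> BC" "\<And>x. x \<in> carrier G \<Longrightarrow> cmod (f x - q x) \<le> e / (3 * K)"
        and l: "l \<in> BC" "\<And>x. x \<in> carrier G \<Longrightarrow> cmod (k x - l x) \<le> e / (3 * K)"
        and lim: "((\<lambda>h. \<phi> (translate G h q)) \<longlongrightarrow> \<phi> l) U"
        using step phi by blast
      have 1: "cmod (\<phi> k - \<phi> l) \<le> e / 3"
        using K(2)[OF BC_diff[OF kBC l(1)] l(2)] K(1) by (simp add: dual_diff[OF phi kBC l(1)])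
      have "eventually (\<lambda>h. dist (\<phi> (translate G h q)) (\<phi> l) < e / 3) U"
        using tendstoD[OF lim, of "e / 3"] e by simp
      with U(2) show "eventually (\<lambda>h. dist (\<phi> (translate G h f)) (\<phi> k) < e) U"
      proof eventually_elim
        case (elim h)
        have "cmod (\<phi> (\<lambda>x. translate G h f x - translate G h q x)) \<le> K * (e / (3 * K))"
          using elim q by (intro K(2) BC_diff BC_translate fBC) (auto simp: translate_def)
        then have 2: "cmod (\<phi> (translate G h f) - \<phi> (translate G h q)) \<le> e / 3"
          using K(1) elim by (simp add: dual_diff[OF phi] BC_translate fBC q)
        have "dist (\<phi> (translate G h f)) (\<phi> k) \<le> dist (\<phi> (translate G h f)) (\<phi> (translate G h q))
          + dist (\<phi> (translate G h q)) (\<phi> l) + dist (\<phi> l) (\<phi> k)"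
          by (meson dist_triangle add_mono_thms_linordered_semiring(1) dist_triangle_le order_refl order_trans)
        then show ?case using 1 2 elim(2) by (simp add: dist_norm norm_minus_commute)
      qed
    qed
    with kBC show "\<exists>k\<in>BC. \<forall>\<phi>\<in>BC_dual. ((\<lambda>h. \<phi> (translate G h f)) \<longlongrightarrow> \<phi> k) U" by blast
  qed
qed

theorem Hilbert_subset_WAP: "Hilbert_algebra G T \<subseteq> WAP_algebra G T"
proof
  fix f assume f: "f \<in> Hilbert_algebra G T"
  have 0: "f x = 0" if "x \<notin> carrier G" for x
    using f that by (simp add: Hilbert_algebra_def functions_on_def)
  have approx: "\<exists>h\<in>BC. orbit_map_converges h \<and> (\<forall>x\<in>carrier G. cmod (f x - h x) < e)" if "e > 0" for e
    using f that PD_combinations_orbit_map_converges unfolding Hilbert_algebra_def by blast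
  show "f \<in> WAP_algebra G T"
    unfolding WAP_iff using orbit_map_converges_uniform_limit[of f, OF 0 approx] by blast
qed

end

section \<open>Weakly almost periodic functions are uniformly continuous\<close>

text \<open>Real and imaginary parts of the first \<open>n + 1\<close> values are rounded down to
  multiples of \<open>e / 2\<close>. Boundedness leaves finitely many codes, and one representative
  of each makes up \<open>B0\<close>.\<close>

lemma finite_net_bounded_family:
  fixes F :: "nat \<Rightarrow> 'b \<Rightarrow> complex"
  assumes bd: "\<And>i b. b \<in> B \<Longrightarrow> cmod (F i b) \<le> C" and e: "e > 0"
  obtains B0 where "finite B0" "B0 \<subseteq> B"
    "\<And>b. b \<in> B \<Longrightarrow> \<exists>b0\<in>B0. \<forall>i\<le>n. cmod (F i b - F i b0) \<le> e"
proof -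
  define fl where "fl = (\<lambda>t. \<lfloor>t / (e / 2)\<rfloor>)"
  define code where "code = (\<lambda>b. \<lambda>i\<in>{..n}. (fl (Re (F i b)), fl (Im (F i b))))"
  have fl_range: "fl t \<in> {fl (- C)..fl C}" if "\<bar>t\<bar> \<le> C" for t
  proof -
    have "- C \<le> t" "t \<le> C" using that by auto
    then show ?thesis
      using e unfolding fl_def atLeastAtMost_iff by (intro conjI floor_mono divide_right_mono) auto
  qed
  have "code ` B \<subseteq> PiE {..n} (\<lambda>_. {fl (- C)..fl C} \<times> {fl (- C)..fl C})"
    using fl_range bd abs_Re_le_cmod abs_Im_le_cmod order_trans
    unfolding code_def by (intro image_subsetI restrict_PiE_iff[THEN iffD2] ballI SigmaI) blast+
  moreover have "finite (PiE {..n} (\<lambda>_. {fl (- C)..fl C} \<times> {fl (- C)..fl C}))"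
    by (intro finite_PiE) auto
  ultimately have fin: "finite (code ` B)" by (rule finite_subset)
  have fl_close: "\<bar>t - u\<bar> \<le> e / 2" if "fl t = fl u" for t u
  proof -
    have "\<bar>t / (e / 2) - u / (e / 2)\<bar> \<le> 1"
      using that unfolding fl_def by linarith
    then have "\<bar>t - u\<bar> / (e / 2) \<le> 1"
      using e by (metis abs_divide abs_of_pos diff_divide_distrib half_gt_zero)
    then show ?thesis by (simp only: divide_le_eq_1_pos[OF half_gt_zero[OF e]])
  qed
  show thesis
  proof (rule that[of "inv_into B code ` (code ` B)"])
    show "finite (inv_into B code ` (code ` B))" using fin by blast
    show "inv_into B code ` (code ` B) \<subseteq> B" by (auto intro: inv_into_into)
    fix b assume b: "b \<in> B"
    let ?b = "inv_into B code (code b)"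
    have eq: "code ?b = code b" by (rule f_inv_into_f) (use b in blast)
    have "cmod (F i b - F i ?b) \<le> e" if "i \<le> n" for i
    proof -
      have "fl (Re (F i ?b)) = fl (Re (F i b))" "fl (Im (F i ?b)) = fl (Im (F i b))"
        using fun_cong[OF eq, of i] that by (auto simp: code_def)
      then have "\<bar>Re (F i b) - Re (F i ?b)\<bar> \<le> e / 2" "\<bar>Im (F i b) - Im (F i ?b)\<bar> \<le> e / 2"
        using fl_close by metis+
      then show ?thesis using cmod_le[of "F i b - F i ?b"] by simp
    qed
    then show "\<exists>b0\<in>inv_into B code ` (code ` B). \<forall>i\<le>n. cmod (F i b - F i b0) \<le> e"
      using b by blast
  qed
qed

lemma limitin_product_eval:
  assumes "limitin (product_topology (\<lambda>_. euclidean) B) (\<lambda>a. \<lambda>b\<in>B. F a b) k U" "b \<in> B"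
  shows "((\<lambda>a. F a b) \<longlongrightarrow> k b) U"
  using assms unfolding limitin_componentwise by auto

text \<open>The last assumption before \<open>e\<close> is the double limit property. It makes each element of the
  pointwise closure of the functions \<open>F a\<close> continuous for the uniformity that the countably many
  functions \<open>F (d i)\<close> induce on \<open>B\<close>, so countably many closed sets with a fixed modulus of continuity
  cover this compact closure.\<close>

lemma oscillation_small_on_open_set:
  fixes F :: "'a \<Rightarrow> 'b \<Rightarrow> complex" and X :: "'a topology" and d :: "nat \<Rightarrow> 'a"
  assumes dX: "\<And>n. d n \<in> topspace X"
    and dense: "\<And>V. openin X V \<Longrightarrow> V \<noteq> {} \<Longrightarrow> \<exists>n. d n \<in> V"
    and cont: "\<And>b. b \<in> B \<Longrightarrow> continuous_map X euclidean (\<lambda>a. F a b)"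
    and bd: "\<And>a b. a \<in> topspace X \<Longrightarrow> b \<in> B \<Longrightarrow> cmod (F a b) \<le> C"
    and dlc: "\<And>U V k l s. ultrafilter U \<Longrightarrow> eventually (\<lambda>a. a \<in> topspace X) U \<Longrightarrow>
      ultrafilter V \<Longrightarrow> eventually (\<lambda>b. b \<in> B) V \<Longrightarrow>
      (\<And>b. b \<in> B \<Longrightarrow> ((\<lambda>a. F a b) \<longlongrightarrow> k b) U) \<Longrightarrow>
      (\<And>a. a \<in> topspace X \<Longrightarrow> (F a \<longlongrightarrow> l a) V) \<Longrightarrow> (k \<longlongrightarrow> s) V \<Longrightarrow> (l \<longlongrightarrow> s) U"
    and e: "e > 0"
  obtains V where "openin X V" "V \<noteq> {}"
    "\<And>a a' b. a \<in> V \<Longrightarrow> a' \<in> V \<Longrightarrow> b \<in> B \<Longrightarrow> cmod (F a b - F a' b) \<le> e"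
proof -
  let ?P = "product_topology (\<lambda>_. euclidean :: complex topology) B"
  define E where "E = (\<lambda>a. \<lambda>b\<in>B. F a b)"
  define K where "K = ?P closure_of (E ` topspace X)"
  define S where "S = subtopology ?P K"
  \<comment> \<open>Three errors of size \<open>r\<close> separate a point of \<open>V\<close> from
    the centre \<open>a0\<close>, hence six separate two points of \<open>V\<close>.\<close>
  define r where "r = e / 6"
  have r: "r > 0" using e by (simp add: r_def)
  have KP: "K \<subseteq> topspace ?P" unfolding K_def by (rule closure_of_subset_topspace)
  have EK: "E ` topspace X \<subseteq> K" unfolding K_def by (rule closure_of_subset) (auto simp: E_def)
  have Kbox: "K \<subseteq> (\<Pi>\<^sub>E b\<in>B. cball 0 C)"
    unfolding K_def by (rule closure_of_minimal) (auto simp: E_def bd closedin_product_topology)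
  have "compactin ?P K"
    by (rule closed_compactin[OF _ Kbox]) (auto simp: compactin_PiE K_def)
  then have S_compact: "compact_space S" by (simp add: S_def compact_space_subtopology)
  have "Hausdorff_space S"
    unfolding S_def by (intro Hausdorff_space_subtopology) (simp add: Hausdorff_space_product_topology)
  then have S_Baire: "locally_compact_space S \<and> regular_space S"
    using S_compact compact_imp_locally_compact_space compact_Hausdorff_imp_regular_space by blast
  have topS: "topspace S = K" using KP by (auto simp: S_def)
  \<comment> \<open>An entourage on \<open>B\<close> that tests only the functions
    \<open>F (d i)\<close> with \<open>i \<le> n\<close>; \<open>A n\<close> collects the limits
    that vary by at most \<open>r\<close> on it.\<close>
  define Z where "Z = (\<lambda>n::nat. {(x, y). x \<in> B \<and> y \<in> B \<and>
    (\<forall>i\<le>n. cmod (F (d i) x - F (d i) y) \<le> 1 / Suc n)})"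
  define A where "A = (\<lambda>n. {k \<in> K. \<forall>(x, y)\<in>Z n. cmod (k x - k y) \<le> r})"
  have closedA: "closedin S (A n)" for n
  proof -
    have "closedin ?P {k \<in> topspace ?P. k x - k y \<in> cball 0 r}" if "x \<in> B" "y \<in> B" for x y
    proof -
      have "continuous_map ?P euclidean (\<lambda>k. k x - k y)"
        using that by (intro continuous_map_diff continuous_map_product_projection)
      then show ?thesis by (rule closedin_continuous_map_preimage) simp
    qed
    then have "closedin ?P (\<Inter>(insert K ((\<lambda>(x, y). {k \<in> topspace ?P. k x - k y \<in> cball 0 r}) ` Z n)))"
      by (intro closedin_Inter) (auto simp: K_def Z_def)
    also have "\<Inter>(insert K ((\<lambda>(x, y). {k \<in> topspace ?P. k x - k y \<in> cball 0 r}) ` Z n)) = A n"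
      using KP unfolding A_def by (auto simp: case_prod_beta)
    finally show ?thesis
      unfolding S_def by (rule closedin_subset_topspace) (auto simp: A_def)
  qed
  \<comment> \<open>If \<open>k\<close> lay in no \<open>A n\<close>, there would be pairs in
    \<open>Z n\<close> on which \<open>k\<close> differs by more than \<open>r\<close>. The limits
    of \<open>F a\<close> along the two halves of these pairs agree for \<open>a = d i\<close>,
    hence for all \<open>a\<close>, and the double limit property transfers this to
    \<open>k\<close>.\<close>
  have cover: "\<exists>n. k \<in> A n" if kK: "k \<in> K" for k
  proof (rule ccontr)
    assume "\<nexists>n. k \<in> A n"
    then have "\<exists>p. p \<in> Z n \<and> cmod (k (fst p) - k (snd p)) > r" for n
    proof -
      have "k \<notin> A n" using \<open>\<nexists>n. k \<in> A n\<close> by blast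
      then show ?thesis using kK unfolding A_def by (fastforce simp: not_le)
    qed
    then obtain p where p: "\<And>n. p n \<in> Z n" "\<And>n. cmod (k (fst (p n)) - k (snd (p n))) > r"
      by metis
    define x where "x = (\<lambda>n. fst (p n))"
    define y where "y = (\<lambda>n. snd (p n))"
    have xy: "x n \<in> B" "y n \<in> B" "\<And>i. i \<le> n \<Longrightarrow> cmod (F (d i) (x n) - F (d i) (y n)) \<le> 1 / Suc n"
      "cmod (k (x n) - k (y n)) > r" for n
      using p[of n] by (auto simp: x_def y_def Z_def case_prod_beta)
    obtain N where N: "N \<le> sequentially" "ultrafilter N"
      using ultrafilter_exists[OF sequentially_bot] by blast
    have Nb: "N \<noteq> bot" using N(2) ultrafilter_not_bot by blast
    have kC: "cmod (k b) \<le> C" if "b \<in> B" for b using Kbox kK that by (auto simp: PiE_iff)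
    obtain U where U: "ultrafilter U" "eventually (\<lambda>a. a \<in> topspace X) U" "limitin ?P E k U"
      using kK unfolding K_def by (rule closure_of_ultrafilter)
    have Uk: "((\<lambda>a. F a b) \<longlongrightarrow> k b) U" if "b \<in> B" for b
      using limitin_product_eval[OF U(3)[unfolded E_def] that] .
    \<comment> \<open>The last clause is the double limit property with \<open>F a\<close> in place
      of \<open>k\<close>; it extends the equality of \<open>l\<close> and \<open>l'\<close> from
      the dense sequence to all points.\<close>
    have main: "\<exists>s l. ((\<lambda>n. k (w n)) \<longlongrightarrow> s) N \<and> (l \<longlongrightarrow> s) U \<and>
        (\<forall>a\<in>topspace X. ((\<lambda>n. F a (w n)) \<longlongrightarrow> l a) N) \<and>
        (\<forall>a\<in>topspace X. \<forall>W. ultrafilter W \<longrightarrow> eventually (\<lambda>a. a \<in> topspace X) W \<longrightarrow>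
          (\<forall>b\<in>B. ((\<lambda>a. F a b) \<longlongrightarrow> F a b) W) \<longrightarrow> (l \<longlongrightarrow> l a) W)"
      if w: "\<And>n. w n \<in> B" for w
    proof -
      let ?V = "filtermap w N"
      have V: "ultrafilter ?V" "eventually (\<lambda>b. b \<in> B) ?V"
        using ultrafilter_filtermap[OF N(2)] w by (auto simp: eventually_filtermap)
      obtain s where s: "((\<lambda>n. k (w n)) \<longlongrightarrow> s) N"
        using bounded_ultrafilter_limit[OF N(2), of "\<lambda>n. k (w n)" C] kC w by auto
      define l where "l = (\<lambda>a. Lim N (\<lambda>n. F a (w n)))"
      have l: "((\<lambda>n. F a (w n)) \<longlongrightarrow> l a) N" if "a \<in> topspace X" for a
        unfolding l_def using ultrafilter_Lim[OF N(2), of "\<lambda>n. F a (w n)" C] bd that w by auto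
      have "(l \<longlongrightarrow> s) U"
        by (rule dlc[OF U(1,2) V Uk]) (use l s in \<open>auto simp: filterlim_filtermap\<close>)
      moreover have "(l \<longlongrightarrow> l a) W" if "a \<in> topspace X" "ultrafilter W"
        "eventually (\<lambda>a. a \<in> topspace X) W" "\<forall>b\<in>B. ((\<lambda>a. F a b) \<longlongrightarrow> F a b) W" for a W
        by (rule dlc[OF that(2,3) V, of "F a" l]) (use l that in \<open>auto simp: filterlim_filtermap\<close>)
      ultimately show ?thesis using s l by blast
    qed
    obtain s l where s: "((\<lambda>n. k (x n)) \<longlongrightarrow> s) N" "(l \<longlongrightarrow> s) U"
      and l: "\<And>a. a \<in> topspace X \<Longrightarrow> ((\<lambda>n. F a (x n)) \<longlongrightarrow> l a) N"
      and lW: "\<And>a W. a \<in> topspace X \<Longrightarrow> ultrafilter W \<Longrightarrow> eventually (\<lambda>a. a \<in> topspace X) W \<Longrightarrow>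
          (\<forall>b\<in>B. ((\<lambda>a. F a b) \<longlongrightarrow> F a b) W) \<Longrightarrow> (l \<longlongrightarrow> l a) W"
      using main[of x] xy(1) by blast
    obtain s' l' where s': "((\<lambda>n. k (y n)) \<longlongrightarrow> s') N" "(l' \<longlongrightarrow> s') U"
      and l': "\<And>a. a \<in> topspace X \<Longrightarrow> ((\<lambda>n. F a (y n)) \<longlongrightarrow> l' a) N"
      and lW': "\<And>a W. a \<in> topspace X \<Longrightarrow> ultrafilter W \<Longrightarrow> eventually (\<lambda>a. a \<in> topspace X) W \<Longrightarrow>
          (\<forall>b\<in>B. ((\<lambda>a. F a b) \<longlongrightarrow> F a b) W) \<Longrightarrow> (l' \<longlongrightarrow> l' a) W"
      using main[of y] xy(2) by blast
    have eq_d: "l (d i) = l' (d i)" for i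
    proof -
      have "((\<lambda>n. F (d i) (x n) - F (d i) (y n)) \<longlongrightarrow> 0) sequentially"
      proof (rule Lim_null_comparison[OF _ LIMSEQ_inverse_real_of_nat])
        show "\<forall>\<^sub>F n in sequentially. cmod (F (d i) (x n) - F (d i) (y n)) \<le> inverse (real (Suc n))"
          using eventually_ge_at_top[of i]
          by eventually_elim (use xy(3) in \<open>simp add: inverse_eq_divide\<close>)
      qed
      then have "((\<lambda>n. F (d i) (x n) - F (d i) (y n)) \<longlongrightarrow> 0) N"
        using N(1) by (rule tendsto_mono[rotated])
      moreover have "((\<lambda>n. F (d i) (x n) - F (d i) (y n)) \<longlongrightarrow> l (d i) - l' (d i)) N"
        by (intro tendsto_diff l l' dX)
      ultimately show ?thesis using tendsto_unique[OF Nb] by fastforce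
    qed
    have eq: "l a = l' a" if a: "a \<in> topspace X" for a
    proof -
      have "a \<in> X closure_of (range d)"
        unfolding in_closure_of using a dense by fast
      then obtain W where W: "ultrafilter W" "limitin X d a W"
        by (rule closure_of_ultrafilter)
      let ?W = "filtermap d W"
      have W': "ultrafilter ?W" "eventually (\<lambda>a. a \<in> topspace X) ?W"
        using ultrafilter_filtermap[OF W(1)] dX by (auto simp: eventually_filtermap)
      have F: "\<forall>b\<in>B. ((\<lambda>a. F a b) \<longlongrightarrow> F a b) ?W"
        using continuous_map_limit[OF cont W(2)] by (auto simp: filterlim_filtermap o_def)
      have "(l \<longlongrightarrow> l a) ?W" "(l' \<longlongrightarrow> l' a) ?W"
        using lW[OF a W' F] lW'[OF a W' F] by auto
      then have "((\<lambda>i. l (d i)) \<longlongrightarrow> l a) W" "((\<lambda>i. l (d i)) \<longlongrightarrow> l' a) W"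
        by (simp_all add: filterlim_filtermap eq_d)
      then show ?thesis
        using tendsto_unique W(1) ultrafilter_not_bot by blast
    qed
    have "(l \<longlongrightarrow> s') U"
      using s'(2) by (rule Lim_transform_eventually) (use U(2) in \<open>eventually_elim, simp add: eq\<close>)
    then have "s = s'"
      using s(2) tendsto_unique U(1) ultrafilter_not_bot by blast
    then have "((\<lambda>n. k (x n) - k (y n)) \<longlongrightarrow> 0) N"
      using tendsto_diff[OF s(1) s'(1)] by simp
    then have "eventually (\<lambda>n. cmod (k (x n) - k (y n)) < r) N"
      using tendstoD[OF _ r] by fastforce
    then show False
      using xy(4) Nb eventually_happens[of _ N] by (meson order_less_asym)
  qed
  have Xne: "topspace X \<noteq> {}" using dX by blast
  \<comment> \<open>Baire category in the compact Hausdorff space \<open>S\<close>, which the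
    countably many closed sets \<open>A n\<close> cover.\<close>
  have "\<exists>n. S interior_of A n \<noteq> {}"
  proof (rule ccontr)
    assume "\<nexists>n. S interior_of A n \<noteq> {}"
    then have "S interior_of \<Union>(range A) = {}"
      using S_Baire closedA by (intro Baire_category_alt) auto
    moreover have "\<Union>(range A) = topspace S"
      unfolding topS using cover by (auto simp: A_def)
    moreover have "K \<noteq> {}" using EK Xne by blast
    ultimately show False using interior_of_topspace[of S] topS by metis
  qed
  then obtain n z where z: "z \<in> S interior_of A n" by blast
  then obtain W where W: "openin S W" "z \<in> W" "W \<subseteq> A n"
    unfolding interior_of_def by blast
  then obtain O' where O': "openin ?P O'" "W = O' \<inter> K"
    unfolding S_def openin_subtopology by blast
  \<comment> \<open>The functions \<open>E a\<close> are dense in \<open>K\<close>, so the interior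
    point can be exchanged for one of them.\<close>
  obtain a0 where a0: "a0 \<in> topspace X" "E a0 \<in> O'"
  proof -
    have "z \<in> ?P closure_of (E ` topspace X)" "z \<in> O'" using W(2) O'(2) by (auto simp: K_def)
    then have "\<exists>y. y \<in> E ` topspace X \<and> y \<in> O'" using O'(1) by (meson in_closure_of)
    then show thesis using that by blast
  qed
  have contE: "continuous_map X ?P E"
    unfolding continuous_map_componentwise E_def by (auto simp: cont)
  have osc: "cmod (F a x - F a y) \<le> r" if "a \<in> topspace X" "E a \<in> O'" "(x, y) \<in> Z n" for a x y
  proof -
    have "E a \<in> A n" using that EK W(3) O'(2) by blast
    then have "cmod (E a x - E a y) \<le> r" using that(3) by (auto simp: A_def)
    then show ?thesis using that(3) by (auto simp: E_def Z_def)
  qed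
  obtain B0 where B0: "finite B0" "B0 \<subseteq> B"
    "\<And>b. b \<in> B \<Longrightarrow> \<exists>b0\<in>B0. \<forall>i\<le>n. cmod (F (d i) b - F (d i) b0) \<le> 1 / Suc n"
    by (rule finite_net_bounded_family[where F = "\<lambda>i. F (d i)" and n = n and B = B and C = C and e = "1 / Suc n"])
      (use bd dX in auto)
  \<comment> \<open>The values at the finite net \<open>B0\<close> are fixed up to \<open>r\<close>;
    membership of \<open>E a\<close> in \<open>O'\<close> controls the passage from an arbitrary
    \<open>b\<close> to its net point.\<close>
  define V where "V = \<Inter>(insert {a \<in> topspace X. E a \<in> O'}
    ((\<lambda>b. {a \<in> topspace X. F a b \<in> ball (F a0 b) r}) ` B0))"
  show thesis
  proof (rule that[of V])
    show "openin X V"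
      unfolding V_def
    proof (rule openin_Inter)
      fix Y assume "Y \<in> insert {a \<in> topspace X. E a \<in> O'} ((\<lambda>b. {a \<in> topspace X. F a b \<in> ball (F a0 b) r}) ` B0)"
      moreover have "openin X {a \<in> topspace X. E a \<in> O'}"
        by (rule openin_continuous_map_preimage[OF contE O'(1)])
      moreover have "openin X {a \<in> topspace X. F a b \<in> ball (F a0 b) r}" if "b \<in> B0" for b
        by (rule openin_continuous_map_preimage[OF cont]) (use that B0 in auto)
      ultimately show "openin X Y" by blast
    qed (use B0 in auto)
    have "a0 \<in> V" using a0 r by (auto simp: V_def)
    then show "V \<noteq> {}" by blast
    have near: "cmod (F a b - F a0 b) \<le> e / 2" if ab: "a \<in> V" "b \<in> B" for a b
    proof -
      obtain b0 where b0: "b0 \<in> B0" "\<forall>i\<le>n. cmod (F (d i) b - F (d i) b0) \<le> 1 / Suc n"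
        using B0(3)[OF ab(2)] by blast
      then have Zb: "(b, b0) \<in> Z n" using ab(2) B0(2) by (auto simp: Z_def)
      have a: "a \<in> topspace X" "E a \<in> O'" "cmod (F a0 b0 - F a b0) < r"
        using ab(1) b0(1) by (auto simp: V_def dist_norm)
      have "cmod (F a b - F a0 b) = cmod ((F a b - F a b0) - (F a0 b0 - F a b0) - (F a0 b - F a0 b0))"
        by simp
      also have "\<dots> \<le> cmod (F a b - F a b0) + cmod (F a0 b0 - F a b0) + cmod (F a0 b - F a0 b0)"
        by (intro norm_triangle_le_diff add_mono norm_triangle_ineq4 order_refl)
      also have "\<dots> \<le> r + r + r"
        using osc[OF a(1,2) Zb] osc[OF a0 Zb] a(3) by (intro add_mono) auto
      finally show ?thesis by (simp add: r_def)
    qed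
    fix a a' b assume "a \<in> V" "a' \<in> V" "b \<in> B"
    then have "cmod (F a b - F a0 b) \<le> e / 2" "cmod (F a' b - F a0 b) \<le> e / 2" using near by auto
    then show "cmod (F a b - F a' b) \<le> e"
      using norm_triangle_ineq4[of "F a b - F a0 b" "F a' b - F a0 b"] by simp
  qed
qed

section \<open>From small oscillation on an open set to uniform continuity\<close>

context semitopological_group
begin

text \<open>\<open>R U x y\<close> stands for \<open>x \<otimes> inv y \<in> U\<close> or for
  \<open>inv x \<otimes> y \<in> U\<close>. Compatibility with intersections makes the principal
  filters a filter base, so that the infimum can be unfolded.\<close>

lemma uniformly_continuous_wrt_INF:
  assumes "\<And>U V x y. R (U \<inter> V) x y \<longleftrightarrow> R U x y \<and> R V x y"
  shows "uniformly_continuous_wrt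
      (INF U\<in>{U. openin T U \<and> \<one> \<in> U}. principal {(x, y). R U x y}) f \<longleftrightarrow>
    (\<forall>e>0. \<exists>U. openin T U \<and> \<one> \<in> U \<and> (\<forall>x y. R U x y \<longrightarrow> cmod (f x - f y) < e))"
proof -
  let ?I = "INF U\<in>{U. openin T U \<and> \<one> \<in> U}. principal {(x, y). R U x y}"
  have ev: "eventually P ?I \<longleftrightarrow> (\<exists>U. openin T U \<and> \<one> \<in> U \<and> (\<forall>x y. R U x y \<longrightarrow> P (x, y)))" for P
  proof (subst eventually_INF_base)
    have "openin T (carrier G)" using openin_topspace[of T] topspace_eq by simp
    then show "{U. openin T U \<and> \<one> \<in> U} \<noteq> {}" using one_closed by blast
    show "\<exists>x\<in>{U. openin T U \<and> \<one> \<in> U}. principal {(xa, y). R x xa y}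
        \<le> inf (principal {(x, y). R a x y}) (principal {(x, y). R b x y})"
      if "a \<in> {U. openin T U \<and> \<one> \<in> U}" "b \<in> {U. openin T U \<and> \<one> \<in> U}" for a b
      using that assms by (intro bexI[of _ "a \<inter> b"]) auto
  qed (auto simp: eventually_principal)
  show ?thesis
    unfolding uniformly_continuous_wrt_def filterlim_iff ev eventually_uniformity_metric
  proof (intro iffI allI impI)
    fix e :: real
    assume *: "\<forall>P. (\<exists>e>0. \<forall>x y. dist x y < e \<longrightarrow> P (x, y)) \<longrightarrow>
        (\<exists>U. openin T U \<and> \<one> \<in> U \<and> (\<forall>x y. R U x y \<longrightarrow> P (case (x, y) of (x, y) \<Rightarrow> (f x, f y))))"
      and "e > 0"
    then show "\<exists>U. openin T U \<and> \<one> \<in> U \<and> (\<forall>x y. R U x y \<longrightarrow> cmod (f x - f y) < e)"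
      using *[rule_format, of "\<lambda>(x, y). dist x y < e"] by (auto simp: dist_norm)
  next
    fix P :: "complex \<times> complex \<Rightarrow> bool"
    assume *: "\<forall>e>0. \<exists>U. openin T U \<and> \<one> \<in> U \<and> (\<forall>x y. R U x y \<longrightarrow> cmod (f x - f y) < e)"
      and "\<exists>e>0. \<forall>x y. dist x y < e \<longrightarrow> P (x, y)"
    then obtain e where e: "e > 0" "\<And>x y. dist x y < e \<Longrightarrow> P (x, y)" by blast
    obtain U where "openin T U" "\<one> \<in> U" "\<forall>x y. R U x y \<longrightarrow> cmod (f x - f y) < e"
      using * e(1) by blast
    then show "\<exists>U. openin T U \<and> \<one> \<in> U \<and> (\<forall>x y. R U x y \<longrightarrow> P (case (x, y) of (x, y) \<Rightarrow> (f x, f y)))"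
      using e(2) by (intro exI[of _ U]) (simp add: dist_norm)
  qed
qed

lemma right_uniformly_continuous_iff:
  "uniformly_continuous_wrt (right_uniformity G T) f \<longleftrightarrow>
    (\<forall>e>0. \<exists>U. openin T U \<and> \<one> \<in> U \<and>
      (\<forall>x y. x \<in> carrier G \<and> y \<in> carrier G \<and> x \<otimes> inv y \<in> U \<longrightarrow> cmod (f x - f y) < e))"
  unfolding right_uniformity_def by (rule uniformly_continuous_wrt_INF) auto

lemma left_uniformly_continuous_iff:
  "uniformly_continuous_wrt (left_uniformity G T) f \<longleftrightarrow>
    (\<forall>e>0. \<exists>U. openin T U \<and> \<one> \<in> U \<and>
      (\<forall>x y. x \<in> carrier G \<and> y \<in> carrier G \<and> inv x \<otimes> y \<in> U \<longrightarrow> cmod (f x - f y) < e))"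
  unfolding left_uniformity_def by (rule uniformly_continuous_wrt_INF) auto

text \<open>The weak limit \<open>k'\<close> of the translates agrees with \<open>k\<close> on the
  group. The functional \<open>Lim V\<close> sends the translate by \<open>a\<close> to
  \<open>l a\<close> and sends \<open>k'\<close> to \<open>s\<close>, so weak convergence along
  \<open>U\<close> is the claim.\<close>

lemma double_limit:
  assumes fBC: "f \<in> BC" and conv: "orbit_map_converges f"
    and U: "ultrafilter U" "eventually (\<lambda>a. a \<in> carrier G) U"
    and V: "ultrafilter V" "eventually (\<lambda>b. b \<in> carrier G) V"
    and k: "\<And>b. b \<in> carrier G \<Longrightarrow> ((\<lambda>a. f (a \<otimes> b)) \<longlongrightarrow> k b) U"
    and l: "\<And>a. a \<in> carrier G \<Longrightarrow> ((\<lambda>b. f (a \<otimes> b)) \<longlongrightarrow> l a) V"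
    and s: "(k \<longlongrightarrow> s) V"
  shows "(l \<longlongrightarrow> s) U"
proof -
  have Vb: "V \<noteq> bot" and Ub: "U \<noteq> bot" using U V ultrafilter_not_bot by auto
  obtain k' where k': "k' \<in> BC" "\<And>\<phi>. \<phi> \<in> BC_dual \<Longrightarrow> ((\<lambda>h. \<phi> (translate G h f)) \<longlongrightarrow> \<phi> k') U"
    using conv U unfolding orbit_map_converges_def by blast
  have "k' b = k b" if "b \<in> carrier G" for b
    using tendsto_unique[OF Ub k'(2)[OF evaluation_in_dual[OF that]]] k[OF that] that
    by (simp add: translate_def)
  then have "(k' \<longlongrightarrow> s) V"
    by (intro Lim_transform_eventually[OF s]) (use V(2) in \<open>eventually_elim, simp\<close>)
  then have s': "Lim V k' = s" by (rule tendsto_Lim[OF Vb])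
  have "Lim V (translate G a f) = l a" if a: "a \<in> carrier G" for a
  proof (rule tendsto_Lim[OF Vb], rule Lim_transform_eventually[OF l[OF a]])
    show "\<forall>\<^sub>F b in V. f (a \<otimes> b) = translate G a f b"
      using V(2) by eventually_elim (simp add: translate_def)
  qed
  then have "\<forall>\<^sub>F a in U. Lim V (translate G a f) = l a"
    using U(2) by (auto elim: eventually_mono)
  then show ?thesis
    using Lim_transform_eventually[OF k'(2)[OF Lim_in_dual[OF V]]] s' by simp
qed

text \<open>Let all functions \<open>f (a \<otimes> b)\<close> of \<open>a\<close> vary little on
  \<open>V\<close> and let \<open>a \<in> V\<close>. If \<open>x \<otimes> inv y\<close> is so near
  the identity that \<open>x \<otimes> inv y \<otimes> a \<in> V\<close>, the choice
  \<open>b = inv a \<otimes> y\<close> turns the two values into \<open>f x\<close> and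
  \<open>f y\<close>. For the left uniformity the factors are exchanged.\<close>

theorem WAP_subset_Roelcke:
  fixes d :: "nat \<Rightarrow> 'a"
  assumes d: "\<And>n. d n \<in> carrier G" and dense: "\<And>V. openin T V \<Longrightarrow> V \<noteq> {} \<Longrightarrow> \<exists>n. d n \<in> V"
  shows "WAP_algebra G T \<subseteq> Roelcke_algebra G T"
proof
  fix f assume "f \<in> WAP_algebra G T"
  then have fBC: "f \<in> BC" and conv: "orbit_map_converges f" by (auto simp: WAP_iff)
  obtain C where C: "\<And>x. cmod (f x) \<le> C" using BC_bounded[OF fBC] by blast
  have fc: "continuous_map T euclidean f" using fBC by (simp add: BC_iff)
  \<comment> \<open>The double limit property with the factors exchanged: boundedness provides some
    limit of \<open>l\<close> along \<open>U\<close>, and \<open>double_limit\<close>, with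
    \<open>U\<close> and \<open>V\<close> in opposite roles, identifies it with
    \<open>s\<close>.\<close>
  have dl: "(l \<longlongrightarrow> s) U" if as: "ultrafilter U" "eventually (\<lambda>a. a \<in> carrier G) U"
    "ultrafilter V" "eventually (\<lambda>b. b \<in> carrier G) V"
    "\<And>b. b \<in> carrier G \<Longrightarrow> ((\<lambda>a. f (b \<otimes> a)) \<longlongrightarrow> k b) U"
    "\<And>a. a \<in> carrier G \<Longrightarrow> ((\<lambda>b. f (b \<otimes> a)) \<longlongrightarrow> l a) V" "(k \<longlongrightarrow> s) V" for U V k l s
  proof -
    have Vb: "V \<noteq> bot" using as(3) ultrafilter_not_bot by blast
    have lC: "cmod (l a) \<le> C" if "a \<in> carrier G" for a
      using tendsto_upperbound[OF tendsto_norm[OF \<open>\<And>a. a \<in> carrier G \<Longrightarrow> ((\<lambda>b. f (b \<otimes> a)) \<longlongrightarrow> l a) V\<close>[OF that]] _ Vb]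
        C by simp
    have "eventually (\<lambda>a. cmod (l a) \<le> C) U"
      using as(2) by eventually_elim (rule lC)
    then obtain s' where s': "(l \<longlongrightarrow> s') U" by (rule bounded_ultrafilter_limit[OF as(1)])
    have "(k \<longlongrightarrow> s') V"
      by (rule double_limit[OF fBC conv as(3,4,1,2,6,5) s'])
    then show ?thesis using s' tendsto_unique[OF Vb as(7)] by simp
  qed
  have "uniformly_continuous_wrt (right_uniformity G T) f"
    unfolding right_uniformly_continuous_iff
  proof (intro allI impI)
    fix e :: real assume "e > 0"
    then have e: "e / 2 > 0" by simp
    obtain V where V: "openin T V" "V \<noteq> {}"
      "\<And>a a' b. a \<in> V \<Longrightarrow> a' \<in> V \<Longrightarrow> b \<in> carrier G \<Longrightarrow> cmod (f (a \<otimes> b) - f (a' \<otimes> b)) \<le> e / 2"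
    proof (rule oscillation_small_on_open_set[where F = "\<lambda>a b. f (a \<otimes> b)" and X = T and d = d and B = "topspace T" and C = C, OF _ dense _ _ _ e])
      show "continuous_map T euclidean (\<lambda>a. f (a \<otimes> b))" if "b \<in> topspace T" for b
        using continuous_map_compose[OF continuous_right_mult[OF that[unfolded topspace_eq]] fc] by (simp add: o_def)
      show "((l \<longlongrightarrow> s) U)" if "ultrafilter U" "eventually (\<lambda>a. a \<in> topspace T) U"
        "ultrafilter V" "eventually (\<lambda>b. b \<in> topspace T) V"
        "\<And>b. b \<in> topspace T \<Longrightarrow> ((\<lambda>a. f (a \<otimes> b)) \<longlongrightarrow> k b) U"
        "\<And>a. a \<in> topspace T \<Longrightarrow> ((\<lambda>b. f (a \<otimes> b)) \<longlongrightarrow> l a) V" "(k \<longlongrightarrow> s) V" for U V k l s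
        using that by (rule double_limit[OF fBC conv, folded topspace_eq])
      show "d n \<in> topspace T" for n using d by (simp add: topspace_eq)
    qed (simp_all add: C topspace_eq)
    then obtain a where a: "a \<in> V" by blast
    have aG: "a \<in> carrier G" using a V(1) openin_subset topspace_eq by blast
    show "\<exists>U. openin T U \<and> \<one> \<in> U \<and>
      (\<forall>x y. x \<in> carrier G \<and> y \<in> carrier G \<and> x \<otimes> inv y \<in> U \<longrightarrow> cmod (f x - f y) < e)"
    proof (intro exI conjI allI impI)
      show "openin T {u \<in> topspace T. u \<otimes> a \<in> V}"
        by (rule openin_continuous_map_preimage[OF continuous_right_mult[OF aG] V(1)])
      show "\<one> \<in> {u \<in> topspace T. u \<otimes> a \<in> V}" using a aG by (simp add: topspace_eq)
      fix x y assume xy: "x \<in> carrier G \<and> y \<in> carrier G \<and> x \<otimes> inv y \<in> {u \<in> topspace T. u \<otimes> a \<in> V}"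
      then have "cmod (f ((x \<otimes> inv y \<otimes> a) \<otimes> (inv a \<otimes> y)) - f (a \<otimes> (inv a \<otimes> y))) \<le> e / 2"
        using V(3) a aG by simp
      moreover have "(x \<otimes> inv y \<otimes> a) \<otimes> (inv a \<otimes> y) = x" "a \<otimes> (inv a \<otimes> y) = y"
        using xy aG by (simp_all add: m_assoc inv_solve_left' m_assoc[symmetric, of a "inv a" y] m_assoc[symmetric, of "inv y" y])
      ultimately show "cmod (f x - f y) < e" using \<open>e > 0\<close> by simp
    qed
  qed
  moreover have "uniformly_continuous_wrt (left_uniformity G T) f"
    unfolding left_uniformly_continuous_iff
  proof (intro allI impI)
    fix e :: real assume "e > 0"
    then have e: "e / 2 > 0" by simp
    obtain V where V: "openin T V" "V \<noteq> {}"
      "\<And>a a' b. a \<in> V \<Longrightarrow> a' \<in> V \<Longrightarrow> b \<in> carrier G \<Longrightarrow> cmod (f (b \<otimes> a) - f (b \<otimes> a')) \<le> e / 2"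
    proof (rule oscillation_small_on_open_set[where F = "\<lambda>a b. f (b \<otimes> a)" and X = T and d = d and B = "topspace T" and C = C, OF _ dense _ _ _ e])
      show "continuous_map T euclidean (\<lambda>a. f (b \<otimes> a))" if "b \<in> topspace T" for b
        using continuous_map_compose[OF continuous_left_mult[OF that[unfolded topspace_eq]] fc] by (simp add: o_def)
      show "((l \<longlongrightarrow> s) U)" if "ultrafilter U" "eventually (\<lambda>a. a \<in> topspace T) U"
        "ultrafilter V" "eventually (\<lambda>b. b \<in> topspace T) V"
        "\<And>b. b \<in> topspace T \<Longrightarrow> ((\<lambda>a. f (b \<otimes> a)) \<longlongrightarrow> k b) U"
        "\<And>a. a \<in> topspace T \<Longrightarrow> ((\<lambda>b. f (b \<otimes> a)) \<longlongrightarrow> l a) V" "(k \<longlongrightarrow> s) V" for U V k l s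
        using that by (rule dl[folded topspace_eq])
      show "d n \<in> topspace T" for n using d by (simp add: topspace_eq)
    qed (simp_all add: C topspace_eq)
    then obtain a where a: "a \<in> V" by blast
    have aG: "a \<in> carrier G" using a V(1) openin_subset topspace_eq by blast
    show "\<exists>U. openin T U \<and> \<one> \<in> U \<and>
      (\<forall>x y. x \<in> carrier G \<and> y \<in> carrier G \<and> inv x \<otimes> y \<in> U \<longrightarrow> cmod (f x - f y) < e)"
    proof (intro exI conjI allI impI)
      show "openin T {u \<in> topspace T. a \<otimes> u \<in> V}"
        by (rule openin_continuous_map_preimage[OF continuous_left_mult[OF aG] V(1)])
      show "\<one> \<in> {u \<in> topspace T. a \<otimes> u \<in> V}" using a aG by (simp add: topspace_eq)
      fix x y assume xy: "x \<in> carrier G \<and> y \<in> carrier G \<and> inv x \<otimes> y \<in> {u \<in> topspace T. a \<otimes> u \<in> V}"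
      then have "cmod (f ((x \<otimes> inv a) \<otimes> a) - f ((x \<otimes> inv a) \<otimes> (a \<otimes> (inv x \<otimes> y)))) \<le> e / 2"
        using V(3) a aG by simp
      moreover have "(x \<otimes> inv a) \<otimes> (a \<otimes> (inv x \<otimes> y)) = y" "(x \<otimes> inv a) \<otimes> a = x"
        using xy aG by (simp_all add: m_assoc m_assoc[symmetric, of "inv a" a] m_assoc[symmetric, of x "inv x" y])
      ultimately show "cmod (f x - f y) < e" using \<open>e > 0\<close> by simp
    qed
  qed
  moreover have "f \<in> bounded_functions G"
    using fBC by (simp add: bounded_continuous_def)
  ultimately show "f \<in> Roelcke_algebra G T" by (simp add: Roelcke_algebra_def)
qed

end

section \<open>A chart onto the unit interval\<close>

text \<open>The point of the Cantor set with ternary digits 0 and 2; leaving out the digit 1 makes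
  the coding injective.\<close>

definition ternary :: "(nat \<Rightarrow> bool) \<Rightarrow> real" where
  "ternary c = (\<Sum>m. if c m then 2 / 3 ^ Suc m else 0)"

text \<open>Drops the first \<open>m\<close> digits. The threshold \<open>1/2\<close> lies in the
  middle gap of the Cantor set, so the leading digit is read off by one measurable
  comparison.\<close>

fun ternary_remainder :: "nat \<Rightarrow> real \<Rightarrow> real" where
  "ternary_remainder 0 y = y"
| "ternary_remainder (Suc m) y =
    3 * ternary_remainder m y - (if ternary_remainder m y \<ge> 1/2 then 2 else 0)"

lemma ternary_sums: "(\<lambda>m. 2 / 3 ^ Suc m :: real) sums 1"
  using sums_mult[OF geometric_sums[of "1/3::real"], of "2/3"]
  by (simp add: power_one_over field_simps)

lemma summable_ternary: "summable (\<lambda>m. if c m then 2 / 3 ^ Suc m else 0 :: real)"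
  by (rule summable_comparison_test'[OF sums_summable[OF ternary_sums], of 0]) auto

lemma ternary_bounds: "0 \<le> ternary c" "ternary c \<le> 1"
proof -
  show "0 \<le> ternary c" unfolding ternary_def by (rule suminf_nonneg[OF summable_ternary]) auto
  have "ternary c \<le> (\<Sum>m. 2 / 3 ^ Suc m)"
    unfolding ternary_def
    by (rule suminf_le[OF _ summable_ternary sums_summable[OF ternary_sums]]) auto
  then show "ternary c \<le> 1" using sums_unique[OF ternary_sums] by simp
qed

lemma ternary_shift: "ternary c = (if c 0 then 2/3 else 0) + ternary (\<lambda>m. c (Suc m)) / 3"
proof -
  have "ternary c = (\<Sum>m. if c (Suc m) then 2 / 3 ^ Suc (Suc m) else 0) + (if c 0 then 2 / 3 ^ Suc 0 else 0)"
    unfolding ternary_def using suminf_split_head[OF summable_ternary[of c]] by simp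
  also have "(\<lambda>m. if c (Suc m) then 2 / 3 ^ Suc (Suc m) else 0 :: real)
      = (\<lambda>m. (if c (Suc m) then 2 / 3 ^ Suc m else 0) / 3)"
    by auto
  also have "suminf \<dots> = ternary (\<lambda>m. c (Suc m)) / 3"
    unfolding ternary_def by (rule suminf_divide[OF summable_ternary])
  finally show ?thesis by simp
qed

lemma ternary_ge_half_iff: "ternary c \<ge> 1/2 \<longleftrightarrow> c 0"
  using ternary_shift[of c] ternary_bounds[of "\<lambda>m. c (Suc m)"] by auto

lemma ternary_remainder_ternary: "ternary_remainder m (ternary c) = ternary (\<lambda>j. c (m + j))"
proof (induction m)
  case (Suc m)
  have "3 * ternary (\<lambda>j. c (m + j)) - (if c m then 2 else 0) = ternary (\<lambda>j. c (Suc m + j))"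
    using ternary_shift[of "\<lambda>j. c (m + j)"] by (simp add: field_simps)
  then show ?case using ternary_ge_half_iff[of "\<lambda>j. c (m + j)"] by (simp add: Suc)
qed simp

lemma ternary_digit: "ternary_remainder m (ternary c) \<ge> 1/2 \<longleftrightarrow> c m"
  using ternary_ge_half_iff[of "\<lambda>j. c (m + j)"] by (simp add: ternary_remainder_ternary)

lemma measurable_ternary_remainder [measurable]: "ternary_remainder m \<in> borel_measurable borel"
proof (induction m)
  case (Suc m)
  note Suc[measurable]
  have "(\<lambda>y. 3 * ternary_remainder m y - (if ternary_remainder m y \<ge> 1/2 then 2 else 0)) \<in> borel_measurable borel"
    by measurable
  then show ?case by simp
qed simp

text \<open>A point is coded by the balls of radius \<open>2\<^sup>-\<^sup>n\<close> around a dense sequence that contain it; decoding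
  takes the limit of the first admissible centres, where completeness makes the set of admissible codes
  Borel.\<close>

lemma standard_borel_real_embedding:
  fixes M :: "'a measure"
  assumes "standard_borel M" and x0: "x0 \<in> space M"
  obtains \<phi> :: "'a \<Rightarrow> real" and \<kappa> :: "real \<Rightarrow> 'a"
  where "\<phi> \<in> borel_measurable M" "\<kappa> \<in> measurable borel M" "\<forall>x\<in>space M. \<kappa> (\<phi> x) = x"
proof -
  obtain T where T: "completely_metrizable_space T" "second_countable T" "topspace T = space M"
    and sets: "sets M = sigma_sets (space M) {U. openin T U}"
    using assms(1) unfolding standard_borel_def by blast
  obtain S d where "Metric_space S d" and complete: "Metric_space.mcomplete S d"
    and T_eq: "T = Metric_space.mtopology S d"
    using T(1) unfolding completely_metrizable_space_def by blast
  interpret Metric_space S d by fact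
  have S: "S = space M" using T(3) T_eq by simp
  have open_sets: "openin mtopology U \<Longrightarrow> U \<in> sets M" for U
    unfolding sets T_eq by auto
  obtain D where D: "countable D" "D \<subseteq> S" "mtopology closure_of D = S"
    using second_countable_imp_separable_space[OF T(2)] unfolding T_eq separable_space_def by auto
  have "D \<noteq> {}" using D(3) x0 S by auto
  define q where "q = from_nat_into D"
  have q: "range q = D"
    unfolding q_def by (rule range_from_nat_into[OF \<open>D \<noteq> {}\<close> D(1)])
  have qS: "q i \<in> S" for i using q D(2) by auto
  define r where "r = (\<lambda>n::nat. (1/2::real) ^ n)"
  have r_pos: "r n > 0" for n by (simp add: r_def)
  have r_Suc: "r (Suc n) = r n / 2" for n by (simp add: r_def)
  have r_small: "\<exists>n. c * r n < e" if "e > 0" "c > 0" for c e :: real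
    using real_arch_pow_inv[of "e / c" "1/2"] that by (auto simp: r_def field_simps)
  have approx: "\<exists>i. d x (q i) < e" if x: "x \<in> S" and e: "e > 0" for x e
  proof -
    have "x \<in> mtopology closure_of D" using x D(3) by simp
    then obtain y where "y \<in> D" "y \<in> mball x e"
      using e unfolding metric_closure_of by blast
    then show ?thesis using q by auto
  qed
  \<comment> \<open>Digit \<open>m\<close> belongs to a pair: \<open>prod_decode m\<close> gives the
    index of the radius and the index of the centre.\<close>
  define c where "c = (\<lambda>x m. d x (q (snd (prod_decode m))) < r (fst (prod_decode m)))"
  define \<phi> where "\<phi> = (\<lambda>x. ternary (c x))"
  have "Measurable.pred M (\<lambda>x. c x m)" for m
  proof -
    have "{x \<in> space M. c x m} = mball (q (snd (prod_decode m))) (r (fst (prod_decode m)))"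
      using qS by (auto simp: c_def S[symmetric] commute)
    then show ?thesis unfolding pred_def using open_sets openin_mball by metis
  qed
  then have \<phi>_meas: "\<phi> \<in> borel_measurable M"
    unfolding \<phi>_def ternary_def by measurable
  \<comment> \<open>The first centre whose ball of radius \<open>r n\<close> contains the coded
    point. On a real number that codes no point, \<open>LEAST\<close> still returns some
    index.\<close>
  define I where "I = (\<lambda>n y. LEAST i. ternary_remainder (prod_encode (n, i)) y \<ge> 1/2)"
  have I_meas [measurable]: "I n \<in> measurable borel (count_space UNIV)" for n
    unfolding I_def by measurable
  define z where "z = (\<lambda>n y. q (I n y))"
  have zS: "z n y \<in> S" for n y by (simp add: z_def qS)
  have z_near: "d x (z n (\<phi> x)) < r n" if x: "x \<in> S" for x n
  proof -
    have "c x (prod_encode (n, i)) \<longleftrightarrow> d x (q i) < r n" for i by (simp add: c_def)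
    then have I_eq: "I n (\<phi> x) = (LEAST i. d x (q i) < r n)"
      unfolding I_def \<phi>_def ternary_digit by simp
    obtain i where "d x (q i) < r n" using approx[OF x r_pos] by blast
    then show ?thesis unfolding z_def I_eq by (rule LeastI)
  qed
  \<comment> \<open>For the code of a point, consecutive centres are less than
    \<open>r n + r (Suc n)\<close> apart, so the code lies in \<open>Z\<close>. The condition is
    Borel and already makes the centres a Cauchy sequence.\<close>
  define Z where "Z = {y. \<forall>n. d (z n y) (z (Suc n) y) < 2 * r n}"
  have \<phi>Z: "\<phi> x \<in> Z" if x: "x \<in> S" for x
    unfolding Z_def mem_Collect_eq
  proof
    fix n
    have "d (z n (\<phi> x)) (z (Suc n) (\<phi> x)) \<le> d x (z n (\<phi> x)) + d x (z (Suc n) (\<phi> x))"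
      using triangle''[of x "z n (\<phi> x)" "z (Suc n) (\<phi> x)"] x zS by (metis commute triangle)
    then show "d (z n (\<phi> x)) (z (Suc n) (\<phi> x)) < 2 * r n"
      using z_near[OF x, of n] z_near[OF x, of "Suc n"] r_Suc[of n] r_pos[of n] by linarith
  qed
  \<comment> \<open>The right-hand side is the geometric sum of the steps \<open>2 * r j\<close> for
    \<open>j\<close> from \<open>n\<close> up to \<open>n + k - 1\<close>.\<close>
  have tele: "d (z n y) (z (n + k) y) \<le> 4 * r n - 4 * r (n + k)" if y: "y \<in> Z" for n k y
  proof (induction k)
    case (Suc k)
    have "d (z n y) (z (n + Suc k) y) \<le> d (z n y) (z (n + k) y) + d (z (n + k) y) (z (Suc (n + k)) y)"
      using triangle[OF zS zS zS] by simp
    also have "\<dots> \<le> (4 * r n - 4 * r (n + k)) + 2 * r (n + k)"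
      using y Suc unfolding Z_def by (intro add_mono) (auto simp: less_imp_le)
    finally show ?case by (simp add: r_Suc)
  qed (simp add: zS)
  have tele': "d (z n y) (z m y) \<le> 4 * r n" if "y \<in> Z" "n \<le> m" for n m y
    using tele[OF that(1), of n "m - n"] that(2) r_pos[of m] by simp
  have "\<exists>l. limitin mtopology (\<lambda>n. z n y) l sequentially" if y: "y \<in> Z" for y
  proof -
    have "MCauchy (\<lambda>n. z n y)"
      unfolding MCauchy_def
    proof (intro conjI allI impI)
      show "range (\<lambda>n. z n y) \<subseteq> S" using zS by auto
      fix e :: real assume "e > 0"
      then obtain N where N: "8 * r N < e" using r_small[of e 8] by auto
      have "d (z n y) (z m y) < e" if "N \<le> n" "N \<le> m" for n m
      proof -
        have "d (z n y) (z m y) \<le> d (z N y) (z n y) + d (z N y) (z m y)"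
          using triangle[OF zS[of n y] zS[of N y] zS[of m y]] commute[of "z n y" "z N y"] by simp
        then show ?thesis using tele'[OF y that(1)] tele'[OF y that(2)] N by linarith
      qed
      then show "\<exists>N. \<forall>n n'. N \<le> n \<longrightarrow> N \<le> n' \<longrightarrow> d (z n y) (z n' y) < e" by blast
    qed
    then show ?thesis using complete unfolding mcomplete_def by blast
  qed
  then obtain l where l: "\<And>y. y \<in> Z \<Longrightarrow> limitin mtopology (\<lambda>n. z n y) (l y) sequentially" by metis
  have lS: "l y \<in> S" if "y \<in> Z" for y using l[OF that] limitin_mspace by blast
  have lz: "d (z n y) (l y) \<le> 4 * r n" if y: "y \<in> Z" for n y
  proof (rule field_le_epsilon)
    fix e :: real assume "e > 0"
    then have "eventually (\<lambda>m. d (z m y) (l y) < e) sequentially"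
      using l[OF y] unfolding limitin_metric by (auto elim: eventually_mono)
    then have "eventually (\<lambda>m. d (z m y) (l y) < e \<and> n \<le> m) sequentially"
      using eventually_ge_at_top by (rule eventually_conj)
    then obtain m where m: "d (z m y) (l y) < e" "n \<le> m"
      using eventually_happens[of _ sequentially] by auto
    have "d (z n y) (l y) \<le> d (z n y) (z m y) + d (z m y) (l y)"
      by (rule triangle[OF zS zS lS[OF y]])
    then show "d (z n y) (l y) \<le> 4 * r n + e" using tele'[OF y m(2)] m(1) by linarith
  qed
  define \<kappa> where "\<kappa> = (\<lambda>y. if y \<in> Z then l y else x0)"
  have \<kappa>\<phi>: "\<kappa> (\<phi> x) = x" if x: "x \<in> space M" for x
  proof -
    have xS: "x \<in> S" using x S by simp
    have "d x (l (\<phi> x)) \<le> e" if e: "e > 0" for e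
    proof -
      obtain n where n: "5 * r n < e" using r_small[of e 5] e by auto
      have "d x (l (\<phi> x)) \<le> d x (z n (\<phi> x)) + d (z n (\<phi> x)) (l (\<phi> x))"
        by (rule triangle[OF xS zS lS[OF \<phi>Z[OF xS]]])
      then show ?thesis using z_near[OF xS, of n] lz[OF \<phi>Z[OF xS], of n] n by linarith
    qed
    then have "d x (l (\<phi> x)) \<le> 0" using dense_ge by blast
    then show ?thesis
      using zero[OF xS lS[OF \<phi>Z[OF xS]]] nonneg[of x "l (\<phi> x)"] \<phi>Z[OF xS] by (simp add: \<kappa>_def)
  qed
  have Z_meas [measurable]: "Z \<in> sets borel"
    unfolding Z_def z_def by measurable
  have \<kappa>_meas: "\<kappa> \<in> measurable borel M"
  proof (rule measurable_sigma_sets[OF sets])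
    show "{U. openin T U} \<subseteq> Pow (space M)" using openin_subset T(3) by blast
    show "\<kappa> \<in> space borel \<rightarrow> space M" using lS x0 S by (auto simp: \<kappa>_def)
    fix U assume "U \<in> {U. openin T U}"
    then have U: "openin mtopology U" by (simp add: T_eq)
    \<comment> \<open>The centre with index \<open>n\<close> is within \<open>4 * r n\<close> of the
      limit, so the ball of radius \<open>5 * r n\<close> about it contains the limit and fits into
      the ball of radius \<open>9 * r n\<close> about the limit. The preimage of \<open>U\<close> is
      thus described by countably many conditions on indices.\<close>
    have iff: "l y \<in> U \<longleftrightarrow> (\<exists>n. mball (q (I n y)) (5 * r n) \<subseteq> U)" if y: "y \<in> Z" for y
    proof
      assume "l y \<in> U"
      then obtain e where e: "e > 0" "mball (l y) e \<subseteq> U"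
        using U unfolding openin_mtopology by blast
      obtain n where n: "9 * r n < e" using r_small[of e 9] e(1) by auto
      have "mball (z n y) (5 * r n) \<subseteq> mball (l y) e"
      proof (rule mball_subset[OF _ lS[OF y]])
        show "d (z n y) (l y) + 5 * r n \<le> e" using lz[OF y, of n] n by linarith
      qed
      then show "\<exists>n. mball (q (I n y)) (5 * r n) \<subseteq> U" using e(2) unfolding z_def by blast
    next
      assume "\<exists>n. mball (q (I n y)) (5 * r n) \<subseteq> U"
      then obtain n where n: "mball (z n y) (5 * r n) \<subseteq> U" by (auto simp: z_def)
      have "l y \<in> mball (z n y) (5 * r n)"
        using zS lS[OF y] lz[OF y, of n] r_pos[of n] by simp
      then show "l y \<in> U" using n by blast
    qed
    have "\<kappa> -` U \<inter> space borel =
        (Z \<inter> (\<Union>n. I n -` {i. mball (q i) (5 * r n) \<subseteq> U} \<inter> space borel)) \<union> (if x0 \<in> U then - Z else {})"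
    proof (rule Set.set_eqI)
      fix y show "y \<in> \<kappa> -` U \<inter> space borel \<longleftrightarrow> y \<in>
          (Z \<inter> (\<Union>n. I n -` {i. mball (q i) (5 * r n) \<subseteq> U} \<inter> space borel)) \<union> (if x0 \<in> U then - Z else {})"
        by (cases "y \<in> Z") (simp_all add: \<kappa>_def iff)
    qed
    also have "\<dots> \<in> sets borel"
    proof -
      have m: "I n -` A \<inter> space borel \<in> sets borel" for n A
        by (rule measurable_sets[OF I_meas]) simp
      have "(\<Union>n. I n -` {i. mball (q i) (5 * r n) \<subseteq> U} \<inter> space borel) \<in> sets borel"
        using m by (intro sets.countable_UN) blast
      moreover have "(if x0 \<in> U then - Z else {}) \<in> sets borel" using Z_meas by simp
      ultimately show ?thesis by (intro sets.Un sets.Int Z_meas)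
    qed
    finally show "\<kappa> -` U \<inter> space borel \<in> sets borel" .
  qed
  show thesis using \<kappa>\<phi> by (intro that[OF \<phi>_meas \<kappa>_meas] ballI)
qed

text \<open>The law of a Borel code of the points has no atoms, so its distribution function is
  continuous and sends it to Lebesgue measure on the unit interval. The quantile function undoes
  this almost everywhere.\<close>

lemma uniform_chart_exists:
  fixes M :: "'a measure"
  assumes "prob_space M" "standard_borel M" "atomless M"
  obtains \<psi> :: "'a \<Rightarrow> real" and \<kappa> :: "real \<Rightarrow> 'a"
  where "\<psi> \<in> borel_measurable M" "\<kappa> \<in> measurable borel M" "AE x in M. \<kappa> (\<psi> x) = x"
    "\<forall>B\<in>sets borel. emeasure M (\<psi> -` B \<inter> space M) = emeasure lborel (B \<inter> {0<..<1})"
proof -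
  interpret prob_space M by fact
  obtain x0 where x0: "x0 \<in> space M" using not_empty by blast
  obtain \<phi> :: "'a \<Rightarrow> real" and \<kappa> :: "real \<Rightarrow> 'a"
    where \<phi>_meas: "\<phi> \<in> borel_measurable M" and \<kappa>_meas: "\<kappa> \<in> measurable borel M"
      and \<kappa>\<phi>: "\<forall>x\<in>space M. \<kappa> (\<phi> x) = x"
    by (rule standard_borel_real_embedding[OF assms(2) x0])
  note \<phi>_meas [measurable] \<kappa>_meas [measurable]
  define N where "N = distr M borel \<phi>"
  have "real_distribution N" unfolding N_def by (rule real_distribution_distr) measurable
  then interpret N: cdf_distribution N by (simp add: cdf_distribution_def)
  let ?\<Omega> = "restrict_space lborel {0<..<1::real}"
  \<comment> \<open>\<kappa> is a left inverse of \<phi>, so a fibre of \<phi> has at most one point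
    and no subset of strictly smaller positive measure.\<close>
  have no_atoms: "measure N {t} = 0" for t
  proof -
    let ?A = "\<phi> -` {t} \<inter> space M"
    have A: "?A \<in> sets M" by measurable
    have sub: "B = {} \<or> B = ?A" if "B \<subseteq> ?A" for B
    proof -
      have "?A \<subseteq> {\<kappa> t}" using \<kappa>\<phi> by auto
      then have "?A = {} \<or> ?A = {\<kappa> t}" by (simp only: subset_singleton_iff)
      then show ?thesis using that by (metis subset_empty subset_singleton_iff)
    qed
    have "emeasure M ?A = 0"
    proof (rule ccontr)
      assume "emeasure M ?A \<noteq> 0"
      then have "0 < emeasure M ?A" using zero_less_iff_neq_zero by blast
      then obtain B where "B \<subseteq> ?A" "0 < emeasure M B" "emeasure M B < emeasure M ?A"
        using assms(3) A unfolding atomless_def by blast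
      then show False using sub[of B] by auto
    qed
    then show ?thesis unfolding N_def measure_def by (simp add: emeasure_distr[OF \<phi>_meas])
  qed
  \<comment> \<open>One inequality is the Galois connection between distribution and quantile
    function. If the other failed, continuity would give a point left of \<open>N.I u\<close> at
    which \<open>N.C\<close> exceeds \<open>u\<close>.\<close>
  have FI: "N.C (N.I u) = u" if u: "0 < u" "u < 1" for u
  proof (rule antisym)
    show "u \<le> N.C (N.I u)" by (rule N.pseudoinverse[OF u, THEN iffD2]) (rule order_refl)
    show "N.C (N.I u) \<le> u"
    proof (rule ccontr)
      assume "\<not> N.C (N.I u) \<le> u"
      then have "u < N.C (N.I u)" by simp
      moreover have "isCont N.C (N.I u)" using no_atoms N.isCont_cdf by blast
      ultimately have "\<forall>\<^sub>F x in at (N.I u). u < N.C x"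
        unfolding isCont_def by (rule order_tendstoD(1)[rotated])
      then have "\<forall>\<^sub>F x in at_left (N.I u). u < N.C x"
        by (rule filter_leD[OF at_le[OF subset_UNIV]])
      moreover have "\<forall>\<^sub>F x in at_left (N.I u). x < N.I u"
        by (simp add: eventually_at_filter)
      ultimately have "\<forall>\<^sub>F x in at_left (N.I u). u < N.C x \<and> x < N.I u"
        by (rule eventually_conj)
      then obtain x where "u < N.C x" "x < N.I u"
        using eventually_happens[of _ "at_left (N.I u)"] trivial_limit_at_left_real by blast
      then show False using N.pseudoinverse[OF u, of x, THEN iffD1, OF less_imp_le] by (meson not_less)
    qed
  qed
  \<comment> \<open>The quantile function matters on the open unit interval; the value 0 elsewhere
    gives a Borel function on the whole line.\<close>
  define J where "J = (\<lambda>u. if u \<in> {0<..<1} then N.I u else 0)"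
  have J_meas [measurable]: "J \<in> borel_measurable borel"
    unfolding J_def using N.measurable_CI
    by (subst measurable_restrict_space_iff[symmetric]) auto
  define \<psi> where "\<psi> = (\<lambda>x. N.C (\<phi> x))"
  have [measurable]: "\<psi> \<in> borel_measurable M"
    unfolding \<psi>_def by measurable
  have I_meas [measurable]: "N.I \<in> measurable ?\<Omega> borel"
    using N.measurable_CI by (simp cong: measurable_cong_sets add: sets_restrict_space)
  have law: "emeasure M (\<psi> -` B \<inter> space M) = emeasure lborel (B \<inter> {0<..<1})"
    if [measurable]: "B \<in> sets borel" for B
  proof -
    have FB [measurable]: "N.C -` B \<in> sets borel"
      using measurable_sets[OF N.measurable_C that] by simp
    have "emeasure M (\<psi> -` B \<inter> space M) = emeasure N (N.C -` B)"
      unfolding N_def by (subst emeasure_distr) (auto simp: \<psi>_def N_def intro!: arg_cong2[where f = emeasure] FB[unfolded N_def])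
    also have "\<dots> = emeasure (distr ?\<Omega> borel N.I) (N.C -` B)"
      by (simp add: N.distr_I_eq_M)
    also have "\<dots> = emeasure ?\<Omega> (N.I -` (N.C -` B) \<inter> space ?\<Omega>)"
      by (rule emeasure_distr) (use I_meas FB in auto)
    also have "N.I -` (N.C -` B) \<inter> space ?\<Omega> = B \<inter> {0<..<1}"
      using FI by (auto simp: space_restrict_space)
    also have "emeasure ?\<Omega> (B \<inter> {0<..<1}) = emeasure lborel (B \<inter> {0<..<1})"
      by (rule emeasure_restrict_space) auto
    finally show ?thesis .
  qed
  have "AE t in distr ?\<Omega> borel N.I. J (N.C t) = t"
  proof (subst AE_distr_iff[OF I_meas])
    show "{x \<in> space borel. J (N.C x) = x} \<in> sets borel" by measurable
    show "AE u in ?\<Omega>. J (N.C (N.I u)) = N.I u"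
      by (rule AE_I2) (simp add: FI J_def space_restrict_space)
  qed
  then have "AE t in N. J (N.C t) = t" unfolding N.distr_I_eq_M .
  then have "AE x in M. J (N.C (\<phi> x)) = \<phi> x"
    unfolding N_def by (rule AE_distrD[rotated]) measurable
  then have "AE x in M. (\<kappa> \<circ> J) (\<psi> x) = x"
    using AE_space by eventually_elim (simp add: \<psi>_def \<kappa>\<phi>)
  moreover have "\<kappa> \<circ> J \<in> measurable borel M" by measurable
  ultimately show thesis using that[of \<psi> "\<kappa> \<circ> J"] law by simp
qed

section \<open>The group of automorphisms\<close>

lemma equiv_ae_rel: "equiv A (ae_rel M A)"
proof (rule equivI)
  show "trans (ae_rel M A)"
  proof (rule transI)
    fix f g h assume "(f, g) \<in> ae_rel M A" "(g, h) \<in> ae_rel M A"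
    then have *: "f \<in> A" "h \<in> A" "AE x in M. f x = g x" "AE x in M. g x = h x" by (auto simp: ae_rel_def)
    from *(3,4) have "AE x in M. f x = h x" by eventually_elim simp
    then show "(f, h) \<in> ae_rel M A" using * by (simp add: ae_rel_def)
  qed
qed (auto simp: ae_rel_def refl_on_def sym_def eq_commute)

lemma ae_rel_class_eq_iff:
  "f \<in> A \<Longrightarrow> g \<in> A \<Longrightarrow> ae_rel M A `` {f} = ae_rel M A `` {g} \<longleftrightarrow> (AE x in M. f x = g x)"
  using eq_equiv_class_iff[OF equiv_ae_rel, of f A g M] by (simp add: ae_rel_def)

lemma ae_rel_class_mem: "g \<in> ae_rel M A `` {f} \<longleftrightarrow> f \<in> A \<and> g \<in> A \<and> (AE x in M. f x = g x)"
  by (simp add: ae_rel_def)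

lemma ae_rel_SOME:
  assumes "\<xi> \<in> A // ae_rel M A"
  shows "(SOME f. f \<in> \<xi>) \<in> A" "ae_rel M A `` {SOME f. f \<in> \<xi>} = \<xi>"
proof -
  obtain f where f: "f \<in> A" "\<xi> = ae_rel M A `` {f}" using assms by (rule quotientE)
  have "f \<in> \<xi>" using f equiv_class_self[OF equiv_ae_rel] by blast
  moreover define g where "g = (SOME f. f \<in> \<xi>)"
  ultimately have "g \<in> \<xi>" by (metis someI)
  then have fg: "(f, g) \<in> ae_rel M A" using f(2) by simp
  then show "(SOME f. f \<in> \<xi>) \<in> A" unfolding g_def[symmetric] by (simp add: ae_rel_def)
  show "ae_rel M A `` {SOME f. f \<in> \<xi>} = \<xi>"
    unfolding g_def[symmetric] using equiv_class_eq[OF equiv_ae_rel fg] f(2) by (simp only:)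
qed

section \<open>Classes of transformations and their representatives\<close>

context prob_space
begin

abbreviation "tr \<equiv> transformations M"

definition cls :: "('a \<Rightarrow> 'a) \<Rightarrow> ('a \<Rightarrow> 'a) set" where
  "cls t = ae_rel M tr `` {t}"

text \<open>An arbitrary representative; the choice is compatible with products and inverses almost
  everywhere.\<close>

definition rep :: "('a \<Rightarrow> 'a) set \<Rightarrow> 'a \<Rightarrow> 'a" where
  "rep g = (SOME t. t \<in> g)"

lemma trD:
  assumes "t \<in> tr"
  shows "bij_betw t (space M) (space M)" "t \<in> measurable M M"
    "inv_into (space M) t \<in> measurable M M" "distr M M t = M"
  using assms unfolding transformations_def by blast+

lemma tr_inv_left: "t \<in> tr \<Longrightarrow> x \<in> space M \<Longrightarrow> inv_into (space M) t (t x) = x"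
  by (rule bij_betw_inv_into_left[OF trD(1)])

lemma tr_inv_right: "t \<in> tr \<Longrightarrow> x \<in> space M \<Longrightarrow> t (inv_into (space M) t x) = x"
  by (rule bij_betw_inv_into_right[OF trD(1)])

lemma AE_measure_preserving:
  assumes "t \<in> measurable M M" "distr M M t = M" "AE x in M. P x"
  shows "AE x in M. P (t x)"
  by (rule AE_distrD[OF assms(1)]) (simp only: assms(2,3))

lemma tr_AE: "t \<in> tr \<Longrightarrow> AE x in M. P x \<Longrightarrow> AE x in M. P (t x)"
  by (rule AE_measure_preserving[OF trD(2) trD(4)])

lemma tr_id: "id \<in> tr"
proof -
  have "inv_into (space M) id \<in> measurable M M"
    by (rule measurable_cong[THEN iffD2, of _ _ "\<lambda>x. x"]) (auto intro!: inv_into_f_eq)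
  moreover have "distr M M id = M" using distr_id[of M] by (simp add: id_def)
  ultimately show ?thesis by (simp add: transformations_def)
qed

lemma tr_comp:
  assumes s: "s \<in> tr" and t: "t \<in> tr"
  shows "s \<circ> t \<in> tr"
proof -
  have b: "bij_betw (s \<circ> t) (space M) (space M)"
    by (rule bij_betw_trans[OF trD(1)[OF t] trD(1)[OF s]])
  have "inv_into (space M) (s \<circ> t) x = inv_into (space M) t (inv_into (space M) s x)" if "x \<in> space M" for x
  proof (rule inv_into_f_eq)
    show "inj_on (s \<circ> t) (space M)" using b by (rule bij_betw_imp_inj_on)
    have 1: "inv_into (space M) s x \<in> space M" by (rule measurable_space[OF trD(3)[OF s] that])
    show "inv_into (space M) t (inv_into (space M) s x) \<in> space M" by (rule measurable_space[OF trD(3)[OF t] 1])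
    show "(s \<circ> t) (inv_into (space M) t (inv_into (space M) s x)) = x"
      by (simp add: tr_inv_right[OF t 1] tr_inv_right[OF s that])
  qed
  then have "inv_into (space M) (s \<circ> t) \<in> measurable M M \<longleftrightarrow>
      (\<lambda>x. inv_into (space M) t (inv_into (space M) s x)) \<in> measurable M M"
    by (rule measurable_cong)
  moreover have "(\<lambda>x. inv_into (space M) t (inv_into (space M) s x)) \<in> measurable M M"
    by (rule measurable_compose[OF trD(3)[OF s] trD(3)[OF t]])
  moreover have "distr M M (s \<circ> t) = M"
    unfolding distr_distr[OF trD(2)[OF s] trD(2)[OF t], symmetric] trD(4)[OF t] by (rule trD(4)[OF s])
  moreover have "s \<circ> t \<in> measurable M M" by (rule measurable_comp[OF trD(2)[OF t] trD(2)[OF s]])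
  ultimately show ?thesis using b by (simp add: transformations_def)
qed

lemma tr_inv:
  assumes t: "t \<in> tr"
  shows "inv_into (space M) t \<in> tr"
proof -
  let ?u = "inv_into (space M) t"
  have "inv_into (space M) ?u \<in> measurable M M"
    by (rule measurable_cong[THEN iffD2, OF _ trD(2)[OF t]])
      (rule inv_into_inv_into_eq[OF trD(1)[OF t]])
  moreover have "distr M M ?u = M"
  proof -
    have "distr (distr M M t) M ?u = distr M M (?u \<circ> t)"
      by (rule distr_distr[OF trD(3)[OF t] trD(2)[OF t]])
    also have "\<dots> = distr M M (\<lambda>x. x)"
      by (rule distr_cong) (use tr_inv_left t in auto)
    finally show ?thesis using trD(4)[OF t] by simp
  qed
  ultimately show ?thesis
    using bij_betw_inv_into[OF trD(1)[OF t]] trD(3)[OF t] by (simp add: transformations_def)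
qed

lemma cls_eq_iff: "s \<in> tr \<Longrightarrow> t \<in> tr \<Longrightarrow> cls s = cls t \<longleftrightarrow> (AE x in M. s x = t x)"
  unfolding cls_def by (rule ae_rel_class_eq_iff)

lemma cls_carrier: "t \<in> tr \<Longrightarrow> cls t \<in> carrier (Aut M)"
  by (simp add: Aut_def cls_def quotientI)

lemma rep_tr: "g \<in> carrier (Aut M) \<Longrightarrow> rep g \<in> tr"
  and cls_rep: "g \<in> carrier (Aut M) \<Longrightarrow> cls (rep g) = g"
  using ae_rel_SOME[of g tr M] by (auto simp: Aut_def rep_def cls_def)

lemma rep_cls: "t \<in> tr \<Longrightarrow> AE x in M. rep (cls t) x = t x"
  by (rule cls_eq_iff[THEN iffD1]) (simp_all add: rep_tr cls_rep cls_carrier)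

lemma cls_mult:
  assumes s: "s \<in> tr" and t: "t \<in> tr"
  shows "cls s \<otimes>\<^bsub>Aut M\<^esub> cls t = cls (s \<circ> t)"
proof -
  have "cls (s' \<circ> t') = cls (s \<circ> t)" if "s' \<in> cls s" "t' \<in> cls t" for s' t'
  proof -
    have s': "s' \<in> tr" "AE x in M. s x = s' x" and t': "t' \<in> tr" "AE x in M. t x = t' x"
      using that unfolding cls_def ae_rel_class_mem by blast+
    have "AE x in M. s (t x) = s' (t x)" using tr_AE[OF t s'(2)] .
    with t'(2) have "AE x in M. (s' \<circ> t') x = (s \<circ> t) x" by eventually_elim simp
    then show ?thesis
      by (rule cls_eq_iff[THEN iffD2, OF tr_comp[OF s'(1) t'(1)] tr_comp[OF s t]])
  qed
  moreover have "s \<in> cls s" "t \<in> cls t"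
    unfolding cls_def ae_rel_class_mem using s t by simp_all
  ultimately have "(\<Union>s'\<in>cls s. \<Union>t'\<in>cls t. cls (s' \<circ> t')) = cls (s \<circ> t)" by blast
  then show ?thesis by (simp add: Aut_def cls_def)
qed

lemma one_Aut: "\<one>\<^bsub>Aut M\<^esub> = cls id"
  by (simp add: Aut_def cls_def)

lemma Aut_cases:
  assumes "g \<in> carrier (Aut M)" obtains t where "t \<in> tr" "g = cls t"
  by (rule that[OF rep_tr[OF assms] cls_rep[OF assms, symmetric]])

lemma group_Aut: "group (Aut M)"
proof (rule groupI)
  show "x \<otimes>\<^bsub>Aut M\<^esub> y \<in> carrier (Aut M)" if "x \<in> carrier (Aut M)" "y \<in> carrier (Aut M)" for x y
    using that by (auto elim!: Aut_cases simp: cls_mult intro!: cls_carrier tr_comp)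
  show "\<one>\<^bsub>Aut M\<^esub> \<in> carrier (Aut M)" by (simp add: one_Aut cls_carrier tr_id)
  show "x \<otimes>\<^bsub>Aut M\<^esub> y \<otimes>\<^bsub>Aut M\<^esub> z = x \<otimes>\<^bsub>Aut M\<^esub> (y \<otimes>\<^bsub>Aut M\<^esub> z)"
    if "x \<in> carrier (Aut M)" "y \<in> carrier (Aut M)" "z \<in> carrier (Aut M)" for x y z
    using that by (auto elim!: Aut_cases simp: cls_mult tr_comp comp_assoc)
  show "\<one>\<^bsub>Aut M\<^esub> \<otimes>\<^bsub>Aut M\<^esub> x = x" if "x \<in> carrier (Aut M)" for x
    using that by (auto elim!: Aut_cases simp: cls_mult one_Aut tr_id)
  show "\<exists>y\<in>carrier (Aut M). y \<otimes>\<^bsub>Aut M\<^esub> x = \<one>\<^bsub>Aut M\<^esub>" if x: "x \<in> carrier (Aut M)" for x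
  proof -
    obtain t where t: "t \<in> tr" "x = cls t" using x by (rule Aut_cases)
    have "AE x in M. (inv_into (space M) t \<circ> t) x = id x"
      using tr_inv_left[OF t(1)] by (intro AE_I2) simp
    then have "cls (inv_into (space M) t) \<otimes>\<^bsub>Aut M\<^esub> x = \<one>\<^bsub>Aut M\<^esub>"
      using t by (simp add: cls_mult tr_inv one_Aut cls_eq_iff tr_comp tr_id)
    then show ?thesis using cls_carrier[OF tr_inv[OF t(1)]] by blast
  qed
qed

lemma inv_cls: "t \<in> tr \<Longrightarrow> inv\<^bsub>Aut M\<^esub> (cls t) = cls (inv_into (space M) t)"
proof (rule group.inv_equality[OF group_Aut])
  assume t: "t \<in> tr"
  have "AE x in M. (inv_into (space M) t \<circ> t) x = id x"
    using tr_inv_left[OF t(1)] by (intro AE_I2) simp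
  then show "cls (inv_into (space M) t) \<otimes>\<^bsub>Aut M\<^esub> cls t = \<one>\<^bsub>Aut M\<^esub>"
    using t by (simp add: cls_mult tr_inv one_Aut cls_eq_iff tr_comp tr_id)
qed (auto intro: cls_carrier tr_inv)

lemma rep_mult:
  assumes "g \<in> carrier (Aut M)" "h \<in> carrier (Aut M)"
  shows "AE x in M. rep (g \<otimes>\<^bsub>Aut M\<^esub> h) x = rep g (rep h x)"
proof -
  have "g \<otimes>\<^bsub>Aut M\<^esub> h = cls (rep g \<circ> rep h)"
    using cls_mult[OF rep_tr[OF assms(1)] rep_tr[OF assms(2)]] cls_rep assms by simp
  then show ?thesis using rep_cls[OF tr_comp[OF rep_tr[OF assms(1)] rep_tr[OF assms(2)]]] by simp
qed

lemma rep_one: "AE x in M. rep \<one>\<^bsub>Aut M\<^esub> x = x"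
  using rep_cls[OF tr_id] by (simp add: one_Aut)

lemma rep_inv:
  assumes "g \<in> carrier (Aut M)"
  shows "AE x in M. rep (inv\<^bsub>Aut M\<^esub> g) x = inv_into (space M) (rep g) x"
  using rep_cls[OF tr_inv[OF rep_tr[OF assms]]] inv_cls[OF rep_tr[OF assms]] cls_rep[OF assms] by simp

lemma rep_inv_right:
  assumes g: "g \<in> carrier (Aut M)"
  shows "AE x in M. rep g (rep (inv\<^bsub>Aut M\<^esub> g) x) = x"
  using rep_inv[OF g] AE_space by eventually_elim (simp add: tr_inv_right[OF rep_tr[OF g]])

text \<open>\<open>T\<close> becomes a bijection of the whole space when it is replaced by the identity off the conull
  set of points whose images under all words in \<open>S\<close> and \<open>T\<close> avoid the exceptional null set.\<close>

lemma automorphism_of_ae_inverse: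
  assumes S [measurable]: "S \<in> measurable M M" and T [measurable]: "T \<in> measurable M M"
    and dS: "distr M M S = M" and dT: "distr M M T = M"
    and ST: "AE x in M. S (T x) = x" and TS: "AE x in M. T (S x) = x"
  obtains t where "t \<in> tr" "AE x in M. t x = T x"
proof -
  have "AE x in M. S (T x) = x \<and> T (S x) = x" using ST TS by eventually_elim simp
  then obtain N where N: "{x \<in> space M. \<not> (S (T x) = x \<and> T (S x) = x)} \<subseteq> N" "emeasure M N = 0" "N \<in> sets M"
    by (rule AE_E)
  \<comment> \<open>\<open>True\<close> stands for \<open>S\<close>, \<open>False\<close> for
    \<open>T\<close>, and the head of the list acts first, so that prepending a letter amounts to
    applying it to the point.\<close>
  define w where "w = (\<lambda>bs x. fold (\<lambda>b y. if b then S y else T y) bs x)"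
  have w_Cons: "w (b # bs) x = w bs (if b then S x else T x)" for b bs x by (simp add: w_def)
  have w: "w bs \<in> measurable M M \<and> distr M M (w bs) = M" for bs
  proof (induction bs)
    case Nil
    have "w [] = (\<lambda>x. x)" by (auto simp: w_def)
    then show ?case by simp
  next
    case (Cons b bs)
    have wc: "w (b # bs) = w bs \<circ> (if b then S else T)" by (auto simp: w_Cons)
    have f: "(if b then S else T) \<in> measurable M M" "distr M M (if b then S else T) = M"
      using S T dS dT by (cases b; simp)+
    have ws: "w bs \<in> measurable M M" "distr M M (w bs) = M" using Cons by blast+
    show ?case
      unfolding wc using measurable_comp[OF f(1) ws(1)]
      by (simp only: distr_distr[OF ws(1) f(1), symmetric] f(2) ws(2) simp_thms)
  qed
  have [measurable]: "w bs \<in> measurable M M" for bs using w by blast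
  \<comment> \<open>There are countably many words, each measure preserving, so \<open>E\<close> is
    conull; both \<open>S\<close> and \<open>T\<close> map it into itself.\<close>
  define E where "E = {x \<in> space M. \<forall>bs. w bs x \<notin> N}"
  have [measurable]: "E \<in> sets M"
    unfolding E_def using N(3) by measurable
  have notN: "AE x in M. x \<notin> N" using N(2,3) by (intro AE_not_in) (auto simp: null_sets_def)
  have "AE x in M. w bs x \<notin> N" for bs
    by (rule AE_measure_preserving[OF conjunct1[OF w] conjunct2[OF w] notN])
  then have "AE x in M. \<forall>bs. w bs x \<notin> N"
    unfolding AE_all_countable by (rule allI)
  then have AE_E: "AE x in M. x \<in> E" using AE_space by eventually_elim (simp add: E_def)
  have SE: "S x \<in> E" if "x \<in> E" for x
  proof -
    have "w bs (S x) \<notin> N" for bs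
    proof -
      have "w (True # bs) x \<notin> N" using that unfolding E_def by blast
      then show ?thesis by (simp add: w_Cons)
    qed
    then show ?thesis using that measurable_space[OF S] unfolding E_def by blast
  qed
  have TE: "T x \<in> E" if "x \<in> E" for x
  proof -
    have "w bs (T x) \<notin> N" for bs
    proof -
      have "w (False # bs) x \<notin> N" using that unfolding E_def by blast
      then show ?thesis by (simp add: w_Cons)
    qed
    then show ?thesis using that measurable_space[OF T] unfolding E_def by blast
  qed
  have inv: "S (T x) = x" "T (S x) = x" if "x \<in> E" for x
  proof -
    have "w [] x \<notin> N" "x \<in> space M" using that unfolding E_def by blast+
    then have "x \<notin> N" "x \<in> space M" by (auto simp: w_def)
    then show "S (T x) = x" "T (S x) = x" using N(1) by auto
  qed
  define t where "t = (\<lambda>x. if x \<in> E then T x else x)"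
  define s where "s = (\<lambda>x. if x \<in> E then S x else x)"
  have t_meas: "t \<in> measurable M M" unfolding t_def by measurable
  have s_meas: "s \<in> measurable M M" unfolding s_def by measurable
  have st: "s (t x) = x" "t (s x) = x" for x using SE TE inv by (auto simp: s_def t_def)
  have bij: "bij_betw t (space M) (space M)"
    by (rule bij_betw_byWitness[where f' = s])
      (use st measurable_space[OF t_meas] measurable_space[OF s_meas] in auto)
  have "inv_into (space M) t x = s x" if "x \<in> space M" for x
    using bij_betw_imp_inj_on[OF bij] measurable_space[OF s_meas that] st by (intro inv_into_f_eq) auto
  then have "inv_into (space M) t \<in> measurable M M"
    using s_meas by (simp cong: measurable_cong)
  moreover have AE_t: "AE x in M. t x = T x"
    using AE_E by eventually_elim (simp add: t_def)
  moreover have "distr M M t = M"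
    unfolding distr_cong_AE[OF refl refl AE_t t_meas T] by (rule dT)
  ultimately have "t \<in> tr"
    using bij t_meas unfolding transformations_def by blast
  then show thesis using AE_t by (rule that)
qed

section \<open>Dyadic sets and matching automorphisms\<close>

text \<open>The distance of the measure algebra: a pseudometric on the events that vanishes exactly
  when they agree almost everywhere.\<close>

definition dm :: "'a set \<Rightarrow> 'a set \<Rightarrow> real" where
  "dm A B = prob ((A - B) \<union> (B - A))"

lemma dm_commute: "dm A B = dm B A" by (simp add: dm_def Un_commute)

lemma dm_self [simp]: "dm A A = 0" by (simp add: dm_def)

lemma dm_le:
  assumes "A \<in> events" "B \<in> events" "C \<in> events" "(A - B) \<union> (B - A) \<subseteq> C"
  shows "dm A B \<le> prob C"
  unfolding dm_def using assms by (intro finite_measure_mono) auto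

lemma dm_triangle:
  assumes "A \<in> events" "B \<in> events" "C \<in> events"
  shows "dm A C \<le> dm A B + dm B C"
proof -
  have "dm A C \<le> prob (((A - B) \<union> (B - A)) \<union> ((B - C) \<union> (C - B)))"
    using assms by (intro dm_le) auto
  also have "\<dots> \<le> dm A B + dm B C"
    unfolding dm_def using assms by (intro measure_Un_le) auto
  finally show ?thesis .
qed

lemma dm_prob_diff:
  assumes "A \<in> events" "B \<in> events"
  shows "\<bar>prob A - prob B\<bar> \<le> dm A B"
proof -
  have "prob A \<le> prob (B \<union> ((A - B) \<union> (B - A)))" "prob B \<le> prob (A \<union> ((A - B) \<union> (B - A)))"
    using assms by (intro finite_measure_mono; auto)+
  moreover have "prob (B \<union> ((A - B) \<union> (B - A))) \<le> prob B + dm A B"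
    "prob (A \<union> ((A - B) \<union> (B - A))) \<le> prob A + dm A B"
    unfolding dm_def using assms by (intro measure_Un_le; auto)+
  ultimately show ?thesis by linarith
qed

lemma dm_Un:
  assumes "A \<in> events" "B \<in> events" "C \<in> events" "D \<in> events"
  shows "dm (A \<union> B) (C \<union> D) \<le> dm A C + dm B D"
proof -
  have "dm (A \<union> B) (C \<union> D) \<le> prob (((A - C) \<union> (C - A)) \<union> ((B - D) \<union> (D - B)))"
    using assms by (intro dm_le) auto
  also have "\<dots> \<le> dm A C + dm B D"
    unfolding dm_def using assms by (intro measure_Un_le) auto
  finally show ?thesis .
qed

lemma dm_UN:
  assumes "finite K" "\<And>k. k \<in> K \<Longrightarrow> A k \<in> events" "\<And>k. k \<in> K \<Longrightarrow> B k \<in> events"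
  shows "dm (\<Union>k\<in>K. A k) (\<Union>k\<in>K. B k) \<le> (\<Sum>k\<in>K. dm (A k) (B k))"
  using assms
proof (induction K rule: finite_induct)
  case (insert k K)
  have "dm (\<Union>k\<in>insert k K. A k) (\<Union>k\<in>insert k K. B k) \<le> dm (A k) (B k) + dm (\<Union>k\<in>K. A k) (\<Union>k\<in>K. B k)"
    unfolding UN_insert using insert.hyps(1) insert.prems by (intro dm_Un sets.finite_UN) auto
  also have "\<dots> \<le> dm (A k) (B k) + (\<Sum>k\<in>K. dm (A k) (B k))"
    using insert.IH insert.prems by simp
  finally show ?case using insert.hyps by simp
qed simp

lemma dm_compl:
  assumes "A \<in> events" "B \<in> events"
  shows "dm (space M - A) (space M - B) = dm A B"
proof -
  have "A \<subseteq> space M" "B \<subseteq> space M" using assms sets.sets_into_space by auto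
  then have "(space M - A - (space M - B)) \<union> (space M - B - (space M - A)) = (A - B) \<union> (B - A)" by blast
  then show ?thesis by (simp add: dm_def)
qed

lemma dm_AE:
  assumes "A \<in> events" "B \<in> events" "AE x in M. x \<in> A \<longleftrightarrow> x \<in> B"
  shows "dm A B = 0"
proof -
  have "prob ((A - B) \<union> (B - A)) = prob {}"
    using assms(3) by (intro measure_eq_AE) (use assms in auto)
  then show ?thesis by (simp add: dm_def)
qed

lemma dm_cong_AE:
  assumes "A \<in> events" "B \<in> events" "A' \<in> events" "B' \<in> events"
    "AE x in M. x \<in> A \<longleftrightarrow> x \<in> A'" "AE x in M. x \<in> B \<longleftrightarrow> x \<in> B'"
  shows "dm A B = dm A' B'"
  unfolding dm_def
proof (rule measure_eq_AE)
  show "AE x in M. x \<in> A - B \<union> (B - A) \<longleftrightarrow> x \<in> A' - B' \<union> (B' - A')"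
    using assms(5,6) by eventually_elim auto
qed (use assms in auto)

abbreviation pre :: "('a \<Rightarrow> 'a) \<Rightarrow> 'a set \<Rightarrow> 'a set" where
  "pre t A \<equiv> t -` A \<inter> space M"

lemma pre_events: "t \<in> measurable M M \<Longrightarrow> A \<in> events \<Longrightarrow> pre t A \<in> events"
  by (rule measurable_sets)

lemma prob_pre:
  assumes "t \<in> measurable M M" "distr M M t = M" "A \<in> events"
  shows "prob (pre t A) = prob A"
  using measure_distr[OF assms(1,3)] assms(2) by simp

lemma dm_pre:
  assumes "t \<in> measurable M M" "distr M M t = M" "A \<in> events" "B \<in> events"
  shows "dm (pre t A) (pre t B) = dm A B"
proof -
  have "(pre t A - pre t B) \<union> (pre t B - pre t A) = pre t ((A - B) \<union> (B - A))" by blast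
  then show ?thesis
    unfolding dm_def using prob_pre[OF assms(1,2), of "(A - B) \<union> (B - A)"] assms by simp
qed

end

section \<open>Approximation of events by unions of dyadic cells\<close>

locale uniform_chart = prob_space M for M :: "'a measure" +
  fixes \<psi> :: "'a \<Rightarrow> real" and \<kappa> :: "real \<Rightarrow> 'a"
  assumes \<psi>_measurable [measurable]: "\<psi> \<in> borel_measurable M"
    and \<kappa>_measurable [measurable]: "\<kappa> \<in> measurable borel M"
    and \<kappa>_\<psi>: "AE x in M. \<kappa> (\<psi> x) = x"
    and \<psi>_law: "B \<in> sets borel \<Longrightarrow> emeasure M (\<psi> -` B \<inter> space M) = emeasure lborel (B \<inter> {0<..<1})"
begin

definition rdigit :: "nat \<Rightarrow> real \<Rightarrow> nat" where
  "rdigit n y = nat \<lfloor>2 ^ n * y\<rfloor>"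

definition digit :: "nat \<Rightarrow> 'a \<Rightarrow> nat" where
  "digit n x = rdigit n (\<psi> x)"

definition dyadic :: "nat \<Rightarrow> nat set \<Rightarrow> 'a set" where
  "dyadic n S = {x \<in> space M. digit n x \<in> S}"

lemma rdigit_measurable [measurable]: "rdigit n \<in> measurable borel (count_space UNIV)"
  unfolding rdigit_def by measurable

lemma digit_measurable [measurable]: "digit n \<in> measurable M (count_space UNIV)"
  unfolding digit_def by measurable

lemma dyadic_events [measurable, simp]: "dyadic n S \<in> events"
proof -
  have "dyadic n S = digit n -` S \<inter> space M" by (auto simp: dyadic_def)
  then show ?thesis using measurable_sets[OF digit_measurable, of S n] by simp
qed

lemma AE_\<psi>: "AE x in M. 0 < \<psi> x \<and> \<psi> x < 1"
proof (rule AE_I')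
  have "emeasure M (\<psi> -` (- {0<..<1}) \<inter> space M) = 0"
    by (subst \<psi>_law) auto
  then show "\<psi> -` (- {0<..<1}) \<inter> space M \<in> null_sets M"
    by (auto simp: null_sets_def)
qed auto

lemma rdigit_eq_iff:
  assumes "0 \<le> y"
  shows "rdigit n y = k \<longleftrightarrow> real k / 2 ^ n \<le> y \<and> y < (real k + 1) / 2 ^ n"
proof -
  have "rdigit n y = k \<longleftrightarrow> \<lfloor>2 ^ n * y\<rfloor> = int k"
    using assms unfolding rdigit_def by auto
  also have "\<dots> \<longleftrightarrow> k \<le> 2 ^ n * y \<and> 2 ^ n * y < k + 1"
    by (simp add: floor_eq_iff add.commute)
  also have "\<dots> \<longleftrightarrow> real k / 2 ^ n \<le> y \<and> y < (real k + 1) / 2 ^ n"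
    by (simp add: field_simps)
  finally show ?thesis .
qed

lemma rdigit_less: "0 \<le> y \<Longrightarrow> y < 1 \<Longrightarrow> rdigit n y < 2 ^ n"
proof -
  assume y: "0 \<le> y" "y < 1"
  have "\<lfloor>2 ^ n * y\<rfloor> < 2 ^ n" using y by (simp add: floor_less_iff)
  then show ?thesis unfolding rdigit_def using y by (simp add: nat_less_iff)
qed

lemma AE_digit: "AE x in M. digit n x < 2 ^ n"
  using AE_\<psi> by eventually_elim (simp add: digit_def rdigit_less)

lemma rdigit_div: "rdigit (n + m) y div 2 ^ m = rdigit n y"
proof -
  have "\<lfloor>2 ^ n * y\<rfloor> = \<lfloor>2 ^ (n + m) * y\<rfloor> div 2 ^ m"
    using floor_divide_real_eq_div[of "2 ^ m" "2 ^ (n + m) * y"]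
    by (simp add: power_add)
  then show ?thesis unfolding rdigit_def
    by (metis nat_div_distrib' nat_numeral nat_power_eq zero_le_numeral zero_le_power)
qed

lemma dyadic_refine: "dyadic n S = dyadic (n + m) {j. j div 2 ^ m \<in> S}"
  by (simp add: dyadic_def digit_def rdigit_div)

lemma emeasure_dyadic_cell:
  assumes "k < 2 ^ n"
  shows "emeasure lborel ({real k / 2 ^ n..<(real k + 1) / 2 ^ n} \<inter> {0<..<1}) = ennreal (1 / 2 ^ n)"
proof -
  have 1: "(real k + 1) / 2 ^ n \<le> (1::real)"
  proof -
    have "real k + 1 \<le> 2 ^ n"
      using assms by (metis Suc_leI add.commute of_nat_Suc of_nat_le_iff of_nat_numeral of_nat_power)
    then show ?thesis by simp
  qed
  have "{a..<b} \<inter> {0<..<1} = {a..<b} - {0}" if "0 \<le> a" "b \<le> 1" for a b :: real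
    using that by auto
  from this[OF _ 1]
  have "{real k / 2 ^ n..<(real k + 1) / 2 ^ n} \<inter> {0<..<1::real} = {real k / 2 ^ n..<(real k + 1) / 2 ^ n} - {0}"
    by simp
  moreover have "emeasure lborel ({real k / 2 ^ n..<(real k + 1) / 2 ^ n} - {0::real}) = emeasure lborel {real k / 2 ^ n..<(real k + 1) / 2 ^ n}"
    by (rule emeasure_Diff_null_set) auto
  moreover have "emeasure lborel {real k / 2 ^ n..<(real k + 1) / 2 ^ n} = ennreal (1 / 2 ^ n)"
    by (simp add: divide_right_mono diff_divide_distrib[symmetric])
  ultimately show ?thesis by simp
qed

lemma prob_dyadic_single: "k < 2 ^ n \<Longrightarrow> prob (dyadic n {k}) = 1 / 2 ^ n"
proof -
  assume k: "k < 2 ^ n"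
  have "emeasure M (dyadic n {k}) = emeasure M (\<psi> -` {real k / 2 ^ n..<(real k + 1) / 2 ^ n} \<inter> space M)"
  proof (rule emeasure_eq_AE)
    show "AE x in M. x \<in> dyadic n {k} \<longleftrightarrow> x \<in> \<psi> -` {real k / 2 ^ n..<(real k + 1) / 2 ^ n} \<inter> space M"
      using AE_\<psi> AE_space by eventually_elim (auto simp: dyadic_def digit_def rdigit_eq_iff)
  qed auto
  also have "\<dots> = ennreal (1 / 2 ^ n)"
    by (subst \<psi>_law) (simp_all only: emeasure_dyadic_cell[OF k] sets.sets_into_space, auto)
  finally show ?thesis by (simp add: measure_def)
qed

lemma prob_dyadic: "S \<subseteq> {..<2 ^ n} \<Longrightarrow> prob (dyadic n S) = card S / 2 ^ n"
proof -
  assume S: "S \<subseteq> {..<2 ^ n}"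
  then have fin: "finite S" by (rule finite_subset) simp
  have "dyadic n S = (\<Union>k\<in>S. dyadic n {k})" by (auto simp: dyadic_def)
  then have "prob (dyadic n S) = (\<Sum>k\<in>S. prob (dyadic n {k}))"
    using fin by (simp only:) (intro finite_measure_finite_Union, auto simp: disjoint_family_on_def dyadic_def)
  also have "\<dots> = (\<Sum>k\<in>S. 1 / 2 ^ n)"
    using S by (intro sum.cong) (auto simp: prob_dyadic_single)
  finally show ?thesis by simp
qed

lemma dyadic_restrict: "AE x in M. x \<in> dyadic n S \<longleftrightarrow> x \<in> dyadic n (S \<inter> {..<2 ^ n})"
  using AE_digit[of n] by eventually_elim (auto simp: dyadic_def)

text \<open>All large levels are demanded, not only one, so that finitely many sets can be
  approximated at a common level.\<close>

definition approximable :: "'a set \<Rightarrow> bool" where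
  "approximable A \<longleftrightarrow> (\<forall>e>0. \<exists>n0. \<forall>n\<ge>n0. \<exists>S. dm A (dyadic n S) < e)"

lemma approximableI:
  assumes "\<And>e. e > 0 \<Longrightarrow> \<exists>n S. dm A (dyadic n S) < e"
  shows "approximable A"
  unfolding approximable_def
proof (intro allI impI)
  fix e :: real assume "e > 0"
  then obtain n S where "dm A (dyadic n S) < e" using assms by blast
  then have "\<exists>S. dm A (dyadic m S) < e" if "m \<ge> n" for m
    using dyadic_refine[of n S "m - n"] that by auto
  then show "\<exists>n0. \<forall>n\<ge>n0. \<exists>S. dm A (dyadic n S) < e" by blast
qed

lemma approximable_compl:
  assumes "approximable A" "A \<in> events"
  shows "approximable (space M - A)"
proof (rule approximableI)
  fix e :: real assume "e > 0"
  then obtain n S where "dm A (dyadic n S) < e"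
    using assms(1) unfolding approximable_def by blast
  moreover have "space M - dyadic n S = dyadic n (- S)" by (auto simp: dyadic_def)
  ultimately have "dm (space M - A) (dyadic n (- S)) < e"
    using dm_compl[OF assms(2) dyadic_events[of n S]] by simp
  then show "\<exists>n S. dm (space M - A) (dyadic n S) < e" by blast
qed

lemma approximable_Un:
  assumes "approximable A" "A \<in> events" "approximable B" "B \<in> events"
  shows "approximable (A \<union> B)"
proof (rule approximableI)
  fix e :: real assume "e > 0"
  then have e: "e / 2 > 0" by simp
  obtain n1 n2 where n: "\<And>n. n \<ge> n1 \<Longrightarrow> \<exists>S. dm A (dyadic n S) < e / 2"
    "\<And>n. n \<ge> n2 \<Longrightarrow> \<exists>S. dm B (dyadic n S) < e / 2"
    using assms(1,3) e unfolding approximable_def by meson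
  obtain S1 S2 where S: "dm A (dyadic (max n1 n2) S1) < e / 2" "dm B (dyadic (max n1 n2) S2) < e / 2"
    using n(1)[of "max n1 n2"] n(2)[of "max n1 n2"] by auto
  have "dyadic (max n1 n2) S1 \<union> dyadic (max n1 n2) S2 = dyadic (max n1 n2) (S1 \<union> S2)"
    by (auto simp: dyadic_def)
  then have "dm (A \<union> B) (dyadic (max n1 n2) (S1 \<union> S2)) < e"
    using dm_Un[OF assms(2,4) dyadic_events[of "max n1 n2" S1] dyadic_events[of "max n1 n2" S2]] S by simp
  then show "\<exists>n S. dm (A \<union> B) (dyadic n S) < e" by blast
qed

lemma approximable_empty: "approximable {}"
proof (rule approximableI)
  fix e :: real assume "e > 0"
  moreover have "dyadic 0 {} = {}" by (simp add: dyadic_def)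
  ultimately show "\<exists>n S. dm {} (dyadic n S) < e" by (metis dm_self)
qed

text \<open>At level \<open>n\<close> only the cell with index \<open>rdigit n a\<close> can be cut
  by the endpoint, and its measure is at most \<open>1 / 2 ^ n\<close>.\<close>

lemma approximable_halfline: "approximable (\<psi> -` {..<a} \<inter> space M)"
proof (rule approximableI)
  fix e :: real assume "e > 0"
  then obtain n where n: "(1/2) ^ n < e" using real_arch_pow_inv[of e "1/2"] by auto
  define S where "S = {k. (real k + 1) / 2 ^ n \<le> a}"
  have E: "\<psi> -` {..<a} \<inter> space M \<in> events" by measurable
  define A' where "A' = dyadic n S \<union> ((\<psi> -` {..<a} \<inter> space M) \<inter> dyadic n {rdigit n a})"
  have A': "A' \<in> events" using E by (simp add: A'_def)
  have "AE x in M. x \<in> \<psi> -` {..<a} \<inter> space M \<longleftrightarrow> x \<in> A'"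
    using AE_\<psi> AE_space
  proof eventually_elim
    case (elim x)
    have d: "real (digit n x) / 2 ^ n \<le> \<psi> x" "\<psi> x < (real (digit n x) + 1) / 2 ^ n"
      using rdigit_eq_iff[of "\<psi> x" n "digit n x"] elim by (auto simp: digit_def)
    have "digit n x = rdigit n a" if "\<psi> x < a" "\<not> (real (digit n x) + 1) / 2 ^ n \<le> a"
      using rdigit_eq_iff[of a n "digit n x"] d that elim by auto
    moreover have "\<psi> x < a" if "(real (digit n x) + 1) / 2 ^ n \<le> a"
      using d(2) that by (rule less_le_trans)
    ultimately show ?case using elim unfolding A'_def dyadic_def S_def by blast
  qed
  then have 0: "dm (\<psi> -` {..<a} \<inter> space M) A' = 0" by (rule dm_AE[OF E A'])
  have "dm A' (dyadic n S) \<le> prob (dyadic n {rdigit n a})"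
    by (rule dm_le[OF A']) (auto simp: A'_def)
  also have "\<dots> \<le> 1 / 2 ^ n"
  proof (cases "rdigit n a < 2 ^ n")
    case False
    have "prob (dyadic n {rdigit n a}) = prob {}"
      by (rule measure_eq_AE) (use AE_digit[of n] False in \<open>auto simp: dyadic_def elim: eventually_mono\<close>)
    then show ?thesis by simp
  qed (simp add: prob_dyadic_single)
  also have "\<dots> < e" using n by (simp add: power_one_over)
  finally have "dm (\<psi> -` {..<a} \<inter> space M) (dyadic n S) < e"
    using dm_triangle[OF E A' dyadic_events[of n S]] 0 by simp
  then show "\<exists>n S. dm (\<psi> -` {..<a} \<inter> space M) (dyadic n S) < e" by blast
qed

text \<open>Half-lines are stable under intersection and generate the Borel sets, so complements and
  disjoint countable unions suffice. A countable union is replaced by a finite one by continuity of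
  the measure.\<close>

lemma approximable_borel:
  assumes "B \<in> sets borel"
  shows "approximable (\<psi> -` B \<inter> space M)"
proof -
  have eq: "sets borel = sigma_sets UNIV (range lessThan :: real set set)"
    by (subst borel_Iio) (simp add: sets_measure_of)
  have B: "B \<in> sigma_sets UNIV (range lessThan :: real set set)" using assms eq by simp
  have "Int_stable (range lessThan :: real set set)"
  proof (rule Int_stableI)
    fix A B :: "real set" assume "A \<in> range lessThan" "B \<in> range lessThan"
    then obtain a b where "A = {..<a}" "B = {..<b}" by blast
    then have "A \<inter> B = {..<min a b}" by auto
    then show "A \<inter> B \<in> range lessThan" by blast
  qed
  moreover have "range lessThan \<subseteq> Pow (UNIV :: real set)" by simp
  ultimately show ?thesis
    using B
  proof (induction B rule: sigma_sets_induct_disjoint)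
    case (basic A)
    then show ?case using approximable_halfline by auto
  next
    case empty
    then show ?case using approximable_empty by simp
  next
    case (compl A)
    have A: "\<psi> -` A \<inter> space M \<in> events" using compl.hyps eq by (intro measurable_sets[OF \<psi>_measurable]) simp
    have "\<psi> -` (UNIV - A) \<inter> space M = space M - (\<psi> -` A \<inter> space M)" by auto
    then show ?case using approximable_compl[OF compl.IH A] by simp
  next
    case (union A)
    define P where "P = (\<lambda>i. \<psi> -` A i \<inter> space M)"
    have A: "P i \<in> events" for i
      unfolding P_def using union.hyps(2) eq by (intro measurable_sets[OF \<psi>_measurable]) blast
    have IH: "approximable (P i)" for i using union.IH unfolding P_def .
    have fin: "approximable (\<Union>i<n. P i)" for n
    proof (induction n)
      case (Suc n)
      have "(\<Union>i<n. P i) \<in> events" using A by (intro sets.finite_UN) auto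
      then show ?case
        using approximable_Un[OF Suc _ IH[of n] A] by (simp add: lessThan_Suc Un_commute)
    qed (simp add: approximable_empty)
    have meas: "(\<Union>i. P i) \<in> events" "\<And>n. (\<Union>i<n. P i) \<in> events"
      using A by (auto intro!: sets.countable_UN sets.finite_UN)
    have "approximable (\<Union>i. P i)"
    proof (rule approximableI)
      fix e :: real assume "e > 0"
      then have e: "e / 2 > 0" by simp
      have "(\<lambda>n. prob (\<Union>i<n. P i)) \<longlonglongrightarrow> prob (\<Union>n. \<Union>i<n. P i)"
      proof (rule finite_Lim_measure_incseq)
        show "range (\<lambda>n. \<Union>i<n. P i) \<subseteq> events" using meas(2) by blast
        show "incseq (\<lambda>n. \<Union>i<n. P i)" by (intro monoI UN_mono) auto
      qed
      moreover have "(\<Union>n. \<Union>i<n. P i) = (\<Union>i. P i)" by auto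
      ultimately have "(\<lambda>n. prob (\<Union>i<n. P i)) \<longlonglongrightarrow> prob (\<Union>i. P i)" by simp
      from LIMSEQ_D[OF this e] obtain n where n: "\<bar>prob (\<Union>i<n. P i) - prob (\<Union>i. P i)\<bar> < e / 2"
        by (auto simp: real_norm_def)
      have sub: "(\<Union>i<n. P i) \<subseteq> (\<Union>i. P i)" by auto
      have "((\<Union>i. P i) - (\<Union>i<n. P i)) \<union> ((\<Union>i<n. P i) - (\<Union>i. P i)) = (\<Union>i. P i) - (\<Union>i<n. P i)"
        using sub by blast
      then have "dm (\<Union>i. P i) (\<Union>i<n. P i) = prob (\<Union>i. P i) - prob (\<Union>i<n. P i)"
        unfolding dm_def using finite_measure_Diff[OF meas(1) meas(2) sub] by simp
      then have 1: "dm (\<Union>i. P i) (\<Union>i<n. P i) < e / 2" using n by linarith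
      obtain m S where 2: "dm (\<Union>i<n. P i) (dyadic m S) < e / 2"
        using fin[of n] e unfolding approximable_def by blast
      have "dm (\<Union>i. P i) (dyadic m S) < e"
        using dm_triangle[OF meas(1) meas(2)[of n] dyadic_events[of m S]] 1 2 by linarith
      then show "\<exists>n S. dm (\<Union>i. P i) (dyadic n S) < e" by blast
    qed
    moreover have "\<psi> -` (\<Union>i. A i) \<inter> space M = (\<Union>i. P i)" by (auto simp: P_def)
    ultimately show ?case by simp
  qed
qed

theorem dyadic_approximation:
  assumes A: "A \<in> events" and e: "e > 0"
  shows "\<exists>n0. \<forall>n\<ge>n0. \<exists>S. S \<subseteq> {..<2 ^ n} \<and> dm A (dyadic n S) < e"
proof -
  let ?B = "\<kappa> -` A"
  have B: "?B \<in> sets borel" using measurable_sets[OF \<kappa>_measurable A] by simp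
  have PB: "\<psi> -` ?B \<inter> space M \<in> events" by (rule measurable_sets[OF \<psi>_measurable B])
  have "AE x in M. x \<in> A \<longleftrightarrow> x \<in> \<psi> -` ?B \<inter> space M"
    using \<kappa>_\<psi> AE_space by eventually_elim simp
  then have 0: "dm A (\<psi> -` ?B \<inter> space M) = 0" by (rule dm_AE[OF A PB])
  obtain n0 where n0: "\<And>n. n \<ge> n0 \<Longrightarrow> \<exists>S. dm (\<psi> -` ?B \<inter> space M) (dyadic n S) < e"
    using approximable_borel[OF B] e unfolding approximable_def by blast
  have "\<exists>S. S \<subseteq> {..<2 ^ n} \<and> dm A (dyadic n S) < e" if n: "n \<ge> n0" for n
  proof -
    obtain S where "dm (\<psi> -` ?B \<inter> space M) (dyadic n S) < e" using n0[OF n] by blast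
    then have "dm A (dyadic n S) < e"
      using dm_triangle[OF A PB dyadic_events[of n S]] 0 by linarith
    moreover have "dm (dyadic n S) (dyadic n (S \<inter> {..<2 ^ n})) = 0"
      by (rule dm_AE[OF _ _ dyadic_restrict]) auto
    ultimately have "dm A (dyadic n (S \<inter> {..<2 ^ n})) < e"
      using dm_triangle[OF A dyadic_events[of n S] dyadic_events[of n "S \<inter> {..<2 ^ n}"]] by linarith
    then show ?thesis by (intro exI[of _ "S \<inter> {..<2 ^ n}"] conjI) simp_all
  qed
  then show ?thesis by (intro exI[of _ n0] allI impI)
qed

end

text \<open>Bijections between corresponding pieces are glued; what remains of \<open>X\<close> on
  the two sides has equal cardinality and is matched arbitrarily.\<close>

lemma extend_matching:
  assumes "finite X" "finite J"
    and R: "\<And>j. j \<in> J \<Longrightarrow> R j \<subseteq> X" and S: "\<And>j. j \<in> J \<Longrightarrow> S j \<subseteq> X"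
    and dR: "disjoint_family_on R J" and dS: "disjoint_family_on S J"
    and card: "\<And>j. j \<in> J \<Longrightarrow> card (R j) = card (S j)"
  obtains \<pi> where "bij_betw \<pi> X X" "\<And>j. j \<in> J \<Longrightarrow> \<pi> ` R j = S j"
proof -
  have fin: "finite (R j)" "finite (S j)" if "j \<in> J" for j
    using R[OF that] S[OF that] assms(1) finite_subset by blast+
  have "\<exists>f. bij_betw f (R j) (S j)" if "j \<in> J" for j
    by (rule finite_same_card_bij[OF fin[OF that] card[OF that]])
  then obtain f where f: "\<And>j. j \<in> J \<Longrightarrow> bij_betw (f j) (R j) (S j)" by metis
  define g where "g = (\<lambda>x. f (THE j. j \<in> J \<and> x \<in> R j) x)"
  have g_eq: "g x = f j x" if "j \<in> J" "x \<in> R j" for j x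
  proof -
    have "(THE j. j \<in> J \<and> x \<in> R j) = j"
      using that dR by (intro the_equality) (auto simp: disjoint_family_on_def)
    then show ?thesis by (simp add: g_def)
  qed
  have g: "bij_betw g (R j) (S j)" if "j \<in> J" for j
    using bij_betw_cong[of "R j" g "f j" "S j"] g_eq[OF that] f[OF that] by blast
  have gU: "bij_betw g (\<Union>j\<in>J. R j) (\<Union>j\<in>J. S j)"
    by (rule bij_betw_UNION_disjoint[OF dS g])
  have sub: "(\<Union>j\<in>J. R j) \<subseteq> X" "(\<Union>j\<in>J. S j) \<subseteq> X" using R S by blast+
  have "card (X - (\<Union>j\<in>J. R j)) = card (X - (\<Union>j\<in>J. S j))"
    using sub assms(1) bij_betw_same_card[OF gU]
    by (simp add: card_Diff_subset finite_subset[OF _ assms(1)])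
  then obtain h where h: "bij_betw h (X - (\<Union>j\<in>J. R j)) (X - (\<Union>j\<in>J. S j))"
    using finite_same_card_bij[OF finite_Diff[OF assms(1)] finite_Diff[OF assms(1)]] by blast
  define \<pi> where "\<pi> = (\<lambda>x. if x \<in> (\<Union>j\<in>J. R j) then g x else h x)"
  have "bij_betw \<pi> (\<Union>j\<in>J. R j) (\<Union>j\<in>J. S j)"
    using gU bij_betw_cong[of "\<Union>j\<in>J. R j" \<pi> g] by (simp add: \<pi>_def)
  moreover have "bij_betw \<pi> (X - (\<Union>j\<in>J. R j)) (X - (\<Union>j\<in>J. S j))"
    using h bij_betw_cong[of "X - (\<Union>j\<in>J. R j)" \<pi> h] by (simp add: \<pi>_def)
  ultimately have "bij_betw \<pi> ((\<Union>j\<in>J. R j) \<union> (X - (\<Union>j\<in>J. R j))) ((\<Union>j\<in>J. S j) \<union> (X - (\<Union>j\<in>J. S j)))"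
    by (rule bij_betw_combine) blast
  then have "bij_betw \<pi> X X" using sub by (simp add: Un_absorb1)
  moreover have "\<pi> ` R j = S j" if j: "j \<in> J" for j
  proof -
    have "\<pi> ` R j = g ` R j"
      using j by (intro image_cong) (auto simp: \<pi>_def)
    then show ?thesis using bij_betw_imp_surj_on[OF g[OF j]] by simp
  qed
  ultimately show thesis using that by blast
qed

section \<open>Interval exchanges and the matching of disjoint sets\<close>

context uniform_chart
begin

text \<open>The interval exchange that translates the dyadic interval of level \<open>n\<close> with
  index \<open>k\<close> onto the one with index \<open>\<pi> k\<close>.\<close>

definition exchange :: "nat \<Rightarrow> (nat \<Rightarrow> nat) \<Rightarrow> real \<Rightarrow> real" where
  "exchange n \<pi> y = y + (real (\<pi> (rdigit n y)) - real (rdigit n y)) / 2 ^ n"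

lemma exchange_measurable [measurable]: "exchange n \<pi> \<in> borel_measurable borel"
proof -
  have "(\<lambda>y. real (\<pi> (rdigit n y)) - real (rdigit n y)) \<in> borel_measurable borel"
    using measurable_compose[OF rdigit_measurable[of n], of "\<lambda>k. real (\<pi> k) - real k" borel] by simp
  then show ?thesis unfolding exchange_def by measurable
qed

definition cell :: "nat \<Rightarrow> nat \<Rightarrow> real set" where
  "cell n k = {real k / 2 ^ n..<(real k + 1) / 2 ^ n}"

lemma mem_cell_iff: "y \<in> cell n k \<longleftrightarrow> real k / 2 ^ n \<le> y \<and> y < (real k + 1) / 2 ^ n"
  by (simp add: cell_def)

lemma cell_borel [measurable, simp]: "cell n k \<in> sets borel"
  by (simp add: cell_def)

lemma exchange_cell: "0 \<le> y \<Longrightarrow> exchange n \<pi> y \<in> cell n (\<pi> (rdigit n y))"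
  using rdigit_eq_iff[of y n "rdigit n y"]
  by (simp add: exchange_def mem_cell_iff diff_divide_distrib add_divide_distrib)

lemma cell_bounds:
  assumes "k < 2 ^ n" "y \<in> cell n k"
  shows "0 \<le> y" "y < 1"
proof -
  have 0: "0 \<le> real k / 2 ^ n" by simp
  have "real k + 1 \<le> 2 ^ n"
    using assms(1) by (metis Suc_leI add.commute of_nat_Suc of_nat_le_iff of_nat_numeral of_nat_power)
  then have 1: "(real k + 1) / 2 ^ n \<le> 1" by simp
  show "0 \<le> y" using 0 assms(2) by (meson mem_cell_iff order_trans)
  show "y < 1" using 1 assms(2) by (meson mem_cell_iff less_le_trans)
qed

lemma rdigit_cell: "y \<in> cell n k \<Longrightarrow> rdigit n y = k"
proof -
  assume y: "y \<in> cell n k"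
  have "0 \<le> real k / 2 ^ n" by simp
  then have "0 \<le> y" using y by (meson mem_cell_iff order_trans)
  then show ?thesis using y rdigit_eq_iff[of y n k] by (simp add: mem_cell_iff)
qed

lemma rdigit_exchange: "0 \<le> y \<Longrightarrow> rdigit n (exchange n \<pi> y) = \<pi> (rdigit n y)"
  by (rule rdigit_cell[OF exchange_cell])

lemma exchange_exchange:
  assumes "0 \<le> y" "\<pi>' (\<pi> (rdigit n y)) = rdigit n y"
  shows "exchange n \<pi>' (exchange n \<pi> y) = y"
  using assms rdigit_exchange[OF assms(1), of n \<pi>]
  by (simp add: exchange_def[of n \<pi>'] exchange_def[of n \<pi> y] diff_divide_distrib)

lemma emeasure_sum_cells:
  assumes C: "C \<in> sets borel"
  shows "emeasure lborel (C \<inter> {0<..<1}) = (\<Sum>k<2 ^ n. emeasure lborel (C \<inter> cell n k))"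
proof -
  have "emeasure lborel (C \<inter> {0<..<1}) = emeasure lborel (\<Union>k<2 ^ n. C \<inter> cell n k)"
  proof (rule emeasure_eq_AE)
    show "AE y in lborel. y \<in> C \<inter> {0<..<1} \<longleftrightarrow> y \<in> (\<Union>k<2 ^ n. C \<inter> cell n k)"
      using AE_lborel_singleton[of "0::real"]
    proof eventually_elim
      case (elim y)
      show ?case
      proof
        assume y: "y \<in> C \<inter> {0<..<1}"
        then have "y \<in> cell n (rdigit n y)" using rdigit_eq_iff[of y n "rdigit n y"] by (simp add: mem_cell_iff)
        moreover have "rdigit n y < 2 ^ n" using y by (intro rdigit_less) auto
        ultimately show "y \<in> (\<Union>k<2 ^ n. C \<inter> cell n k)" using y by blast
      next
        assume "y \<in> (\<Union>k<2 ^ n. C \<inter> cell n k)"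
        then obtain k where "k < 2 ^ n" "y \<in> C" "y \<in> cell n k" by blast
        then show "y \<in> C \<inter> {0<..<1}" using cell_bounds[of k n y] elim by simp
      qed
    qed
    show "C \<inter> {0<..<1} \<in> sets lborel" using C by simp
    show "(\<Union>k<2 ^ n. C \<inter> cell n k) \<in> sets lborel" using C by (intro sets.finite_UN) auto
  qed
  also have "\<dots> = (\<Sum>k<2 ^ n. emeasure lborel (C \<inter> cell n k))"
  proof (rule sum_emeasure[symmetric])
    show "(\<lambda>k. C \<inter> cell n k) ` {..<2 ^ n} \<subseteq> sets lborel" using C by auto
    show "disjoint_family_on (\<lambda>k. C \<inter> cell n k) {..<2 ^ n}"
      unfolding disjoint_family_on_def
    proof (intro ballI impI)
      fix i j :: nat assume "i \<noteq> j"
      then have "cell n i \<inter> cell n j = {}" using rdigit_cell[of _ n i] rdigit_cell[of _ n j] by blast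
      then show "(C \<inter> cell n i) \<inter> (C \<inter> cell n j) = {}" by blast
    qed
  qed simp
  finally show ?thesis .
qed

text \<open>On each cell the exchange is a translation, which preserves Lebesgue measure, and the
  permutation only reorders the sum over the cells.\<close>

lemma exchange_law:
  assumes \<pi>: "bij_betw \<pi> {..<2 ^ n} {..<2 ^ n}" and B: "B \<in> sets borel"
  shows "emeasure lborel (exchange n \<pi> -` B \<inter> {0<..<1}) = emeasure lborel (B \<inter> {0<..<1})"
proof -
  have E: "exchange n \<pi> -` B \<in> sets borel" using measurable_sets[OF exchange_measurable B] by simp
  have cells: "emeasure lborel (exchange n \<pi> -` B \<inter> cell n k) = emeasure lborel (B \<inter> cell n (\<pi> k))" for k
  proof -
    define c where "c = (real (\<pi> k) - real k) / 2 ^ n"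
    have cell: "y \<in> cell n k \<longleftrightarrow> c + y \<in> cell n (\<pi> k)" for y
      by (auto simp: c_def mem_cell_iff diff_divide_distrib add_divide_distrib)
    have ex: "exchange n \<pi> y = c + y" if "y \<in> cell n k" for y
      using rdigit_cell[OF that] by (simp add: exchange_def c_def)
    have "exchange n \<pi> -` B \<inter> cell n k = (+) c -` (B \<inter> cell n (\<pi> k)) \<inter> space lborel"
    proof (rule Set.set_eqI)
      fix y show "y \<in> exchange n \<pi> -` B \<inter> cell n k \<longleftrightarrow> y \<in> (+) c -` (B \<inter> cell n (\<pi> k)) \<inter> space lborel"
        using cell[of y] ex[of y] by (cases "y \<in> cell n k") simp_all
    qed
    also have "emeasure lborel \<dots> = emeasure (distr lborel borel ((+) c)) (B \<inter> cell n (\<pi> k))"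
      using B by (intro emeasure_distr[symmetric]) auto
    finally show ?thesis by (simp add: lborel_distr_plus)
  qed
  have "emeasure lborel (exchange n \<pi> -` B \<inter> {0<..<1}) = (\<Sum>k<2 ^ n. emeasure lborel (B \<inter> cell n (\<pi> k)))"
    unfolding emeasure_sum_cells[OF E, of n] cells by (rule refl)
  also have "\<dots> = (\<Sum>k<2 ^ n. emeasure lborel (B \<inter> cell n k))"
    by (rule sum.reindex_bij_betw[OF \<pi>])
  finally show ?thesis unfolding emeasure_sum_cells[OF B, of n] .
qed

definition dyadic_map :: "nat \<Rightarrow> (nat \<Rightarrow> nat) \<Rightarrow> 'a \<Rightarrow> 'a" where
  "dyadic_map n \<pi> x = \<kappa> (exchange n \<pi> (\<psi> x))"

lemma dyadic_map_measurable [measurable]: "dyadic_map n \<pi> \<in> measurable M M"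
  unfolding dyadic_map_def by measurable

lemma \<psi>_exchange_null:
  assumes \<pi>: "bij_betw \<pi> {..<2 ^ n} {..<2 ^ n}" and B: "B \<in> sets borel"
  shows "emeasure M (\<psi> -` (exchange n \<pi> -` B) \<inter> space M) = emeasure M (\<psi> -` B \<inter> space M)"
proof -
  have E: "exchange n \<pi> -` B \<in> sets borel" using measurable_sets[OF exchange_measurable B] by simp
  show ?thesis by (simp only: \<psi>_law[OF E] \<psi>_law[OF B] exchange_law[OF \<pi> B])
qed

lemma dyadic_map_distr:
  assumes \<pi>: "bij_betw \<pi> {..<2 ^ n} {..<2 ^ n}"
  shows "distr M M (dyadic_map n \<pi>) = M"
proof (rule measure_eqI)
  fix A assume "A \<in> sets (distr M M (dyadic_map n \<pi>))"
  then have A: "A \<in> events" by simp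
  have B: "\<kappa> -` A \<in> sets borel" using measurable_sets[OF \<kappa>_measurable A] by simp
  have "emeasure (distr M M (dyadic_map n \<pi>)) A = emeasure M (dyadic_map n \<pi> -` A \<inter> space M)"
    by (rule emeasure_distr[OF dyadic_map_measurable A])
  also have "dyadic_map n \<pi> -` A \<inter> space M = \<psi> -` (exchange n \<pi> -` (\<kappa> -` A)) \<inter> space M"
    by (simp add: dyadic_map_def vimage_def)
  also have "emeasure M \<dots> = emeasure M (\<psi> -` (\<kappa> -` A) \<inter> space M)"
    by (rule \<psi>_exchange_null[OF \<pi> B])
  also have "\<dots> = emeasure M A"
  proof (rule emeasure_eq_AE)
    show "AE x in M. x \<in> \<psi> -` (\<kappa> -` A) \<inter> space M \<longleftrightarrow> x \<in> A"
      using \<kappa>_\<psi> AE_space by eventually_elim simp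
    show "\<psi> -` (\<kappa> -` A) \<inter> space M \<in> events" by (rule measurable_sets[OF \<psi>_measurable B])
  qed (rule A)
  finally show "emeasure (distr M M (dyadic_map n \<pi>)) A = emeasure M A" .
qed simp

text \<open>The reals with \<open>\<psi> (\<kappa> y) \<noteq> y\<close> have a null preimage under
  \<psi>, because \<kappa> inverts \<psi> almost everywhere. The exchange preserves the law of
  \<psi>, so its values also avoid these reals almost everywhere.\<close>

lemma \<psi>_dyadic_map:
  assumes \<pi>: "bij_betw \<pi> {..<2 ^ n} {..<2 ^ n}"
  shows "AE x in M. \<psi> (dyadic_map n \<pi> x) = exchange n \<pi> (\<psi> x)"
proof -
  let ?N = "{y. \<psi> (\<kappa> y) \<noteq> y}"
  have [measurable]: "(\<lambda>y. \<psi> (\<kappa> y)) \<in> borel_measurable borel" by measurable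
  have "{y \<in> space borel. \<psi> (\<kappa> y) \<noteq> y} \<in> sets borel" by measurable
  then have N: "?N \<in> sets borel" by simp
  have "emeasure M (\<psi> -` ?N \<inter> space M) = emeasure M {}"
  proof (rule emeasure_eq_AE)
    show "AE x in M. x \<in> \<psi> -` ?N \<inter> space M \<longleftrightarrow> x \<in> {}"
      using \<kappa>_\<psi> by eventually_elim simp
    show "\<psi> -` ?N \<inter> space M \<in> events" by (rule measurable_sets[OF \<psi>_measurable N])
  qed simp
  then have 0: "emeasure M (\<psi> -` (exchange n \<pi> -` ?N) \<inter> space M) = 0"
    using \<psi>_exchange_null[OF \<pi> N] by simp
  have E: "exchange n \<pi> -` ?N \<in> sets borel" using measurable_sets[OF exchange_measurable N] by simp
  have "\<psi> -` (exchange n \<pi> -` ?N) \<inter> space M \<in> null_sets M"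
    unfolding null_sets_def using 0 measurable_sets[OF \<psi>_measurable E] by blast
  then show ?thesis
    by (rule AE_I') (auto simp: dyadic_map_def)
qed

text \<open>The maps built from a permutation and from its inverse undo each other almost
  everywhere, which is enough to correct the first to an automorphism.\<close>

lemma permutation_automorphism:
  assumes \<pi>: "bij_betw \<pi> {..<2 ^ n} {..<2 ^ n}"
  obtains g where "g \<in> carrier (Aut M)" "AE x in M. digit n (rep g x) = \<pi> (digit n x)"
proof -
  define \<sigma> where "\<sigma> = inv_into {..<2 ^ n} \<pi>"
  have \<sigma>: "bij_betw \<sigma> {..<2 ^ n} {..<2 ^ n}"
    unfolding \<sigma>_def by (rule bij_betw_inv_into[OF \<pi>])
  have ae: "AE x in M. dyadic_map n \<rho>' (dyadic_map n \<rho> x) = x"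
    if \<rho>: "bij_betw \<rho> {..<2 ^ n} {..<2 ^ n}" and inv: "\<And>k. k < 2 ^ n \<Longrightarrow> \<rho>' (\<rho> k) = k" for \<rho> \<rho>'
    using \<psi>_dyadic_map[OF \<rho>] AE_\<psi> AE_digit[of n] \<kappa>_\<psi>
  proof eventually_elim
    case (elim x)
    have "exchange n \<rho>' (exchange n \<rho> (\<psi> x)) = \<psi> x"
      using elim inv by (intro exchange_exchange) (auto simp: digit_def)
    then show ?case using elim by (simp add: dyadic_map_def[of n \<rho>'])
  qed
  have 1: "AE x in M. dyadic_map n \<sigma> (dyadic_map n \<pi> x) = x"
    by (rule ae[OF \<pi>]) (simp add: \<sigma>_def bij_betw_inv_into_left[OF \<pi>])
  have 2: "AE x in M. dyadic_map n \<pi> (dyadic_map n \<sigma> x) = x"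
    by (rule ae[OF \<sigma>]) (simp add: \<sigma>_def bij_betw_inv_into_right[OF \<pi>])
  obtain t where t: "t \<in> tr" "AE x in M. t x = dyadic_map n \<pi> x"
    by (rule automorphism_of_ae_inverse[OF dyadic_map_measurable dyadic_map_measurable
          dyadic_map_distr[OF \<sigma>] dyadic_map_distr[OF \<pi>] 1 2])
  have "AE x in M. digit n (rep (cls t) x) = \<pi> (digit n x)"
    using rep_cls[OF t(1)] t(2) \<psi>_dyadic_map[OF \<pi>] AE_\<psi>
    by eventually_elim (simp add: digit_def rdigit_exchange)
  then show thesis by (rule that[OF cls_carrier[OF t(1)]])
qed

lemma rep_measurable: "g \<in> carrier (Aut M) \<Longrightarrow> rep g \<in> measurable M M"
  and rep_distr: "g \<in> carrier (Aut M) \<Longrightarrow> distr M M (rep g) = M"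
  using trD[OF rep_tr[of g]] by auto

text \<open>A point in the overlap of two approximants lies outside one of the disjoint sets
  \<open>B i\<close> and \<open>B j\<close>, hence in an approximation error. Each overlap thus has
  measure at most \<open>2 * e\<close>, and at most \<open>card J\<close> of them are removed from
  an approximant.\<close>

lemma disjoint_dyadic_approximation:
  fixes e :: real
  assumes J: "finite J" and B: "\<And>j. j \<in> J \<Longrightarrow> B j \<in> events" "disjoint_family_on B J"
    and S: "\<And>j. j \<in> J \<Longrightarrow> dm (B j) (dyadic n (S j)) < e" and e: "e > 0"
  obtains S' where "disjoint_family_on S' J"
    "\<forall>j\<in>J. S' j \<subseteq> S j \<and> dm (B j) (dyadic n (S' j)) < (2 * card J + 1) * e"
proof (rule that)
  let ?S' = "\<lambda>j. S j - (\<Union>i\<in>J - {j}. S i)"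
  show "disjoint_family_on ?S' J" unfolding disjoint_family_on_def by blast
  show "\<forall>j\<in>J. ?S' j \<subseteq> S j \<and> dm (B j) (dyadic n (?S' j)) < (2 * card J + 1) * e"
  proof (intro ballI conjI)
    fix j assume j: "j \<in> J"
    show "?S' j \<subseteq> S j" by blast
    have overlap: "prob (dyadic n (S i \<inter> S j)) \<le> 2 * e" if i: "i \<in> J - {j}" for i
    proof -
      have disj: "B i \<inter> B j = {}" using B(2) i j by (auto simp: disjoint_family_on_def)
      have "prob (dyadic n (S i \<inter> S j)) \<le> prob (((B i - dyadic n (S i)) \<union> (dyadic n (S i) - B i))
          \<union> ((B j - dyadic n (S j)) \<union> (dyadic n (S j) - B j)))"
      proof (rule finite_measure_mono)
        show "dyadic n (S i \<inter> S j) \<subseteq> ((B i - dyadic n (S i)) \<union> (dyadic n (S i) - B i))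
            \<union> ((B j - dyadic n (S j)) \<union> (dyadic n (S j) - B j))"
          using disj by (auto simp: dyadic_def)
        show "((B i - dyadic n (S i)) \<union> (dyadic n (S i) - B i))
            \<union> ((B j - dyadic n (S j)) \<union> (dyadic n (S j) - B j)) \<in> events"
          using B(1)[of i] B(1)[OF j] i by (intro sets.Un sets.Diff dyadic_events) auto
      qed
      also have "\<dots> \<le> dm (B i) (dyadic n (S i)) + dm (B j) (dyadic n (S j))"
        unfolding dm_def using B(1)[of i] B(1)[OF j] i
        by (intro measure_Un_le sets.Un sets.Diff dyadic_events) auto
      also have "\<dots> \<le> e + e" using S[of i] S[OF j] i by simp
      finally show ?thesis by simp
    qed
    have fJ: "finite (J - {j})" using J by simp
    have "dm (dyadic n (S j)) (dyadic n (?S' j)) \<le> prob (\<Union>i\<in>J - {j}. dyadic n (S i \<inter> S j))"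
    proof (rule dm_le[OF dyadic_events dyadic_events])
      show "(\<Union>i\<in>J - {j}. dyadic n (S i \<inter> S j)) \<in> events" using fJ by (intro sets.finite_UN) auto
      show "dyadic n (S j) - dyadic n (?S' j) \<union> (dyadic n (?S' j) - dyadic n (S j))
          \<subseteq> (\<Union>i\<in>J - {j}. dyadic n (S i \<inter> S j))"
        by (auto simp: dyadic_def)
    qed
    also have "\<dots> \<le> (\<Sum>i\<in>J - {j}. prob (dyadic n (S i \<inter> S j)))"
      using fJ by (intro measure_UNION_le) auto
    also have "\<dots> \<le> (\<Sum>i\<in>J - {j}. 2 * e)" by (rule sum_mono) (rule overlap)
    also have "\<dots> \<le> card J * (2 * e)"
    proof -
      have "real (card (J - {j})) \<le> card J" using J by (simp add: card_mono)
      then show ?thesis using e by (simp add: mult_right_mono del: card_Diff_insert)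
    qed
    finally have 1: "dm (dyadic n (S j)) (dyadic n (?S' j)) \<le> card J * (2 * e)" .
    have "dm (B j) (dyadic n (?S' j)) \<le> dm (B j) (dyadic n (S j)) + dm (dyadic n (S j)) (dyadic n (?S' j))"
      by (rule dm_triangle[OF B(1)[OF j] dyadic_events dyadic_events])
    then show "dm (B j) (dyadic n (?S' j)) < (2 * card J + 1) * e"
      using 1 S[OF j] by (simp add: algebra_simps)
  qed
qed

lemma dm_dyadic_subset:
  assumes "R \<subseteq> S" "S \<subseteq> {..<2 ^ n}"
  shows "dm (dyadic n S) (dyadic n R) = (real (card S) - real (card R)) / 2 ^ n"
proof -
  have sub: "dyadic n R \<subseteq> dyadic n S" using assms(1) by (auto simp: dyadic_def)
  then have "dyadic n S - dyadic n R \<union> (dyadic n R - dyadic n S) = dyadic n S - dyadic n R" by blast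
  then have "dm (dyadic n S) (dyadic n R) = prob (dyadic n S) - prob (dyadic n R)"
    unfolding dm_def using finite_measure_Diff[OF dyadic_events dyadic_events sub] by simp
  then show ?thesis using prob_dyadic[OF assms(2)] prob_dyadic[of R n] assms by (simp add: diff_divide_distrib)
qed

text \<open>Both families are approximated by disjoint unions of cells of a common level,
  corresponding unions are cut down to equally many cells, and a permutation of the cells does the
  rest. The two approximations cost less than \<open>e / 8\<close> each. The cutting costs less than
  \<open>3 * e / 4\<close>: the difference of the probabilities contributes \<open>e / 2\<close> and
  the approximations \<open>e / 4\<close>.\<close>

theorem matching_automorphism:
  assumes J: "finite J"
    and B: "\<And>j. j \<in> J \<Longrightarrow> B j \<in> events" "disjoint_family_on B J"
    and C: "\<And>j. j \<in> J \<Longrightarrow> C j \<in> events" "disjoint_family_on C J"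
    and close: "\<And>j. j \<in> J \<Longrightarrow> \<bar>prob (B j) - prob (C j)\<bar> < e / 2" and e: "e > 0"
  obtains g where "g \<in> carrier (Aut M)" "\<And>j. j \<in> J \<Longrightarrow> dm (pre (rep g) (B j)) (C j) < e"
proof -
  \<comment> \<open>Making the approximants disjoint multiplies the error by
    \<open>2 * card J + 1\<close>; the product is to be \<open>e / 8\<close>.\<close>
  define \<eta> where "\<eta> = e / (8 * (2 * card J + 1))"
  have \<eta>: "\<eta> > 0" using e by (simp add: \<eta>_def)
  have \<eta>8: "(2 * card J + 1) * \<eta> = e / 8" by (simp add: \<eta>_def add_pos_nonneg field_simps)
  have "\<exists>m. \<forall>n\<ge>m. \<exists>S. S \<subseteq> {..<2 ^ n} \<and> dm (B j) (dyadic n S) < \<eta>" if "j \<in> J" for j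
    by (rule dyadic_approximation[OF B(1)[OF that] \<eta>])
  then obtain p where p: "\<And>j n. j \<in> J \<Longrightarrow> n \<ge> p j \<Longrightarrow> \<exists>S. S \<subseteq> {..<2 ^ n} \<and> dm (B j) (dyadic n S) < \<eta>"
    by metis
  have "\<exists>m. \<forall>n\<ge>m. \<exists>S. S \<subseteq> {..<2 ^ n} \<and> dm (C j) (dyadic n S) < \<eta>" if "j \<in> J" for j
    by (rule dyadic_approximation[OF C(1)[OF that] \<eta>])
  then obtain q where q: "\<And>j n. j \<in> J \<Longrightarrow> n \<ge> q j \<Longrightarrow> \<exists>S. S \<subseteq> {..<2 ^ n} \<and> dm (C j) (dyadic n S) < \<eta>"
    by metis
  define n where "n = (\<Sum>j\<in>J. p j + q j)"
  have n: "p j \<le> n" "q j \<le> n" if "j \<in> J" for j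
    using member_le_sum[OF that, of "\<lambda>j. p j + q j"] J by (auto simp: n_def)
  obtain S where S: "\<And>j. j \<in> J \<Longrightarrow> S j \<subseteq> {..<2 ^ n}" "\<And>j. j \<in> J \<Longrightarrow> dm (B j) (dyadic n (S j)) < \<eta>"
  proof -
    have "\<exists>S. S \<subseteq> {..<2 ^ n} \<and> dm (B j) (dyadic n S) < \<eta>" if "j \<in> J" for j
      by (rule p[OF that n(1)[OF that]])
    then show thesis using that by metis
  qed
  obtain R where R: "\<And>j. j \<in> J \<Longrightarrow> R j \<subseteq> {..<2 ^ n}" "\<And>j. j \<in> J \<Longrightarrow> dm (C j) (dyadic n (R j)) < \<eta>"
  proof -
    have "\<exists>S. S \<subseteq> {..<2 ^ n} \<and> dm (C j) (dyadic n S) < \<eta>" if "j \<in> J" for j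
      by (rule q[OF that n(2)[OF that]])
    then show thesis using that by metis
  qed
  obtain S1 where S1': "disjoint_family_on S1 J"
    "\<forall>j\<in>J. S1 j \<subseteq> S j \<and> dm (B j) (dyadic n (S1 j)) < (2 * card J + 1) * \<eta>"
    by (rule disjoint_dyadic_approximation[OF J B S(2) \<eta>])
  note S1 = S1'(1) conjunct1[OF bspec[OF S1'(2)]] conjunct2[OF bspec[OF S1'(2)]]
  obtain R1 where R1': "disjoint_family_on R1 J"
    "\<forall>j\<in>J. R1 j \<subseteq> R j \<and> dm (C j) (dyadic n (R1 j)) < (2 * card J + 1) * \<eta>"
    by (rule disjoint_dyadic_approximation[OF J C R(2) \<eta>])
  note R1 = R1'(1) conjunct1[OF bspec[OF R1'(2)]] conjunct2[OF bspec[OF R1'(2)]]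
  have sub: "S1 j \<subseteq> {..<2 ^ n}" "R1 j \<subseteq> {..<2 ^ n}" if "j \<in> J" for j
    using S(1) S1(2) R(1) R1(2) that by blast+
  define m where "m = (\<lambda>j. min (card (S1 j)) (card (R1 j)))"
  have "\<exists>X. X \<subseteq> S1 j \<and> card X = m j" for j
  proof -
    have "m j \<le> card (S1 j)" by (simp add: m_def)
    then obtain X where "X \<subseteq> S1 j" "card X = m j" by (rule obtain_subset_with_card_n)
    then show ?thesis by (intro exI[of _ X] conjI)
  qed
  then obtain S2 where S2: "\<And>j. S2 j \<subseteq> S1 j" "\<And>j. card (S2 j) = m j" by metis
  have "\<exists>X. X \<subseteq> R1 j \<and> card X = m j" for j
  proof -
    have "m j \<le> card (R1 j)" by (simp add: m_def)
    then obtain X where "X \<subseteq> R1 j" "card X = m j" by (rule obtain_subset_with_card_n)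
    then show ?thesis by (intro exI[of _ X] conjI)
  qed
  then obtain R2 where R2: "\<And>j. R2 j \<subseteq> R1 j" "\<And>j. card (R2 j) = m j" by metis
  \<comment> \<open>The permutation goes from the cells for \<open>C\<close> to the cells for
    \<open>B\<close>, because \<open>B j\<close> is pulled back along the automorphism.\<close>
  obtain \<pi> where \<pi>: "bij_betw \<pi> {..<2 ^ n} {..<2 ^ n}" "\<And>j. j \<in> J \<Longrightarrow> \<pi> ` R2 j = S2 j"
  proof (rule extend_matching[of "{..<2 ^ n}" J R2 S2])
    show "R2 j \<subseteq> {..<2 ^ n}" "S2 j \<subseteq> {..<2 ^ n}" if "j \<in> J" for j
      using sub[OF that] R2(1)[of j] S2(1)[of j] by blast+
    show "disjoint_family_on R2 J"
      using R1(1) R2(1) unfolding disjoint_family_on_def by blast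
    show "disjoint_family_on S2 J"
      using S1(1) S2(1) unfolding disjoint_family_on_def by blast
  qed (use J S2(2) R2(2) in auto)
  obtain g where g: "g \<in> carrier (Aut M)" "AE x in M. digit n (rep g x) = \<pi> (digit n x)"
    by (rule permutation_automorphism[OF \<pi>(1)])
  note rg = rep_measurable[OF g(1)] rep_distr[OF g(1)]
  show thesis
  proof (rule that[OF g(1)])
    fix j assume j: "j \<in> J"
    note pe = pre_events[OF rg(1)]
    have 1: "dm (pre (rep g) (B j)) (pre (rep g) (dyadic n (S1 j))) < e / 8"
      using S1(3)[OF j] \<eta>8 by (simp only: dm_pre[OF rg B(1)[OF j] dyadic_events])
    have 2: "dm (pre (rep g) (dyadic n (S1 j))) (pre (rep g) (dyadic n (S2 j))) = (real (card (S1 j)) - real (m j)) / 2 ^ n"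
      by (simp only: dm_pre[OF rg dyadic_events dyadic_events] dm_dyadic_subset[OF S2(1) sub(1)[OF j]] S2(2))
    have 3: "dm (pre (rep g) (dyadic n (S2 j))) (dyadic n (R2 j)) = 0"
    proof (rule dm_AE[OF pe[OF dyadic_events] dyadic_events])
      show "AE x in M. x \<in> pre (rep g) (dyadic n (S2 j)) \<longleftrightarrow> x \<in> dyadic n (R2 j)"
        using g(2) AE_digit[of n] AE_space
      proof eventually_elim
        case (elim x)
        have "\<pi> (digit n x) \<in> S2 j \<longleftrightarrow> digit n x \<in> R2 j"
          unfolding \<pi>(2)[OF j, symmetric]
          using bij_betw_imp_inj_on[OF \<pi>(1)] elim(2) R2(1)[of j] sub(2)[OF j]
          by (intro inj_on_image_mem_iff[where B = "{..<2 ^ n}"]) auto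
        then show ?case
          using elim measurable_space[OF rg(1)] by (simp add: dyadic_def)
      qed
    qed
    have 4: "dm (dyadic n (R2 j)) (dyadic n (R1 j)) = (real (card (R1 j)) - real (m j)) / 2 ^ n"
      by (simp only: dm_commute[of "dyadic n (R2 j)"] dm_dyadic_subset[OF R2(1) sub(2)[OF j]] R2(2))
    have 5: "dm (dyadic n (R1 j)) (C j) < e / 8"
      using R1(3)[OF j] \<eta>8 by (simp only: dm_commute[of "dyadic n (R1 j)"])
    have "\<bar>prob (B j) - card (S1 j) / 2 ^ n\<bar> < e / 8"
      using dm_prob_diff[OF B(1)[OF j] dyadic_events[of n "S1 j"]] S1(3)[OF j] \<eta>8
        prob_dyadic[OF sub(1)[OF j]] by simp
    moreover have "\<bar>prob (C j) - card (R1 j) / 2 ^ n\<bar> < e / 8"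
      using dm_prob_diff[OF C(1)[OF j] dyadic_events[of n "R1 j"]] R1(3)[OF j] \<eta>8
        prob_dyadic[OF sub(2)[OF j]] by simp
    ultimately have "\<bar>card (S1 j) / 2 ^ n - card (R1 j) / 2 ^ n\<bar> < e / 2 + e / 4"
      using close[OF j] by linarith
    moreover have "(real (card (S1 j)) - real (m j)) / 2 ^ n + (real (card (R1 j)) - real (m j)) / 2 ^ n
        = \<bar>card (S1 j) / 2 ^ n - card (R1 j) / 2 ^ n\<bar>"
    proof -
      have "(real (card (S1 j)) - real (m j)) + (real (card (R1 j)) - real (m j))
          = \<bar>real (card (S1 j)) - real (card (R1 j))\<bar>"
        by (auto simp: m_def min_def)
      then show ?thesis by (simp add: add_divide_distrib[symmetric] diff_divide_distrib[symmetric] abs_divide)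
    qed
    moreover have "dm (pre (rep g) (B j)) (C j) \<le> dm (pre (rep g) (B j)) (pre (rep g) (dyadic n (S1 j)))
        + (dm (pre (rep g) (dyadic n (S1 j))) (pre (rep g) (dyadic n (S2 j)))
        + (dm (pre (rep g) (dyadic n (S2 j))) (dyadic n (R2 j))
        + (dm (dyadic n (R2 j)) (dyadic n (R1 j)) + dm (dyadic n (R1 j)) (C j))))"
      by (intro order_trans[OF dm_triangle add_left_mono] pe B(1)[OF j] C(1)[OF j] dyadic_events dm_triangle)
    ultimately show "dm (pre (rep g) (B j)) (C j) < e"
      using 1 2 3 4 5 by linarith
  qed
qed

end

section \<open>The weak topology\<close>

context prob_space
begin

section \<open>The norm on square integrable functions\<close>

abbreviation "SI \<equiv> square_integrable M"

definition norm2 :: "('a \<Rightarrow> complex) \<Rightarrow> real" where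
  "norm2 f = sqrt (\<integral>x. (cmod (f x))\<^sup>2 \<partial>M)"

lemma SI_measurable: "f \<in> SI \<Longrightarrow> f \<in> borel_measurable M"
  and SI_integrable: "f \<in> SI \<Longrightarrow> integrable M (\<lambda>x. (cmod (f x))\<^sup>2)"
  by (auto simp: square_integrable_def)

lemma norm2_nonneg: "0 \<le> norm2 f"
  by (simp add: norm2_def)

lemma norm2_power2: "(norm2 f)\<^sup>2 = (\<integral>x. (cmod (f x))\<^sup>2 \<partial>M)"
  by (simp add: norm2_def)

lemma SI_add:
  assumes "f \<in> SI" "g \<in> SI"
  shows "(\<lambda>x. f x + g x) \<in> SI"
proof -
  have [measurable]: "f \<in> borel_measurable M" "g \<in> borel_measurable M" using assms SI_measurable by auto
  have bound: "(cmod (f x + g x))\<^sup>2 \<le> 2 * (cmod (f x))\<^sup>2 + 2 * (cmod (g x))\<^sup>2" for x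
  proof -
    have "(cmod (f x + g x))\<^sup>2 \<le> (cmod (f x) + cmod (g x))\<^sup>2"
      by (intro power_mono norm_triangle_ineq) simp
    also have "\<dots> \<le> 2 * (cmod (f x))\<^sup>2 + 2 * (cmod (g x))\<^sup>2"
      using sum_squares_bound[of "cmod (f x)" "cmod (g x)"] by (simp add: power2_sum)
    finally show ?thesis .
  qed
  have "integrable M (\<lambda>x. 2 * (cmod (f x))\<^sup>2 + 2 * (cmod (g x))\<^sup>2)"
    using SI_integrable[OF assms(1)] SI_integrable[OF assms(2)]
    by (intro Bochner_Integration.integrable_add integrable_mult_right)
  then have "integrable M (\<lambda>x. (cmod (f x + g x))\<^sup>2)"
  proof (rule Bochner_Integration.integrable_bound)
    show "AE x in M. norm ((cmod (f x + g x))\<^sup>2) \<le> norm (2 * (cmod (f x))\<^sup>2 + 2 * (cmod (g x))\<^sup>2)"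
      by (intro AE_I2) (simp add: bound)
  qed measurable
  then show ?thesis by (simp add: square_integrable_def)
qed

lemma SI_uminus: "f \<in> SI \<Longrightarrow> (\<lambda>x. - f x) \<in> SI"
  by (auto simp: square_integrable_def)

lemma SI_diff: "f \<in> SI \<Longrightarrow> g \<in> SI \<Longrightarrow> (\<lambda>x. f x - g x) \<in> SI"
  using SI_add[of f "\<lambda>x. - g x"] SI_uminus[of g] by simp

lemma SI_bounded:
  assumes "f \<in> borel_measurable M" "\<And>x. cmod (f x) \<le> C"
  shows "f \<in> SI"
proof -
  have "integrable M (\<lambda>x. (cmod (f x))\<^sup>2)"
  proof (rule integrable_const_bound[of _ "C\<^sup>2"])
    show "AE x in M. norm ((cmod (f x))\<^sup>2) \<le> C\<^sup>2"
      using assms(2) by (intro AE_I2) (simp add: power_mono)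
  qed (use assms(1) in measurable)
  then show ?thesis using assms(1) by (simp add: square_integrable_def)
qed

text \<open>The bound \<open>(s + t)^2 \<le> (a + b) * (s^2 / a + t^2 / b)\<close> is integrated
  with \<open>a\<close> and \<open>b\<close> just above the two norms; the added
  \<open>e / 2\<close> keeps the denominators positive.\<close>

lemma norm2_triangle:
  assumes f: "f \<in> SI" and g: "g \<in> SI"
  shows "norm2 (\<lambda>x. f x + g x) \<le> norm2 f + norm2 g"
proof (rule field_le_epsilon)
  fix e :: real assume "e > 0"
  define a where "a = norm2 f + e / 2"
  define b where "b = norm2 g + e / 2"
  have ab: "a > 0" "b > 0" using norm2_nonneg \<open>e > 0\<close> by (auto simp: a_def b_def add_nonneg_pos)
  have bound: "(cmod (f x + g x))\<^sup>2 \<le> (a + b) * ((cmod (f x))\<^sup>2 / a + (cmod (g x))\<^sup>2 / b)" for x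
  proof -
    have "(s + t)\<^sup>2 \<le> (a + b) * (s\<^sup>2 / a + t\<^sup>2 / b)" for s t :: real
    proof -
      have "(a + b) * (s\<^sup>2 / a + t\<^sup>2 / b) - (s + t)\<^sup>2 = (b * s - a * t)\<^sup>2 / (a * b)"
        using ab by (simp add: field_simps power2_eq_square)
      moreover have "(b * s - a * t)\<^sup>2 / (a * b) \<ge> 0" using ab by simp
      ultimately show ?thesis by linarith
    qed
    moreover have "(cmod (f x + g x))\<^sup>2 \<le> (cmod (f x) + cmod (g x))\<^sup>2"
      by (intro power_mono norm_triangle_ineq) simp
    ultimately show ?thesis by (meson order_trans)
  qed
  have "(norm2 (\<lambda>x. f x + g x))\<^sup>2 \<le> (\<integral>x. (a + b) * ((cmod (f x))\<^sup>2 / a + (cmod (g x))\<^sup>2 / b) \<partial>M)"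
    unfolding norm2_power2
    using SI_integrable[OF SI_add[OF f g]] SI_integrable[OF f] SI_integrable[OF g]
    by (intro integral_mono bound) auto
  also have "\<dots> = (a + b) * ((norm2 f)\<^sup>2 / a + (norm2 g)\<^sup>2 / b)"
    using SI_integrable[OF f] SI_integrable[OF g] by (simp add: norm2_power2)
  also have "\<dots> \<le> (a + b) * (a + b)"
  proof (intro mult_left_mono add_mono)
    have "(norm2 f)\<^sup>2 \<le> a\<^sup>2" "(norm2 g)\<^sup>2 \<le> b\<^sup>2"
      using norm2_nonneg \<open>e > 0\<close> by (auto simp: a_def b_def intro!: power_mono)
    then show "(norm2 f)\<^sup>2 / a \<le> a" "(norm2 g)\<^sup>2 / b \<le> b"
      using ab by (simp_all add: divide_le_eq power2_eq_square)
  qed (use ab in auto)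
  finally have "norm2 (\<lambda>x. f x + g x) \<le> a + b"
    using ab norm2_nonneg by (simp add: power2_eq_square[symmetric] power2_le_iff_abs_le)
  then show "norm2 (\<lambda>x. f x + g x) \<le> norm2 f + norm2 g + e" by (simp add: a_def b_def)
qed

text \<open>The inequality between arithmetic and geometric mean, applied to \<open>t\<close> and
  \<open>(cmod (f x))^2 / t\<close>, is integrated over total mass one with \<open>t\<close> just
  above the norm.\<close>

lemma norm1_le_norm2:
  assumes f: "f \<in> SI"
  shows "integrable M (\<lambda>x. cmod (f x))" "(\<integral>x. cmod (f x) \<partial>M) \<le> norm2 f"
proof -
  have [measurable]: "f \<in> borel_measurable M" using f SI_measurable by auto
  have bound: "cmod (f x) \<le> (t + (cmod (f x))\<^sup>2 / t) / 2" if "t > 0" for t x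
  proof -
    have "(t + (cmod (f x))\<^sup>2 / t) / 2 - cmod (f x) = (t - cmod (f x))\<^sup>2 / (2 * t)"
      using that by (simp add: field_simps power2_eq_square)
    moreover have "(t - cmod (f x))\<^sup>2 / (2 * t) \<ge> 0" using that by simp
    ultimately show ?thesis by linarith
  qed
  have int: "integrable M (\<lambda>x. (t + (cmod (f x))\<^sup>2 / t) / 2)" for t
    using SI_integrable[OF f] by simp
  show i: "integrable M (\<lambda>x. cmod (f x))"
  proof (rule Bochner_Integration.integrable_bound[OF int[of 1]])
    show "AE x in M. norm (cmod (f x)) \<le> norm ((1 + (cmod (f x))\<^sup>2 / 1) / 2)"
      using bound[of 1] by (intro AE_I2) simp
  qed measurable
  show "(\<integral>x. cmod (f x) \<partial>M) \<le> norm2 f"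
  proof (rule field_le_epsilon)
    fix e :: real assume "e > 0"
    define t where "t = norm2 f + e"
    have t: "t > 0" using norm2_nonneg[of f] \<open>e > 0\<close> by (simp add: t_def add_nonneg_pos)
    have "(\<integral>x. cmod (f x) \<partial>M) \<le> (\<integral>x. (t + (cmod (f x))\<^sup>2 / t) / 2 \<partial>M)"
      by (intro integral_mono i int bound t)
    also have "\<dots> = (t + (norm2 f)\<^sup>2 / t) / 2"
      using SI_integrable[OF f] by (simp add: norm2_power2 prob_space)
    also have "\<dots> \<le> t"
    proof -
      have "(norm2 f)\<^sup>2 \<le> t\<^sup>2"
        using norm2_nonneg[of f] \<open>e > 0\<close> by (auto simp: t_def intro!: power_mono)
      then have "(norm2 f)\<^sup>2 / t \<le> t" using t by (simp add: divide_le_eq power2_eq_square)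
      then show ?thesis by simp
    qed
    finally show "(\<integral>x. cmod (f x) \<partial>M) \<le> norm2 f + e" by (simp add: t_def)
  qed
qed

lemma norm2_cong_AE:
  assumes "f \<in> borel_measurable M" "g \<in> borel_measurable M" "AE x in M. f x = g x"
  shows "norm2 f = norm2 g"
  unfolding norm2_def
  by (intro arg_cong[where f = sqrt] integral_cong_AE) (use assms in auto)

definition cl2 :: "('a \<Rightarrow> complex) \<Rightarrow> ('a \<Rightarrow> complex) set" where
  "cl2 f = ae_rel M SI `` {f}"

lemma cl2_L2: "f \<in> SI \<Longrightarrow> cl2 f \<in> L2 M"
  by (simp add: L2_def cl2_def quotientI)

lemma cl2_eq_iff: "f \<in> SI \<Longrightarrow> g \<in> SI \<Longrightarrow> cl2 f = cl2 g \<longleftrightarrow> (AE x in M. f x = g x)"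
  unfolding cl2_def by (rule ae_rel_class_eq_iff)

lemma L2_cases: assumes "\<xi> \<in> L2 M" obtains f where "f \<in> SI" "\<xi> = cl2 f"
  using ae_rel_SOME[of \<xi> SI M] assms by (metis L2_def cl2_def)

lemma L2_dist_cl2:
  assumes f: "f \<in> SI" and g: "g \<in> SI"
  shows "L2_dist M (cl2 f) (cl2 g) = norm2 (\<lambda>x. f x - g x)"
proof -
  define f' where "f' = (SOME h. h \<in> cl2 f)"
  define g' where "g' = (SOME h. h \<in> cl2 g)"
  have f': "f' \<in> SI" "cl2 f' = cl2 f" and g': "g' \<in> SI" "cl2 g' = cl2 g"
    using ae_rel_SOME[of "cl2 f" SI M] ae_rel_SOME[of "cl2 g" SI M] cl2_L2[OF f] cl2_L2[OF g]
    by (simp_all add: f'_def g'_def L2_def cl2_def)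
  have "AE x in M. f' x = f x" "AE x in M. g' x = g x"
    using f' g' f g cl2_eq_iff by blast+
  then have "AE x in M. f' x - g' x = f x - g x" by eventually_elim simp
  then have "norm2 (\<lambda>x. f' x - g' x) = norm2 (\<lambda>x. f x - g x)"
    by (intro norm2_cong_AE SI_measurable SI_diff f' g' f g)
  then show ?thesis by (simp add: L2_dist_def norm2_def f'_def g'_def)
qed

lemma norm2_eq_0_iff: "f \<in> SI \<Longrightarrow> norm2 f = 0 \<longleftrightarrow> (AE x in M. f x = 0)"
  unfolding norm2_def using integral_nonneg_eq_0_iff_AE[OF SI_integrable] by simp

lemma norm2_minus: "norm2 (\<lambda>x. f x - g x) = norm2 (\<lambda>x. g x - f x)"
  by (simp add: norm2_def norm_minus_commute)

lemma Metric_space_L2: "Metric_space (L2 M) (L2_dist M)"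
proof
  fix \<xi> \<eta> :: "('a \<Rightarrow> complex) set"
  show "0 \<le> L2_dist M \<xi> \<eta>" by (simp add: L2_dist_def)
  show "L2_dist M \<xi> \<eta> = L2_dist M \<eta> \<xi>" by (simp add: L2_dist_def norm_minus_commute)
next
  fix \<xi> \<eta> assume "\<xi> \<in> L2 M" "\<eta> \<in> L2 M"
  then obtain f g where fg: "f \<in> SI" "\<xi> = cl2 f" "g \<in> SI" "\<eta> = cl2 g" by (meson L2_cases)
  show "L2_dist M \<xi> \<eta> = 0 \<longleftrightarrow> \<xi> = \<eta>"
    using fg norm2_eq_0_iff[OF SI_diff[OF fg(1,3)]] by (simp add: L2_dist_cl2 cl2_eq_iff)
next
  fix \<xi> \<eta> \<zeta> assume "\<xi> \<in> L2 M" "\<eta> \<in> L2 M" "\<zeta> \<in> L2 M"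
  then obtain f g h where fg: "f \<in> SI" "\<xi> = cl2 f" "g \<in> SI" "\<eta> = cl2 g" "h \<in> SI" "\<zeta> = cl2 h"
    by (meson L2_cases)
  show "L2_dist M \<xi> \<zeta> \<le> L2_dist M \<xi> \<eta> + L2_dist M \<eta> \<zeta>"
    using norm2_triangle[OF SI_diff[OF fg(1,3)] SI_diff[OF fg(3,5)]] fg by (simp add: L2_dist_cl2)
qed

section \<open>The Koopman representation by isometries\<close>

lemma norm2_comp:
  assumes u: "u \<in> measurable M M" "distr M M u = M" and f: "f \<in> SI"
  shows "(\<lambda>x. f (u x)) \<in> SI" "norm2 (\<lambda>x. f (u x)) = norm2 f"
proof -
  have m: "(\<lambda>x. (cmod (f x))\<^sup>2) \<in> borel_measurable M" using SI_measurable[OF f] by measurable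
  have fu: "(\<lambda>x. f (u x)) \<in> borel_measurable M" using measurable_compose[OF u(1) SI_measurable[OF f]] .
  have "integrable M (\<lambda>x. (cmod (f (u x)))\<^sup>2)"
    using integrable_distr_eq[OF u(1) m] u(2) SI_integrable[OF f] by simp
  then show "(\<lambda>x. f (u x)) \<in> SI" using fu by (simp add: square_integrable_def)
  show "norm2 (\<lambda>x. f (u x)) = norm2 f"
    unfolding norm2_def using integral_distr[OF u(1) m] u(2) by simp
qed

text \<open>The representative of the inverse class, which agrees almost everywhere with the inverse
  of the representative; the Koopman operator composes with it.\<close>

abbreviation rinv :: "('a \<Rightarrow> 'a) set \<Rightarrow> 'a \<Rightarrow> 'a" where
  "rinv g \<equiv> rep (inv\<^bsub>Aut M\<^esub> g)"

lemma rinv_measurable: "g \<in> carrier (Aut M) \<Longrightarrow> rinv g \<in> measurable M M"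
  and rinv_distr: "g \<in> carrier (Aut M) \<Longrightarrow> distr M M (rinv g) = M"
  using trD[OF rep_tr[OF group.inv_closed[OF group_Aut]]] by auto

text \<open>Another representative of the automorphism or of the function changes the composition on
  a null set only, so the union that defines the Koopman operator is a union of equal
  classes.\<close>

lemma Koopman_cl2:
  assumes g: "g \<in> carrier (Aut M)" and f: "f \<in> SI"
  shows "Koopman M g (cl2 f) = cl2 (\<lambda>x. f (rinv g x))"
proof -
  have fr: "(\<lambda>x. f (rinv g x)) \<in> SI" by (rule norm2_comp(1)[OF rinv_measurable[OF g] rinv_distr[OF g] f])
  have eq: "cl2 (f' \<circ> inv_into (space M) t) = cl2 (\<lambda>x. f (rinv g x))" if t: "t \<in> g" and f': "f' \<in> cl2 f" for t f'
  proof -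
    have tt: "t \<in> tr" "cls t = g"
    proof -
      have "t \<in> cls (rep g)" using t cls_rep[OF g] by simp
      then have *: "t \<in> tr" "AE x in M. rep g x = t x" unfolding cls_def ae_rel_class_mem by blast+
      then show "t \<in> tr" "cls t = g" using cls_eq_iff[OF rep_tr[OF g], of t] cls_rep[OF g] by auto
    qed
    have f'': "f' \<in> SI" "AE x in M. f x = f' x" using f' unfolding cl2_def ae_rel_class_mem by blast+
    note it = tr_inv[OF tt(1)]
    have "AE x in M. rinv g x = inv_into (space M) t x"
      using rep_cls[OF it] inv_cls[OF tt(1)] tt(2) by simp
    moreover have "AE x in M. f (inv_into (space M) t x) = f' (inv_into (space M) t x)"
      by (rule tr_AE[OF it f''(2)])
    ultimately have "AE x in M. (f' \<circ> inv_into (space M) t) x = f (rinv g x)"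
      by eventually_elim simp
    moreover have "(f' \<circ> inv_into (space M) t) \<in> SI"
      using norm2_comp(1)[OF trD(2)[OF it] trD(4)[OF it] f''(1)] by (simp add: o_def)
    ultimately show ?thesis using cl2_eq_iff fr by blast
  qed
  have ne: "rep g \<in> g" "f \<in> cl2 f"
  proof -
    have "rep g \<in> cls (rep g)" unfolding cls_def ae_rel_class_mem using rep_tr[OF g] by simp
    then show "rep g \<in> g" using cls_rep[OF g] by simp
    show "f \<in> cl2 f" unfolding cl2_def ae_rel_class_mem using f by simp
  qed
  have "(\<Union>t\<in>g. \<Union>f'\<in>cl2 f. cl2 (f' \<circ> inv_into (space M) t)) = cl2 (\<lambda>x. f (rinv g x))"
    using eq ne by blast
  then show ?thesis using cl2_L2[OF f] by (simp add: Koopman_def cl2_def)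
qed

lemma Koopman_L2: "g \<in> carrier (Aut M) \<Longrightarrow> \<xi> \<in> L2 M \<Longrightarrow> Koopman M g \<xi> \<in> L2 M"
  by (metis L2_cases Koopman_cl2 cl2_L2 norm2_comp(1) rinv_measurable rinv_distr)

lemma Koopman_mult:
  assumes g: "g \<in> carrier (Aut M)" and h: "h \<in> carrier (Aut M)" and \<xi>: "\<xi> \<in> L2 M"
  shows "Koopman M (g \<otimes>\<^bsub>Aut M\<^esub> h) \<xi> = Koopman M g (Koopman M h \<xi>)"
proof -
  obtain f where f: "f \<in> SI" "\<xi> = cl2 f" using \<xi> by (rule L2_cases)
  have gh: "g \<otimes>\<^bsub>Aut M\<^esub> h \<in> carrier (Aut M)" using group_Aut g h by (simp add: group.is_monoid monoid.m_closed)
  have fh: "(\<lambda>x. f (rinv h x)) \<in> SI" by (rule norm2_comp(1)[OF rinv_measurable[OF h] rinv_distr[OF h] f(1)])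
  have "inv\<^bsub>Aut M\<^esub> (g \<otimes>\<^bsub>Aut M\<^esub> h) = inv\<^bsub>Aut M\<^esub> h \<otimes>\<^bsub>Aut M\<^esub> inv\<^bsub>Aut M\<^esub> g"
    by (rule group.inv_mult_group[OF group_Aut g h])
  then have "AE x in M. rinv (g \<otimes>\<^bsub>Aut M\<^esub> h) x = rinv h (rinv g x)"
    using rep_mult[OF group.inv_closed[OF group_Aut h] group.inv_closed[OF group_Aut g]] by simp
  then have "AE x in M. f (rinv (g \<otimes>\<^bsub>Aut M\<^esub> h) x) = f (rinv h (rinv g x))" by eventually_elim simp
  then show ?thesis
    unfolding f(2) Koopman_cl2[OF gh f(1)] Koopman_cl2[OF h f(1)] Koopman_cl2[OF g fh]
    using norm2_comp(1)[OF rinv_measurable[OF gh] rinv_distr[OF gh] f(1)]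
      norm2_comp(1)[OF rinv_measurable[OF g] rinv_distr[OF g] fh]
    by (simp add: cl2_eq_iff)
qed

lemma Koopman_one:
  assumes "\<xi> \<in> L2 M" shows "Koopman M \<one>\<^bsub>Aut M\<^esub> \<xi> = \<xi>"
proof -
  obtain f where f: "f \<in> SI" "\<xi> = cl2 f" using assms by (rule L2_cases)
  have o: "\<one>\<^bsub>Aut M\<^esub> \<in> carrier (Aut M)" "inv\<^bsub>Aut M\<^esub> \<one>\<^bsub>Aut M\<^esub> = \<one>\<^bsub>Aut M\<^esub>"
    using group_Aut by (simp_all add: group.is_monoid monoid.one_closed monoid.inv_one)
  have "AE x in M. f (rinv \<one>\<^bsub>Aut M\<^esub> x) = f x"
    unfolding o(2) using rep_one by eventually_elim simp
  then show ?thesis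
    unfolding f(2) Koopman_cl2[OF o(1) f(1)]
    using norm2_comp(1)[OF rinv_measurable[OF o(1)] rinv_distr[OF o(1)] f(1)] f(1)
    by (simp add: cl2_eq_iff)
qed

lemma Koopman_isometry:
  assumes g: "g \<in> carrier (Aut M)" and "\<xi> \<in> L2 M" "\<eta> \<in> L2 M"
  shows "L2_dist M (Koopman M g \<xi>) (Koopman M g \<eta>) = L2_dist M \<xi> \<eta>"
proof -
  obtain f h where f: "f \<in> SI" "\<xi> = cl2 f" and h: "h \<in> SI" "\<eta> = cl2 h"
    using assms(2,3) by (meson L2_cases)
  note u = rinv_measurable[OF g] rinv_distr[OF g]
  show ?thesis
    unfolding f(2) h(2) Koopman_cl2[OF g f(1)] Koopman_cl2[OF g h(1)]
      L2_dist_cl2[OF f(1) h(1)] L2_dist_cl2[OF norm2_comp(1)[OF u f(1)] norm2_comp(1)[OF u h(1)]]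
    by (rule norm2_comp(2)[OF u SI_diff[OF f(1) h(1)]])
qed

section \<open>Continuity of multiplication and neighbourhoods of the identity\<close>

lemma topspace_L2_topology: "topspace (L2_topology M) = L2 M"
  unfolding L2_topology_def using Metric_space.topspace_mtopology[OF Metric_space_L2] .

lemma topspace_weak_topology: "topspace (weak_topology M) = carrier (Aut M)"
proof -
  have "Koopman M g \<in> (\<Pi>\<^sub>E \<xi>\<in>L2 M. L2 M)" if "g \<in> carrier (Aut M)" for g
    using Koopman_L2[OF that] by (auto simp: PiE_iff Koopman_def)
  then show ?thesis
    unfolding weak_topology_def topspace_pullback_topology topspace_product_topology topspace_L2_topology
    by blast
qed

lemma continuous_map_Koopman:
  assumes "\<xi> \<in> L2 M"
  shows "continuous_map (weak_topology M) (L2_topology M) (\<lambda>g. Koopman M g \<xi>)"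
  using continuous_map_pullback[OF continuous_map_product_projection[OF assms, of "\<lambda>_. L2_topology M"],
      of "carrier (Aut M)" "Koopman M"]
  by (simp add: weak_topology_def o_def)

lemma continuous_map_into_weak_topology:
  assumes "\<And>x. x \<in> topspace X \<Longrightarrow> \<phi> x \<in> carrier (Aut M)"
    and "\<And>\<xi>. \<xi> \<in> L2 M \<Longrightarrow> continuous_map X (L2_topology M) (\<lambda>x. Koopman M (\<phi> x) \<xi>)"
  shows "continuous_map X (weak_topology M) \<phi>"
  unfolding weak_topology_def
proof (rule continuous_map_pullback')
  show "continuous_map X (product_topology (\<lambda>_. L2_topology M) (L2 M)) (Koopman M \<circ> \<phi>)"
    unfolding continuous_map_componentwise using assms(2) by (auto simp: Koopman_def o_def)
  show "topspace X \<subseteq> \<phi> -` carrier (Aut M)" using assms(1) by blast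
qed

lemma openin_L2_ball:
  "\<xi> \<in> L2 M \<Longrightarrow> openin (L2_topology M) {\<eta> \<in> L2 M. L2_dist M \<xi> \<eta> < r}"
  using Metric_space.openin_mball[OF Metric_space_L2, of \<xi> r]
  unfolding L2_topology_def Metric_space.mball_def[OF Metric_space_L2] by simp

text \<open>Evaluating \<open>x \<otimes> a\<close> at \<xi> is evaluating \<open>x\<close> at
  another vector, namely \<open>Koopman M a \<xi>\<close>.\<close>

lemma weak_continuous_right_mult:
  assumes a: "a \<in> carrier (Aut M)"
  shows "continuous_map (weak_topology M) (weak_topology M) (\<lambda>x. x \<otimes>\<^bsub>Aut M\<^esub> a)"
proof (rule continuous_map_into_weak_topology)
  fix x assume "x \<in> topspace (weak_topology M)"
  then show "x \<otimes>\<^bsub>Aut M\<^esub> a \<in> carrier (Aut M)"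
    using a group_Aut by (simp add: topspace_weak_topology group.is_monoid monoid.m_closed)
next
  fix \<xi> assume \<xi>: "\<xi> \<in> L2 M"
  show "continuous_map (weak_topology M) (L2_topology M) (\<lambda>x. Koopman M (x \<otimes>\<^bsub>Aut M\<^esub> a) \<xi>)"
    by (rule continuous_map_eq[OF continuous_map_Koopman[OF Koopman_L2[OF a \<xi>]]])
      (simp add: topspace_weak_topology Koopman_mult[OF _ a \<xi>])
qed

text \<open>Evaluating \<open>a \<otimes> x\<close> at \<xi> is applying the isometry
  \<open>Koopman M a\<close> to the value of \<open>x\<close> at \<xi>.\<close>

lemma weak_continuous_left_mult:
  assumes a: "a \<in> carrier (Aut M)"
  shows "continuous_map (weak_topology M) (weak_topology M) (\<lambda>x. a \<otimes>\<^bsub>Aut M\<^esub> x)"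
proof (rule continuous_map_into_weak_topology)
  fix x assume "x \<in> topspace (weak_topology M)"
  then show "a \<otimes>\<^bsub>Aut M\<^esub> x \<in> carrier (Aut M)"
    using a group_Aut by (simp add: topspace_weak_topology group.is_monoid monoid.m_closed)
next
  fix \<xi> assume \<xi>: "\<xi> \<in> L2 M"
  have "continuous_map (L2_topology M) (L2_topology M) (Koopman M a)"
    unfolding L2_topology_def
  proof (subst Metric_space.continuous_map_to_metric[OF Metric_space_L2], intro ballI allI impI)
    fix \<eta> and e :: real assume "\<eta> \<in> topspace (Metric_space.mtopology (L2 M) (L2_dist M))" and e: "e > 0"
    then have \<eta>: "\<eta> \<in> L2 M" using topspace_L2_topology unfolding L2_topology_def by simp
    show "\<exists>U. openin (Metric_space.mtopology (L2 M) (L2_dist M)) U \<and> \<eta> \<in> U \<and>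
        (\<forall>\<zeta>\<in>U. Koopman M a \<zeta> \<in> Metric_space.mball (L2 M) (L2_dist M) (Koopman M a \<eta>) e)"
    proof (intro exI[of _ "{\<zeta> \<in> L2 M. L2_dist M \<eta> \<zeta> < e}"] conjI ballI)
      show "openin (Metric_space.mtopology (L2 M) (L2_dist M)) {\<zeta> \<in> L2 M. L2_dist M \<eta> \<zeta> < e}"
        using openin_L2_ball[OF \<eta>] unfolding L2_topology_def .
      have "L2_dist M \<eta> \<eta> = 0" using Metric_space.mdist_zero[OF Metric_space_L2 \<eta>] .
      then show "\<eta> \<in> {\<zeta> \<in> L2 M. L2_dist M \<eta> \<zeta> < e}" using \<eta> e by simp
    next
      fix \<zeta> assume "\<zeta> \<in> {\<zeta> \<in> L2 M. L2_dist M \<eta> \<zeta> < e}"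
      then show "Koopman M a \<zeta> \<in> Metric_space.mball (L2 M) (L2_dist M) (Koopman M a \<eta>) e"
        using \<eta> a Koopman_L2 Koopman_isometry
        unfolding Metric_space.mball_def[OF Metric_space_L2] by simp
    qed
  qed
  from continuous_map_compose[OF continuous_map_Koopman[OF \<xi>] this]
  show "continuous_map (weak_topology M) (L2_topology M) (\<lambda>x. Koopman M (a \<otimes>\<^bsub>Aut M\<^esub> x) \<xi>)"
    by (rule continuous_map_eq) (simp add: topspace_weak_topology Koopman_mult[OF a _ \<xi>])
qed

lemma weak_neighbourhood_of_one:
  assumes U: "openin (weak_topology M) U" "\<one>\<^bsub>Aut M\<^esub> \<in> U"
  obtains \<Xi> r where "finite \<Xi>" "\<Xi> \<subseteq> L2 M" "r > 0"
    "\<forall>g\<in>carrier (Aut M). (\<forall>\<xi>\<in>\<Xi>. L2_dist M \<xi> (Koopman M g \<xi>) < r) \<longrightarrow> g \<in> U"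
proof -
  let ?P = "product_topology (\<lambda>_. L2_topology M) (L2 M)"
  obtain W where W: "openin ?P W" "U = Koopman M -` W \<inter> carrier (Aut M)"
    using U(1) unfolding weak_topology_def openin_pullback_topology by blast
  have "Koopman M \<one>\<^bsub>Aut M\<^esub> \<in> W" using U(2) W(2) by blast
  then obtain V where V: "finite {\<xi> \<in> L2 M. V \<xi> \<noteq> topspace (L2_topology M)}"
    "\<And>\<xi>. \<xi> \<in> L2 M \<Longrightarrow> openin (L2_topology M) (V \<xi>)"
    "Koopman M \<one>\<^bsub>Aut M\<^esub> \<in> PiE (L2 M) V" "PiE (L2 M) V \<subseteq> W"
    using W(1) unfolding openin_product_topology_alt by meson
  define \<Xi> where "\<Xi> = {\<xi> \<in> L2 M. V \<xi> \<noteq> topspace (L2_topology M)}"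
  have \<Xi>: "finite \<Xi>" "\<Xi> \<subseteq> L2 M" using V(1) by (auto simp: \<Xi>_def)
  have "\<exists>r>0. \<forall>\<eta>\<in>L2 M. L2_dist M \<xi> \<eta> < r \<longrightarrow> \<eta> \<in> V \<xi>" if \<xi>: "\<xi> \<in> L2 M" for \<xi>
  proof -
    have "\<xi> \<in> V \<xi>" using V(3) \<xi> Koopman_one[OF \<xi>] by (metis PiE_mem)
    then obtain r where "r > 0" "Metric_space.mball (L2 M) (L2_dist M) \<xi> r \<subseteq> V \<xi>"
      using V(2)[OF \<xi>] unfolding L2_topology_def Metric_space.openin_mtopology[OF Metric_space_L2] by blast
    then show ?thesis using \<xi> unfolding Metric_space.mball_def[OF Metric_space_L2] by blast
  qed
  then obtain r where r: "\<And>\<xi>. \<xi> \<in> L2 M \<Longrightarrow> r \<xi> > 0"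
    "\<And>\<xi> \<eta>. \<xi> \<in> L2 M \<Longrightarrow> \<eta> \<in> L2 M \<Longrightarrow> L2_dist M \<xi> \<eta> < r \<xi> \<Longrightarrow> \<eta> \<in> V \<xi>" by metis
  \<comment> \<open>The inserted 1 covers the case that no coordinate is restricted.\<close>
  define s where "s = Min (insert 1 (r ` \<Xi>))"
  have s: "s > 0" "\<And>\<xi>. \<xi> \<in> \<Xi> \<Longrightarrow> s \<le> r \<xi>"
    using \<Xi> r(1) by (auto simp: s_def subset_iff)
  show thesis
  proof (rule that[OF \<Xi> s(1)], intro ballI impI)
    fix g assume g: "g \<in> carrier (Aut M)" and close: "\<forall>\<xi>\<in>\<Xi>. L2_dist M \<xi> (Koopman M g \<xi>) < s"
    have "Koopman M g \<xi> \<in> V \<xi>" if \<xi>: "\<xi> \<in> L2 M" for \<xi>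
    proof (cases "\<xi> \<in> \<Xi>")
      case True
      then have "L2_dist M \<xi> (Koopman M g \<xi>) < r \<xi>" using close s(2)[OF True] by fastforce
      then show ?thesis by (rule r(2)[OF \<xi> Koopman_L2[OF g \<xi>]])
    next
      case False
      then have "V \<xi> = L2 M" using \<xi> by (simp add: \<Xi>_def topspace_L2_topology)
      then show ?thesis using Koopman_L2[OF g \<xi>] by simp
    qed
    then have "Koopman M g \<in> PiE (L2 M) V" by (auto simp: PiE_iff Koopman_def)
    then show "g \<in> U" using V(4) W(2) g by blast
  qed
qed

end

section \<open>Neighbourhoods of the identity in terms of dyadic cells\<close>

context uniform_chart
begin

text \<open>Pulling both sets back along \<open>w\<close> preserves their distance and turns
  \<open>h w\<inverse>\<close> into \<open>h\<close>.\<close>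

lemma dm_pre_mult_inv:
  assumes h: "h \<in> carrier (Aut M)" and w: "w \<in> carrier (Aut M)" and A: "A \<in> events"
  shows "dm (pre (rep (h \<otimes>\<^bsub>Aut M\<^esub> inv\<^bsub>Aut M\<^esub> w)) A) A = dm (pre (rep h) A) (pre (rep w) A)"
proof -
  interpret A: group "Aut M" by (rule group_Aut)
  let ?u = "h \<otimes>\<^bsub>Aut M\<^esub> inv\<^bsub>Aut M\<^esub> w"
  have u: "?u \<in> carrier (Aut M)" using h w by simp
  note pu = pre_events[OF rep_measurable[OF u] A]
  note ww = rep_measurable[OF w] rep_distr[OF w]
  have "?u \<otimes>\<^bsub>Aut M\<^esub> w = h" using h w by (simp add: A.m_assoc)
  then have "AE x in M. rep h x = rep ?u (rep w x)"
    using rep_mult[OF u w] by simp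
  then have "AE x in M. x \<in> pre (rep w) (pre (rep ?u) A) \<longleftrightarrow> x \<in> pre (rep h) A"
    using AE_space by eventually_elim (use measurable_space[OF ww(1)] in auto)
  then have "dm (pre (rep w) (pre (rep ?u) A)) (pre (rep w) A) = dm (pre (rep h) A) (pre (rep w) A)"
    by (intro dm_cong_AE pre_events[OF ww(1)] pu pre_events[OF rep_measurable[OF h]] A) auto
  then show ?thesis by (simp only: dm_pre[OF ww pu A])
qed

lemma dm_pre_inv:
  assumes g: "g \<in> carrier (Aut M)" and A: "A \<in> events"
  shows "dm (pre (rinv g) A) A = dm (pre (rep g) A) A"
proof -
  interpret A: group "Aut M" by (rule group_Aut)
  have "dm (pre (rep (\<one>\<^bsub>Aut M\<^esub> \<otimes>\<^bsub>Aut M\<^esub> inv\<^bsub>Aut M\<^esub> g)) A) A = dm (pre (rep \<one>\<^bsub>Aut M\<^esub>) A) (pre (rep g) A)"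
    by (rule dm_pre_mult_inv[OF A.one_closed g A])
  also have "\<dots> = dm A (pre (rep g) A)"
  proof (rule dm_cong_AE)
    show "AE x in M. x \<in> pre (rep \<one>\<^bsub>Aut M\<^esub>) A \<longleftrightarrow> x \<in> A"
      using rep_one AE_space by eventually_elim simp
  qed (use g A in \<open>auto intro!: pre_events rep_measurable\<close>)
  finally show ?thesis using g by (simp add: dm_commute)
qed

abbreviation moves_cells :: "nat \<Rightarrow> real \<Rightarrow> ('a \<Rightarrow> 'a) set \<Rightarrow> bool" where
  "moves_cells n \<delta> g \<equiv> \<forall>k<2 ^ n. dm (pre (rep g) (dyadic n {k})) (dyadic n {k}) < \<delta>"

text \<open>Every neighbourhood of the identity contains a set \<open>{g. moves_cells n \<delta> g}\<close>, so
  \<open>near_one\<close> holds for all neighbourhoods of the identity.\<close>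

definition near_one :: "(('a \<Rightarrow> 'a) set \<Rightarrow> bool) \<Rightarrow> bool" where
  "near_one P \<longleftrightarrow> (\<exists>n0. \<forall>n\<ge>n0. \<exists>\<delta>>0. \<forall>g\<in>carrier (Aut M). moves_cells n \<delta> g \<longrightarrow> P g)"

lemma near_one_mono:
  assumes "near_one P" "\<And>g. g \<in> carrier (Aut M) \<Longrightarrow> P g \<Longrightarrow> Q g"
  shows "near_one Q"
proof -
  obtain n0 where n0: "\<And>n. n \<ge> n0 \<Longrightarrow> \<exists>\<delta>>0. \<forall>g\<in>carrier (Aut M). moves_cells n \<delta> g \<longrightarrow> P g"
    using assms(1) unfolding near_one_def by blast
  show ?thesis
    unfolding near_one_def
  proof (intro exI[of _ n0] allI impI)
    fix n assume "n \<ge> n0"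
    then obtain \<delta> where "\<delta> > 0" "\<forall>g\<in>carrier (Aut M). moves_cells n \<delta> g \<longrightarrow> P g"
      using n0 by blast
    then show "\<exists>\<delta>>0. \<forall>g\<in>carrier (Aut M). moves_cells n \<delta> g \<longrightarrow> Q g"
      using assms(2) by (intro exI[of _ \<delta>]) simp
  qed
qed

lemma near_one_True: "near_one (\<lambda>g. True)"
  unfolding near_one_def by (intro exI[of _ 0] allI impI exI[of _ 1]) simp

text \<open>Both properties are available at every large level, so a common level exists and the
  smaller threshold serves for both.\<close>

lemma near_one_conj:
  assumes "near_one P" "near_one Q"
  shows "near_one (\<lambda>g. P g \<and> Q g)"
proof -
  obtain n0 where n0: "\<And>n. n \<ge> n0 \<Longrightarrow> \<exists>\<delta>>0. \<forall>g\<in>carrier (Aut M). moves_cells n \<delta> g \<longrightarrow> P g"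
    using assms(1) unfolding near_one_def by blast
  obtain n1 where n1: "\<And>n. n \<ge> n1 \<Longrightarrow> \<exists>\<delta>>0. \<forall>g\<in>carrier (Aut M). moves_cells n \<delta> g \<longrightarrow> Q g"
    using assms(2) unfolding near_one_def by blast
  show ?thesis
    unfolding near_one_def
  proof (intro exI[of _ "max n0 n1"] allI impI)
    fix n assume n: "n \<ge> max n0 n1"
    obtain \<delta> where d: "\<delta> > 0" "\<forall>g\<in>carrier (Aut M). moves_cells n \<delta> g \<longrightarrow> P g"
      using n0[of n] n by auto
    obtain \<delta>' where d': "\<delta>' > 0" "\<forall>g\<in>carrier (Aut M). moves_cells n \<delta>' g \<longrightarrow> Q g"
      using n1[of n] n by auto
    show "\<exists>\<delta>>0. \<forall>g\<in>carrier (Aut M). moves_cells n \<delta> g \<longrightarrow> P g \<and> Q g"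
      using d d' by (intro exI[of _ "min \<delta> \<delta>'"]) simp
  qed
qed

lemma near_one_ball:
  assumes "finite I" "\<And>i. i \<in> I \<Longrightarrow> near_one (P i)"
  shows "near_one (\<lambda>g. \<forall>i\<in>I. P i g)"
  using assms
proof (induction I rule: finite_induct)
  case empty
  show ?case using near_one_True by simp
next
  case (insert i I)
  have "near_one (\<lambda>g. P i g \<and> (\<forall>i\<in>I. P i g))"
    by (intro near_one_conj insert.IH insert.prems) auto
  then show ?case by simp
qed

text \<open>A union of at most \<open>2 ^ n\<close> cells approximates \<open>A\<close> within
  \<open>e / 4\<close>. If each cell moves by less than \<open>e / (4 * 2 ^ n)\<close>, the union
  moves by at most \<open>e / 4\<close>, and \<open>A\<close> by less than three such
  quarters.\<close>

lemma near_one_event: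
  assumes A: "A \<in> events" and e: "e > 0"
  shows "near_one (\<lambda>g. dm (pre (rep g) A) A < e)"
proof -
  have "e / 4 > 0" using e by simp
  then obtain n0 where n0: "\<And>n. n \<ge> n0 \<Longrightarrow> \<exists>S. S \<subseteq> {..<2 ^ n} \<and> dm A (dyadic n S) < e / 4"
    using dyadic_approximation[OF A] by blast
  show ?thesis
    unfolding near_one_def
  proof (intro exI[of _ n0] allI impI)
    fix n assume "n \<ge> n0"
    then obtain S where S: "S \<subseteq> {..<2 ^ n}" "dm A (dyadic n S) < e / 4" using n0 by blast
    have fS: "finite S" using S(1) finite_subset by blast
    have cS: "real (card S) \<le> 2 ^ n"
    proof -
      have "card S \<le> 2 ^ n" using card_mono[OF finite_lessThan S(1)] by simp
      then have "real (card S) \<le> real (2 ^ n)" by (rule of_nat_mono)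
      then show ?thesis by simp
    qed
    show "\<exists>\<delta>>0. \<forall>g\<in>carrier (Aut M). moves_cells n \<delta> g \<longrightarrow> dm (pre (rep g) A) A < e"
    proof (intro exI[of _ "e / (4 * 2 ^ n)"] conjI ballI impI)
      show "e / (4 * 2 ^ n) > 0" using e by simp
      fix g assume g: "g \<in> carrier (Aut M)"
        and small: "\<forall>k<2 ^ n. dm (pre (rep g) (dyadic n {k})) (dyadic n {k}) < e / (4 * 2 ^ n)"
      note rg = rep_measurable[OF g] rep_distr[OF g]
      note pe = pre_events[OF rg(1)]
      have D: "dyadic n S = (\<Union>k\<in>S. dyadic n {k})" by (auto simp: dyadic_def)
      have pD: "pre (rep g) (dyadic n S) = (\<Union>k\<in>S. pre (rep g) (dyadic n {k}))" by (auto simp: dyadic_def)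
      have "dm (pre (rep g) (dyadic n S)) (dyadic n S)
          \<le> (\<Sum>k\<in>S. dm (pre (rep g) (dyadic n {k})) (dyadic n {k}))"
        unfolding pD by (subst D) (intro dm_UN fS pe dyadic_events)
      also have "\<dots> \<le> (\<Sum>k\<in>S. e / (4 * 2 ^ n))"
        using small S(1) by (intro sum_mono) (auto intro: less_imp_le)
      also have "\<dots> = card S * (e / (4 * 2 ^ n))" by simp
      also have "\<dots> \<le> 2 ^ n * (e / (4 * 2 ^ n))" using cS e by (intro mult_right_mono) auto
      also have "\<dots> = e / 4" by simp
      finally have 1: "dm (pre (rep g) (dyadic n S)) (dyadic n S) \<le> e / 4" .
      have "dm (pre (rep g) A) A \<le> dm (pre (rep g) A) (pre (rep g) (dyadic n S)) + dm (pre (rep g) (dyadic n S)) A"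
        by (rule dm_triangle[OF pe[OF A] pe[OF dyadic_events] A])
      also have "dm (pre (rep g) A) (pre (rep g) (dyadic n S)) = dm A (dyadic n S)"
        by (rule dm_pre[OF rg A dyadic_events])
      also have "dm (pre (rep g) (dyadic n S)) A \<le> dm (pre (rep g) (dyadic n S)) (dyadic n S) + dm (dyadic n S) A"
        by (rule dm_triangle[OF pe[OF dyadic_events] dyadic_events A])
      finally show "dm (pre (rep g) A) A < e"
        using 1 S(2) dm_commute[of A "dyadic n S"] e by linarith
    qed
  qed
qed

text \<open>The approximants can be taken of modulus at most \<open>2 * cmod (f x)\<close>, so the
  squared error is dominated by \<open>9 * (cmod (f x))^2\<close> and its integral tends to
  zero.\<close>

lemma simple_approximation_norm2:
  assumes f: "f \<in> SI" and e: "e > 0"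
  obtains s where "simple_function M s" "s \<in> SI" "norm2 (\<lambda>x. f x - s x) < e"
proof -
  have fm: "f \<in> borel_measurable M" by (rule SI_measurable[OF f])
  obtain F where F: "\<And>i. simple_function M (F i)"
    "\<And>x. x \<in> space M \<Longrightarrow> (\<lambda>i. F i x) \<longlonglongrightarrow> f x"
    "\<And>i x. x \<in> space M \<Longrightarrow> dist (F i x) 0 \<le> 2 * dist (f x) 0"
    using borel_measurable_implies_sequence_metric[OF fm, of 0] by blast
  have Fm: "F i \<in> borel_measurable M" for i by (rule borel_measurable_simple_function[OF F(1)])
  have Fb: "cmod (F i x) \<le> 2 * cmod (f x)" if "x \<in> space M" for i x using F(3)[OF that] by simp
  have FS: "F i \<in> SI" for i
  proof -
    have "integrable M (\<lambda>x. 4 * (cmod (f x))\<^sup>2)" using SI_integrable[OF f] by simp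
    then have "integrable M (\<lambda>x. (cmod (F i x))\<^sup>2)"
    proof (rule Bochner_Integration.integrable_bound)
      show "AE x in M. norm ((cmod (F i x))\<^sup>2) \<le> norm (4 * (cmod (f x))\<^sup>2)"
      proof (rule AE_I2)
        fix x assume "x \<in> space M"
        then have "(cmod (F i x))\<^sup>2 \<le> (2 * cmod (f x))\<^sup>2" using Fb by (intro power_mono) auto
        then show "norm ((cmod (F i x))\<^sup>2) \<le> norm (4 * (cmod (f x))\<^sup>2)" by (simp add: power_mult_distrib)
      qed
    qed (use Fm in measurable)
    then show ?thesis using Fm by (simp add: square_integrable_def)
  qed
  have "(\<lambda>i. \<integral>x. (cmod (f x - F i x))\<^sup>2 \<partial>M) \<longlonglongrightarrow> (\<integral>x. 0 \<partial>M)"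
  proof (rule integral_dominated_convergence[where w = "\<lambda>x. 9 * (cmod (f x))\<^sup>2"])
    show "integrable M (\<lambda>x. 9 * (cmod (f x))\<^sup>2)" using SI_integrable[OF f] by simp
    show "AE x in M. (\<lambda>i. (cmod (f x - F i x))\<^sup>2) \<longlonglongrightarrow> 0"
    proof (rule AE_I2)
      fix x assume "x \<in> space M"
      then have "(\<lambda>i. (cmod (f x - F i x))\<^sup>2) \<longlonglongrightarrow> (cmod (f x - f x))\<^sup>2"
        by (intro tendsto_intros F(2))
      then show "(\<lambda>i. (cmod (f x - F i x))\<^sup>2) \<longlonglongrightarrow> 0" by simp
    qed
    show "AE x in M. norm ((cmod (f x - F i x))\<^sup>2) \<le> 9 * (cmod (f x))\<^sup>2" for i
    proof (rule AE_I2)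
      fix x assume x: "x \<in> space M"
      have "cmod (f x - F i x) \<le> 3 * cmod (f x)"
        using norm_triangle_ineq4[of "f x" "F i x"] Fb[OF x, of i] by linarith
      then have "(cmod (f x - F i x))\<^sup>2 \<le> (3 * cmod (f x))\<^sup>2" by (intro power_mono) auto
      then show "norm ((cmod (f x - F i x))\<^sup>2) \<le> 9 * (cmod (f x))\<^sup>2" by (simp add: power_mult_distrib)
    qed
  qed (use fm Fm in measurable)
  moreover have "e\<^sup>2 > 0" using e by simp
  ultimately have "\<forall>\<^sub>F i in sequentially. (\<integral>x. (cmod (f x - F i x))\<^sup>2 \<partial>M) < e\<^sup>2"
    using order_tendstoD(2) by fastforce
  then obtain i where "(\<integral>x. (cmod (f x - F i x))\<^sup>2 \<partial>M) < e\<^sup>2"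
    using eventually_happens by fastforce
  then have "(norm2 (\<lambda>x. f x - F i x))\<^sup>2 < e\<^sup>2" by (simp add: norm2_power2)
  then have "norm2 (\<lambda>x. f x - F i x) < e" using e by (simp add: power2_less_imp_less)
  then show thesis by (rule that[OF F(1) FS])
qed

text \<open>Where \<open>s x\<close> and \<open>s (rinv g x)\<close> differ, \<open>x\<close> lies
  in the symmetric difference of the level set of \<open>s x\<close> and its preimage. There are
  finitely many level sets, and the squared difference is at most \<open>4 * C^2\<close>.\<close>

lemma near_one_simple:
  assumes s: "simple_function M s" "s \<in> SI" and e: "e > 0"
  shows "near_one (\<lambda>g. norm2 (\<lambda>x. s x - s (rinv g x)) < e)"
proof -
  define Y where "Y = s ` space M"
  have Y: "finite Y" using simple_functionD(1)[OF s(1)] by (simp add: Y_def)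
  define A where "A = (\<lambda>y. s -` {y} \<inter> space M)"
  have A: "A y \<in> events" for y unfolding A_def by (rule simple_functionD(2)[OF s(1)])
  obtain C where C: "\<And>x. x \<in> space M \<Longrightarrow> cmod (s x) \<le> C"
    using finite_imp_bounded[OF Y] unfolding bounded_iff Y_def by blast
  \<comment> \<open>The added ones keep \<open>D\<close> and the denominator of \<eta> positive, and
    the one next to \<open>card Y\<close> makes the final estimate strict.\<close>
  define D where "D = 4 * C\<^sup>2 + 1"
  have D: "D > 0" "4 * C\<^sup>2 \<le> D" by (auto simp: D_def add_nonneg_pos)
  define \<eta> where "\<eta> = e\<^sup>2 / (D * (card Y + 1))"
  have \<eta>: "\<eta> > 0" using e D(1) by (simp add: \<eta>_def)
  have "near_one (\<lambda>g. \<forall>y\<in>Y. dm (pre (rep g) (A y)) (A y) < \<eta>)"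
    by (intro near_one_ball Y near_one_event A \<eta>)
  then show ?thesis
  proof (rule near_one_mono)
    fix g assume g: "g \<in> carrier (Aut M)" and small: "\<forall>y\<in>Y. dm (pre (rep g) (A y)) (A y) < \<eta>"
    let ?u = "rinv g"
    note u = rinv_measurable[OF g] rinv_distr[OF g]
    define S where "S = (\<lambda>y. (pre ?u (A y) - A y) \<union> (A y - pre ?u (A y)))"
    have S: "S y \<in> events" for y unfolding S_def by (intro sets.Un sets.Diff A pre_events[OF u(1)])
    have bound: "(cmod (s x - s (?u x)))\<^sup>2 \<le> (\<Sum>y\<in>Y. D * indicator (S y) x)" if x: "x \<in> space M" for x
    proof (cases "s x = s (?u x)")
      case True
      then show ?thesis using D(1) by (simp add: sum_nonneg)
    next
      case False
      have ux: "?u x \<in> space M" using measurable_space[OF u(1) x] .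
      have "x \<in> S (s x)" "s x \<in> Y" using False x by (auto simp: S_def A_def Y_def)
      then have "D * indicator (S (s x)) x \<le> (\<Sum>y\<in>Y. D * indicator (S y) x)"
        using D(1) Y by (intro member_le_sum) auto
      moreover have "(cmod (s x - s (?u x)))\<^sup>2 \<le> D"
      proof -
        have "cmod (s x - s (?u x)) \<le> 2 * C"
          using norm_triangle_ineq4[of "s x" "s (?u x)"] C[OF x] C[OF ux] by linarith
        then have "(cmod (s x - s (?u x)))\<^sup>2 \<le> (2 * C)\<^sup>2" by (intro power_mono) auto
        then show ?thesis using D(2) by (simp add: power_mult_distrib)
      qed
      ultimately show ?thesis using \<open>x \<in> S (s x)\<close> by simp
    qed
    have int: "integrable M (\<lambda>x. D * indicator (S y) x)" for y
      using S by (intro integrable_mult_right integrable_real_indicator) (auto simp: emeasure_eq_measure)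
    have "(norm2 (\<lambda>x. s x - s (?u x)))\<^sup>2 \<le> (\<integral>x. (\<Sum>y\<in>Y. D * indicator (S y) x) \<partial>M)"
      unfolding norm2_power2
      by (intro integral_mono bound SI_integrable SI_diff s(2) norm2_comp(1)[OF u] Bochner_Integration.integrable_sum int)
    also have "\<dots> = (\<Sum>y\<in>Y. \<integral>x. D * indicator (S y) x \<partial>M)"
      by (intro Bochner_Integration.integral_sum int)
    also have "\<dots> = (\<Sum>y\<in>Y. D * prob (S y))"
      using S sets.sets_into_space[OF S] by (intro sum.cong) (auto simp: Int_absorb2)
    also have "\<dots> = (\<Sum>y\<in>Y. D * dm (pre (rep g) (A y)) (A y))"
      by (simp add: S_def dm_def[symmetric] dm_pre_inv[OF g A])
    also have "\<dots> \<le> (\<Sum>y\<in>Y. D * \<eta>)"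
      using small D(1) by (intro sum_mono mult_left_mono) (auto intro: less_imp_le)
    also have "\<dots> = card Y * (D * \<eta>)" by simp
    also have "\<dots> < (card Y + 1) * (D * \<eta>)" using D(1) \<eta> by (intro mult_strict_right_mono) auto
    also have "\<dots> = e\<^sup>2" using D(1) by (simp add: \<eta>_def)
    finally show "norm2 (\<lambda>x. s x - s (?u x)) < e" using e by (simp add: power2_less_imp_less)
  qed
qed

lemma near_one_L2:
  assumes f: "f \<in> SI" and e: "e > 0"
  shows "near_one (\<lambda>g. norm2 (\<lambda>x. f x - f (rinv g x)) < e)"
proof -
  have e3: "e / 3 > 0" using e by simp
  obtain s where s: "simple_function M s" "s \<in> SI" "norm2 (\<lambda>x. f x - s x) < e / 3"
    by (rule simple_approximation_norm2[OF f e3])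
  show ?thesis
  proof (rule near_one_mono[OF near_one_simple[OF s(1,2) e3]])
    fix g assume g: "g \<in> carrier (Aut M)" and small: "norm2 (\<lambda>x. s x - s (rinv g x)) < e / 3"
    note u = rinv_measurable[OF g] rinv_distr[OF g]
    note su = norm2_comp(1)[OF u s(2)] and fu = norm2_comp(1)[OF u f]
    have "norm2 (\<lambda>x. f x - f (rinv g x))
        = norm2 (\<lambda>x. (f x - s x) + ((s x - s (rinv g x)) + (s (rinv g x) - f (rinv g x))))"
      by simp
    also have "\<dots> \<le> norm2 (\<lambda>x. f x - s x) + norm2 (\<lambda>x. (s x - s (rinv g x)) + (s (rinv g x) - f (rinv g x)))"
      by (intro norm2_triangle SI_add SI_diff f s(2) su fu)
    also have "norm2 (\<lambda>x. (s x - s (rinv g x)) + (s (rinv g x) - f (rinv g x)))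
        \<le> norm2 (\<lambda>x. s x - s (rinv g x)) + norm2 (\<lambda>x. s (rinv g x) - f (rinv g x))"
      by (intro norm2_triangle SI_diff s(2) su fu)
    also have "norm2 (\<lambda>x. s (rinv g x) - f (rinv g x)) = norm2 (\<lambda>x. f x - s x)"
      using norm2_comp(2)[OF u SI_diff[OF s(2) f]] norm2_minus[of s f] by simp
    finally show "norm2 (\<lambda>x. f x - f (rinv g x)) < e" using small s(3) by linarith
  qed
qed

lemma near_one_open:
  assumes U: "openin (weak_topology M) U" "\<one>\<^bsub>Aut M\<^esub> \<in> U"
  shows "near_one (\<lambda>g. g \<in> U)"
proof -
  obtain \<Xi> r where X: "finite \<Xi>" "\<Xi> \<subseteq> L2 M" "r > 0"
    "\<forall>g\<in>carrier (Aut M). (\<forall>\<xi>\<in>\<Xi>. L2_dist M \<xi> (Koopman M g \<xi>) < r) \<longrightarrow> g \<in> U"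
    by (rule weak_neighbourhood_of_one[OF U])
  have "near_one (\<lambda>g. L2_dist M \<xi> (Koopman M g \<xi>) < r)" if "\<xi> \<in> \<Xi>" for \<xi>
  proof -
    have "\<xi> \<in> L2 M" using X(2) that by blast
    then obtain f where f: "f \<in> SI" "\<xi> = cl2 f" by (rule L2_cases)
    show ?thesis
    proof (rule near_one_mono[OF near_one_L2[OF f(1) X(3)]])
      fix g assume g: "g \<in> carrier (Aut M)" and "norm2 (\<lambda>x. f x - f (rinv g x)) < r"
      then show "L2_dist M \<xi> (Koopman M g \<xi>) < r"
        unfolding f(2) Koopman_cl2[OF g f(1)]
        by (simp only: L2_dist_cl2[OF f(1) norm2_comp(1)[OF rinv_measurable[OF g] rinv_distr[OF g] f(1)]])
    qed
  qed
  from near_one_ball[OF X(1) this] show ?thesis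
  proof (rule near_one_mono)
    fix g assume "g \<in> carrier (Aut M)" "\<forall>\<xi>\<in>\<Xi>. L2_dist M \<xi> (Koopman M g \<xi>) < r"
    then show "g \<in> U" by (rule X(4)[THEN bspec, THEN mp])
  qed
qed

lemma near_oneE:
  assumes "near_one P"
  obtains n \<delta> where "\<delta> > 0" "\<forall>g\<in>carrier (Aut M). moves_cells n \<delta> g \<longrightarrow> P g"
proof -
  obtain n0 where n0: "\<forall>n\<ge>n0. \<exists>\<delta>>0. \<forall>g\<in>carrier (Aut M). moves_cells n \<delta> g \<longrightarrow> P g"
    using assms unfolding near_one_def by (rule exE)
  then obtain \<delta> where "\<delta> > 0" "\<forall>g\<in>carrier (Aut M). moves_cells n0 \<delta> g \<longrightarrow> P g"
    by (meson order_refl)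
  then show thesis by (rule that)
qed

section \<open>Separability, and factorization near the identity\<close>

lemma semitopological_Aut: "semitopological_group (Aut M) (weak_topology M)"
  by (intro semitopological_group.intro group_Aut semitopological_group_axioms.intro
      topspace_weak_topology weak_continuous_left_mult weak_continuous_right_mult)

text \<open>A record, in natural numbers only, of where \<open>g\<close> pulls back the cells of
  level \<open>n\<close>, up to \<open>1 / real (Suc m)\<close>. Lists in place of sets make the
  records a countable type.\<close>

definition dyadic_profile :: "nat \<Rightarrow> nat \<Rightarrow> nat \<Rightarrow> nat list list \<Rightarrow> ('a \<Rightarrow> 'a) set \<Rightarrow> bool" where
  "dyadic_profile n m n' L g \<longleftrightarrow> g \<in> carrier (Aut M) \<and>
     (\<forall>k<2 ^ n. dm (pre (rep g) (dyadic n {k})) (dyadic n' (set (L ! k))) < 1 / real (Suc m))"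

lemma dyadic_profile_exists:
  assumes g: "g \<in> carrier (Aut M)"
  obtains n' L where "dyadic_profile n m n' L g"
proof -
  have ev: "pre (rep g) (dyadic n {k}) \<in> events" for k
    by (rule pre_events[OF rep_measurable[OF g] dyadic_events])
  have m: "1 / real (Suc m) > 0" by simp
  have "\<exists>p. \<forall>n'\<ge>p. \<exists>S. S \<subseteq> {..<2 ^ n'} \<and> dm (pre (rep g) (dyadic n {k})) (dyadic n' S) < 1 / real (Suc m)" for k
    by (rule dyadic_approximation[OF ev m])
  then obtain p where p: "\<And>k n'. n' \<ge> p k \<Longrightarrow>
      \<exists>S. S \<subseteq> {..<2 ^ n'} \<and> dm (pre (rep g) (dyadic n {k})) (dyadic n' S) < 1 / real (Suc m)"
    by metis
  define n' where "n' = (\<Sum>k<2 ^ n. p k)"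
  have "\<exists>S. S \<subseteq> {..<2 ^ n'} \<and> dm (pre (rep g) (dyadic n {k})) (dyadic n' S) < 1 / real (Suc m)"
    if "k < 2 ^ n" for k
  proof -
    have "p k \<le> n'" unfolding n'_def using that by (intro member_le_sum) auto
    then show ?thesis by (rule p)
  qed
  then obtain S where S: "\<And>k. k < 2 ^ n \<Longrightarrow> S k \<subseteq> {..<2 ^ n'}"
    "\<And>k. k < 2 ^ n \<Longrightarrow> dm (pre (rep g) (dyadic n {k})) (dyadic n' (S k)) < 1 / real (Suc m)"
    by metis
  define L where "L = map (\<lambda>k. sorted_list_of_set (S k)) [0..<2 ^ n]"
  have "set (L ! k) = S k" if "k < 2 ^ n" for k
    using that finite_subset[OF S(1)[OF that]] by (simp add: L_def)
  then have "dyadic_profile n m n' L g" using g S(2) by (simp add: dyadic_profile_def)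
  then show thesis by (rule that)
qed

text \<open>One automorphism is chosen for each record that occurs. Two automorphisms with the same
  record pull each cell back to sets less than \<open>2 / real (Suc m)\<close> apart, so their
  quotient lies in a prescribed neighbourhood of the identity once \<open>m\<close> and
  \<open>n\<close> are suitable.\<close>

lemma separable_Aut:
  obtains d :: "nat \<Rightarrow> ('a \<Rightarrow> 'a) set"
  where "\<forall>i. d i \<in> carrier (Aut M)"
    "\<forall>V. openin (weak_topology M) V \<longrightarrow> V \<noteq> {} \<longrightarrow> (\<exists>i. d i \<in> V)"
proof -
  interpret A: semitopological_group "Aut M" "weak_topology M" by (rule semitopological_Aut)
  define c where "c = (\<lambda>(n, m, n', L). if \<exists>g. dyadic_profile n m n' L g
      then SOME g. dyadic_profile n m n' L g else \<one>\<^bsub>Aut M\<^esub>)"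
  have c: "dyadic_profile n m n' L (c (n, m, n', L))" if "dyadic_profile n m n' L g" for n m n' L g
  proof -
    have ex: "\<exists>g. dyadic_profile n m n' L g" using that by blast
    then have "c (n, m, n', L) = (SOME g. dyadic_profile n m n' L g)" by (simp add: c_def)
    then show ?thesis using someI_ex[OF ex] by simp
  qed
  have cG: "c q \<in> carrier (Aut M)" for q
  proof -
    obtain n m n' L where q: "q = (n, m, n', L)" by (metis prod_cases4)
    show ?thesis
    proof (cases "\<exists>g. dyadic_profile n m n' L g")
      case True
      then obtain g where "dyadic_profile n m n' L g" by blast
      from c[OF this] show ?thesis by (simp add: q dyadic_profile_def)
    next
      case False
      then have "c q = \<one>\<^bsub>Aut M\<^esub>" by (auto simp: q c_def)
      then show ?thesis by simp
    qed
  qed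
  define d where "d = (\<lambda>i. c (from_nat i))"
  have "\<exists>i. d i \<in> V" if V: "openin (weak_topology M) V" "V \<noteq> {}" for V
  proof -
    obtain g where g: "g \<in> V" using V(2) by blast
    have gG: "g \<in> carrier (Aut M)" using g V(1) openin_subset A.topspace_eq by blast
    define U where "U = {u \<in> topspace (weak_topology M). u \<otimes>\<^bsub>Aut M\<^esub> g \<in> V}"
    have "openin (weak_topology M) U"
      unfolding U_def by (rule openin_continuous_map_preimage[OF A.continuous_right_mult[OF gG] V(1)])
    moreover have "\<one>\<^bsub>Aut M\<^esub> \<in> U" using g gG by (simp add: U_def A.topspace_eq)
    ultimately obtain n \<delta> where nd: "\<delta> > 0" "\<forall>g\<in>carrier (Aut M). moves_cells n \<delta> g \<longrightarrow> g \<in> U"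
      using near_oneE[OF near_one_open] by metis
    obtain m where m: "1 / real (Suc m) < \<delta> / 2"
      using nat_approx_posE[of "\<delta> / 2"] nd(1) by (metis half_gt_zero)
    obtain n' L where L: "dyadic_profile n m n' L g" by (rule dyadic_profile_exists[OF gG])
    define h where "h = c (n, m, n', L)"
    have h: "dyadic_profile n m n' L h" unfolding h_def by (rule c[OF L])
    have hG: "h \<in> carrier (Aut M)" unfolding h_def by (rule cG)
    have "dm (pre (rep (h \<otimes>\<^bsub>Aut M\<^esub> inv\<^bsub>Aut M\<^esub> g)) (dyadic n {k})) (dyadic n {k}) < \<delta>" if k: "k < 2 ^ n" for k
    proof -
      note ph = pre_events[OF rep_measurable[OF hG] dyadic_events[of n "{k}"]]
      note pg = pre_events[OF rep_measurable[OF gG] dyadic_events[of n "{k}"]]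
      have "dm (pre (rep (h \<otimes>\<^bsub>Aut M\<^esub> inv\<^bsub>Aut M\<^esub> g)) (dyadic n {k})) (dyadic n {k})
          = dm (pre (rep h) (dyadic n {k})) (pre (rep g) (dyadic n {k}))"
        by (rule dm_pre_mult_inv[OF hG gG dyadic_events])
      also have "\<dots> \<le> dm (pre (rep h) (dyadic n {k})) (dyadic n' (set (L ! k)))
          + dm (dyadic n' (set (L ! k))) (pre (rep g) (dyadic n {k}))"
        by (rule dm_triangle[OF ph dyadic_events pg])
      also have "\<dots> < \<delta> / 2 + \<delta> / 2"
        using h L k m unfolding dyadic_profile_def dm_commute[of "dyadic n' (set (L ! k))"]
        by (intro add_strict_mono) (meson less_trans)+
      finally show ?thesis by simp
    qed
    then have "h \<otimes>\<^bsub>Aut M\<^esub> inv\<^bsub>Aut M\<^esub> g \<in> U" using nd(2) hG gG by simp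
    then have "h \<in> V" using hG gG by (simp add: U_def A.m_assoc)
    moreover have "d (to_nat (n, m, n', L)) = h" by (simp add: d_def h_def)
    ultimately show ?thesis by metis
  qed
  then show thesis using that[of d] cG by (simp add: d_def)
qed

text \<open>An automorphism \<open>v\<close> that matches the sets \<open>g\<inverse> A\<^sub>i \<inter> A\<^sub>j\<close> with the sets \<open>h\<inverse> A\<^sub>i \<inter> A\<^sub>j\<close> almost
  preserves every cell \<open>A\<^sub>j\<close>, and \<open>u = h v\<inverse> g\<inverse>\<close> almost preserves every cell \<open>A\<^sub>i\<close>.\<close>

lemma Roelcke_factorization:
  assumes U: "openin (weak_topology M) U" "\<one>\<^bsub>Aut M\<^esub> \<in> U"
  obtains n \<delta> where "\<delta> > 0" "\<forall>g\<in>carrier (Aut M). \<forall>h\<in>carrier (Aut M).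
    (\<forall>i<2 ^ n. \<forall>j<2 ^ n. \<bar>prob (pre (rep g) (dyadic n {i}) \<inter> dyadic n {j})
       - prob (pre (rep h) (dyadic n {i}) \<inter> dyadic n {j})\<bar> < \<delta>) \<longrightarrow>
    (\<exists>u\<in>U. \<exists>v\<in>U. u \<in> carrier (Aut M) \<and> v \<in> carrier (Aut M) \<and> h = u \<otimes>\<^bsub>Aut M\<^esub> (g \<otimes>\<^bsub>Aut M\<^esub> v))"
proof -
  interpret A: group "Aut M" by (rule group_Aut)
  obtain n \<delta> where nd: "\<delta> > 0" "\<forall>g\<in>carrier (Aut M). moves_cells n \<delta> g \<longrightarrow> g \<in> U"
    by (rule near_oneE[OF near_one_open[OF U]])
  \<comment> \<open>Each cell is cut into \<open>2 ^ n\<close> pieces, whose errors have to add up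
    to less than \<delta>.\<close>
  define e where "e = \<delta> / 2 ^ n"
  have e: "e > 0" using nd(1) by (simp add: e_def)
  let ?N = "{..<(2::nat) ^ n}"
  let ?I = "\<lambda>k. dyadic n {k}"
  show thesis
  proof (rule that[of "e / 2" n], simp add: e, intro ballI impI)
    fix g h assume g: "g \<in> carrier (Aut M)" and h: "h \<in> carrier (Aut M)"
      and close: "\<forall>i<2 ^ n. \<forall>j<2 ^ n. \<bar>prob (pre (rep g) (?I i) \<inter> ?I j) - prob (pre (rep h) (?I i) \<inter> ?I j)\<bar> < e / 2"
    define B where "B = (\<lambda>(i, j). pre (rep g) (?I i) \<inter> ?I j)"
    define C where "C = (\<lambda>(i, j). pre (rep h) (?I i) \<inter> ?I j)"
    have BC_ev: "B p \<in> events" "C p \<in> events" for p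
      unfolding B_def C_def
      by (auto simp: case_prod_beta intro!: sets.Int pre_events rep_measurable g h)
    have disj: "disjoint_family_on B (?N \<times> ?N)" "disjoint_family_on C (?N \<times> ?N)"
      by (auto simp: disjoint_family_on_def B_def C_def dyadic_def)
    obtain v where v: "v \<in> carrier (Aut M)" and vBC: "\<And>p. p \<in> ?N \<times> ?N \<Longrightarrow> dm (pre (rep v) (B p)) (C p) < e"
    proof (rule matching_automorphism[of "?N \<times> ?N" B C e])
      show "\<bar>prob (B p) - prob (C p)\<bar> < e / 2" if "p \<in> ?N \<times> ?N" for p
        using close that by (auto simp: B_def C_def)
      show "finite (?N \<times> ?N)" by simp
      show "disjoint_family_on B (?N \<times> ?N)" "disjoint_family_on C (?N \<times> ?N)" by (rule disj)+
      show "e > 0" by (rule e)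
      show "B p \<in> events" "C p \<in> events" for p by (rule BC_ev)+
    qed blast
    note rv = rep_measurable[OF v] and rg = rep_measurable[OF g] and rh = rep_measurable[OF h]
    have sum_e: "(\<Sum>i\<in>?N. dm (pre (rep v) (B (p i))) (C (p i))) < \<delta>"
      if "\<And>i. i \<in> ?N \<Longrightarrow> p i \<in> ?N \<times> ?N" for p
    proof -
      have "(\<Sum>i\<in>?N. dm (pre (rep v) (B (p i))) (C (p i))) < (\<Sum>i\<in>?N. e)"
      proof (rule sum_strict_mono)
        have "0 \<in> ?N" by simp
        then show "?N \<noteq> {}" by blast
      qed (use vBC that in auto)
      then show ?thesis by (simp add: e_def)
    qed
    have ev1: "pre (rep v) (B p) \<in> events" for p by (rule pre_events[OF rv BC_ev(1)])
    have ev2: "(\<Union>i\<in>?N. pre (rep v) (B (q i))) \<in> events" for q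
      using ev1 by (intro sets.finite_UN) auto
    have ev3: "(\<Union>i\<in>?N. C (q i)) \<in> events" for q using BC_ev(2) by (intro sets.finite_UN) auto
    note evs = ev1 ev2 ev3
    have AEg: "AE x in M. digit n (rep g x) < 2 ^ n" by (rule tr_AE[OF rep_tr[OF g] AE_digit])
    have AEh: "AE x in M. digit n (rep h x) < 2 ^ n" by (rule tr_AE[OF rep_tr[OF h] AE_digit])
    have AEgv: "AE x in M. digit n (rep g (rep v x)) < 2 ^ n" by (rule tr_AE[OF rep_tr[OF v] AEg])
    have AEv: "AE x in M. digit n (rep v x) < 2 ^ n" by (rule tr_AE[OF rep_tr[OF v] AE_digit])
    \<comment> \<open>For fixed \<open>j\<close> the pieces \<open>C (i, j)\<close> make up cell
      \<open>j\<close> and the pulled back \<open>B (i, j)\<close> make up its preimage under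
      \<open>v\<close>; the errors are summed over \<open>i\<close>.\<close>
    have vU: "v \<in> U"
    proof -
      have "dm (pre (rep v) (?I j)) (?I j) < \<delta>" if j: "j < 2 ^ n" for j
      proof -
        have "dm (pre (rep v) (?I j)) (?I j) = dm (\<Union>i\<in>?N. pre (rep v) (B (i, j))) (\<Union>i\<in>?N. C (i, j))"
        proof (rule dm_cong_AE)
          show "AE x in M. x \<in> pre (rep v) (?I j) \<longleftrightarrow> x \<in> (\<Union>i\<in>?N. pre (rep v) (B (i, j)))"
            using AEgv AE_space
            by eventually_elim (use measurable_space[OF rv] measurable_space[OF rg] in \<open>auto simp: B_def dyadic_def\<close>)
          show "AE x in M. x \<in> ?I j \<longleftrightarrow> x \<in> (\<Union>i\<in>?N. C (i, j))"
            using AEh AE_space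
            by eventually_elim (use measurable_space[OF rh] in \<open>auto simp: C_def dyadic_def\<close>)
        qed (rule evs dyadic_events pre_events[OF rv dyadic_events])+
        also have "\<dots> \<le> (\<Sum>i\<in>?N. dm (pre (rep v) (B (i, j))) (C (i, j)))"
          by (rule dm_UN) (rule finite_lessThan evs BC_ev)+
        also have "\<dots> < \<delta>" using sum_e[of "\<lambda>i. (i, j)"] j by simp
        finally show ?thesis .
      qed
      then show ?thesis using nd(2) v by blast
    qed
    define w where "w = g \<otimes>\<^bsub>Aut M\<^esub> v"
    have w: "w \<in> carrier (Aut M)" using g v by (simp add: w_def)
    define u where "u = h \<otimes>\<^bsub>Aut M\<^esub> inv\<^bsub>Aut M\<^esub> w"
    have u: "u \<in> carrier (Aut M)" using h w by (simp add: u_def)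
    \<comment> \<open>For fixed \<open>i\<close> the pieces \<open>C (i, j)\<close> make up the
      preimage of cell \<open>i\<close> under \<open>h\<close>, and the pulled back
      \<open>B (i, j)\<close> its preimage under \<open>w\<close>. Their distance is the amount by
      which \<open>u\<close> moves the cell.\<close>
    have uU: "u \<in> U"
    proof -
      have "dm (pre (rep u) (?I i)) (?I i) < \<delta>" if i: "i < 2 ^ n" for i
      proof -
        have "dm (pre (rep u) (?I i)) (?I i) = dm (pre (rep w) (?I i)) (pre (rep h) (?I i))"
          unfolding u_def dm_pre_mult_inv[OF h w dyadic_events] by (rule dm_commute)
        also have "\<dots> = dm (\<Union>j\<in>?N. pre (rep v) (B (i, j))) (\<Union>j\<in>?N. C (i, j))"
        proof (rule dm_cong_AE)
          show "AE x in M. x \<in> pre (rep w) (?I i) \<longleftrightarrow> x \<in> (\<Union>j\<in>?N. pre (rep v) (B (i, j)))"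
            using rep_mult[OF g v, folded w_def] AEv AE_space
            by eventually_elim (use measurable_space[OF rv] measurable_space[OF rg] in \<open>auto simp: B_def dyadic_def\<close>)
          show "AE x in M. x \<in> pre (rep h) (?I i) \<longleftrightarrow> x \<in> (\<Union>j\<in>?N. C (i, j))"
            using AE_digit[of n] AE_space
            by eventually_elim (use measurable_space[OF rh] in \<open>auto simp: C_def dyadic_def\<close>)
        qed (rule evs pre_events[OF rh dyadic_events] pre_events[OF rep_measurable[OF w] dyadic_events])+
        also have "\<dots> \<le> (\<Sum>j\<in>?N. dm (pre (rep v) (B (i, j))) (C (i, j)))"
          by (rule dm_UN) (rule finite_lessThan evs BC_ev)+
        also have "\<dots> < \<delta>" using sum_e[of "\<lambda>j. (i, j)"] i by simp
        finally show ?thesis .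
      qed
      then show ?thesis using nd(2) u by blast
    qed
    have "h = u \<otimes>\<^bsub>Aut M\<^esub> (g \<otimes>\<^bsub>Aut M\<^esub> v)"
      using h w by (simp add: u_def w_def[symmetric] A.m_assoc)
    then show "\<exists>u\<in>U. \<exists>v\<in>U. u \<in> carrier (Aut M) \<and> v \<in> carrier (Aut M) \<and> h = u \<otimes>\<^bsub>Aut M\<^esub> (g \<otimes>\<^bsub>Aut M\<^esub> v)"
      using uU vU u v by blast
  qed
qed

end

section \<open>Roelcke uniformly continuous functions are Hilbert\<close>

text \<open>The variance of a binomial frequency, obtained from the moments of \<open>k\<close> and
  of \<open>k * (k - 1)\<close>.\<close>

lemma Bernstein_second_moment:
  assumes "n > 0"
  shows "(\<Sum>k\<le>n. (real k / real n - x)\<^sup>2 * Bernstein n k x) = x * (1 - x) / n"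
proof -
  have "(real k / real n - x)\<^sup>2 * Bernstein n k x = (real k * (real k - 1) * Bernstein n k x
      + (1 - 2 * n * x) * (real k * Bernstein n k x) + n\<^sup>2 * x\<^sup>2 * Bernstein n k x) / n\<^sup>2" for k
    using assms by (simp add: field_simps power2_eq_square)
  then have "(\<Sum>k\<le>n. (real k / real n - x)\<^sup>2 * Bernstein n k x)
      = (\<Sum>k\<le>n. real k * (real k - 1) * Bernstein n k x
      + (1 - 2 * n * x) * (real k * Bernstein n k x) + n\<^sup>2 * x\<^sup>2 * Bernstein n k x) / n\<^sup>2"
    by (simp only: sum_divide_distrib)
  also have "\<dots> = (real n * (real n - 1) * x\<^sup>2 + (1 - 2 * n * x) * (n * x) + n\<^sup>2 * x\<^sup>2) / n\<^sup>2"
    by (simp only: sum.distrib sum_distrib_left[symmetric] sum_k_Bernstein sum_kk_Bernstein sum_Bernstein mult_1_right)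
  also have "\<dots> = x * (1 - x) / n"
    using assms by (simp add: field_simps power2_eq_square)
  finally show ?thesis .
qed

lemma sum_prod_Bernstein:
  assumes "finite I"
  shows "(\<Sum>\<alpha>\<in>PiE I (\<lambda>_. {..L}). \<Prod>i\<in>I. Bernstein L (\<alpha> i) (y i)) = 1"
  using prod_sum_PiE[OF assms, of "\<lambda>_. {..L}" "\<lambda>i k. Bernstein L k (y i)"] by simp

text \<open>Under the product weights the coordinates are independent, so all factors except the one
  at \<open>i\<close> sum to one.\<close>

lemma sum_prod_Bernstein_second_moment:
  assumes I: "finite I" "i \<in> I" and L: "L > 0"
  shows "(\<Sum>\<alpha>\<in>PiE I (\<lambda>_. {..L}). (real (\<alpha> i) / real L - y i)\<^sup>2 * (\<Prod>j\<in>I. Bernstein L (\<alpha> j) (y j)))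
    = y i * (1 - y i) / L"
proof -
  define F where "F = (\<lambda>j k. (if j = i then (real k / real L - y j)\<^sup>2 else 1) * Bernstein L k (y j))"
  have "(\<Prod>j\<in>I. F j (\<alpha> j)) = (real (\<alpha> i) / real L - y i)\<^sup>2 * (\<Prod>j\<in>I. Bernstein L (\<alpha> j) (y j))" for \<alpha>
    using I by (simp add: F_def prod.distrib prod.delta)
  then have "(\<Sum>\<alpha>\<in>PiE I (\<lambda>_. {..L}). (real (\<alpha> i) / real L - y i)\<^sup>2 * (\<Prod>j\<in>I. Bernstein L (\<alpha> j) (y j)))
      = (\<Sum>\<alpha>\<in>PiE I (\<lambda>_. {..L}). \<Prod>j\<in>I. F j (\<alpha> j))" by simp
  also have "\<dots> = (\<Prod>j\<in>I. \<Sum>k\<le>L. F j k)"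
    by (rule prod_sum_PiE[OF I(1), symmetric]) simp
  also have "\<dots> = (\<Prod>j\<in>I. if j = i then y j * (1 - y j) / L else 1)"
    by (rule prod.cong) (auto simp: F_def Bernstein_second_moment[OF L])
  also have "\<dots> = y i * (1 - y i) / L" using I by (simp add: prod.delta)
  finally show ?thesis .
qed

text \<open>For each \<open>x\<close> the products of Bernstein weights form a probability
  distribution on the grid. Grid points near the coordinates of \<open>x\<close> carry values within
  \<open>e\<close> of \<open>f x\<close> by the oscillation hypothesis; the far ones are controlled
  by second moments, as in Chebyshev's inequality.\<close>

lemma Bernstein_multivariate_approximation:
  fixes m :: "'i \<Rightarrow> 'g \<Rightarrow> real" and f :: "'g \<Rightarrow> complex"
  assumes I: "finite I" and m01: "\<And>i x. i \<in> I \<Longrightarrow> x \<in> X \<Longrightarrow> 0 \<le> m i x \<and> m i x \<le> 1"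
    and fB: "\<And>x. x \<in> X \<Longrightarrow> cmod (f x) \<le> B" and \<delta>: "\<delta> > 0" and e: "e > 0"
    and osc: "\<And>x y. x \<in> X \<Longrightarrow> y \<in> X \<Longrightarrow> (\<And>i. i \<in> I \<Longrightarrow> \<bar>m i x - m i y\<bar> < \<delta>) \<Longrightarrow> cmod (f x - f y) < e"
  obtains L :: nat and c :: "('i \<Rightarrow> nat) \<Rightarrow> complex"
  where "\<forall>x\<in>X. cmod (f x - (\<Sum>\<alpha>\<in>PiE I (\<lambda>_. {..L}). c \<alpha> * of_real (\<Prod>i\<in>I. Bernstein L (\<alpha> i) (m i x)))) < 2 * e"
proof -
  define B1 where "B1 = \<bar>B\<bar> + 1"
  have B1: "B1 > 0" "\<And>x. x \<in> X \<Longrightarrow> cmod (f x) \<le> B1" using fB by (force simp: B1_def)+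
  \<comment> \<open>Chosen so that \<open>K * (\<delta> / 2)^2\<close> equals \<open>2 * B1\<close>,
    which bounds the error at a far grid point.\<close>
  define K where "K = 2 * B1 * (4 / \<delta>\<^sup>2)"
  have K: "K > 0" using B1 \<delta> by (simp add: K_def)
  obtain L :: nat where L: "L > K * card I / e" using reals_Archimedean2 by blast
  have L0: "L > 0"
  proof -
    have "0 \<le> K * card I / e" using K e by simp
    then show ?thesis using L by (metis of_nat_0_less_iff le_less_trans)
  qed
  define Q where "Q = PiE I (\<lambda>_. {..L})"
  define near where "near = (\<lambda>\<alpha> x. x \<in> X \<and> (\<forall>i\<in>I. \<bar>real (\<alpha> i) / real L - m i x\<bar> < \<delta> / 2))"
  \<comment> \<open>The coefficient samples \<open>f\<close> at some element whose coordinates are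
    within \<open>\<delta> / 2\<close> of the grid point, so that any two candidates differ by less
    than \<delta> in each coordinate. Grid points without candidates get 0.\<close>
  define c where "c = (\<lambda>\<alpha>. if \<exists>y. near \<alpha> y then f (SOME y. near \<alpha> y) else 0)"
  have c_near: "cmod (f x - c \<alpha>) < e" if x: "near \<alpha> x" for \<alpha> x
  proof -
    have ex: "\<exists>y. near \<alpha> y" using x by blast
    define y where "y = (SOME y. near \<alpha> y)"
    have y: "near \<alpha> y" unfolding y_def by (rule someI_ex[OF ex])
    have "c \<alpha> = f y" using ex by (auto simp: c_def y_def)
    moreover have "\<bar>m i x - m i y\<bar> < \<delta>" if "i \<in> I" for i
    proof -
      have "\<bar>real (\<alpha> i) / real L - m i x\<bar> < \<delta> / 2" "\<bar>real (\<alpha> i) / real L - m i y\<bar> < \<delta> / 2"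
        using x y that by (auto simp: near_def)
      then show ?thesis by linarith
    qed
    ultimately show ?thesis using osc[of x y] x y by (simp add: near_def)
  qed
  have c_bound: "cmod (c \<alpha>) \<le> B1" for \<alpha>
  proof (cases "\<exists>y. near \<alpha> y")
    case True
    then have "near \<alpha> (SOME y. near \<alpha> y)" by (rule someI_ex)
    moreover have "c \<alpha> = f (SOME y. near \<alpha> y)" using True by (auto simp: c_def)
    ultimately show ?thesis using B1(2) by (simp add: near_def)
  next
    case False
    then have "c \<alpha> = 0" by (auto simp: c_def)
    then show ?thesis using B1(1) by simp
  qed
  have "cmod (f x - (\<Sum>\<alpha>\<in>Q. c \<alpha> * of_real (\<Prod>i\<in>I. Bernstein L (\<alpha> i) (m i x)))) < 2 * e" if x: "x \<in> X" for x
  proof -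
    define q where "q = (\<lambda>\<alpha>. \<Prod>i\<in>I. Bernstein L (\<alpha> i) (m i x))"
    define V where "V = (\<lambda>\<alpha> i. (real (\<alpha> i) / real L - m i x)\<^sup>2)"
    have q0: "q \<alpha> \<ge> 0" for \<alpha>
      unfolding q_def using m01 x by (intro prod_nonneg ballI Bernstein_nonneg) auto
    have sum_q: "(\<Sum>\<alpha>\<in>Q. q \<alpha>) = 1"
      unfolding q_def Q_def by (rule sum_prod_Bernstein[OF I, of L "\<lambda>i. m i x"])
    have sum_V: "(\<Sum>\<alpha>\<in>Q. V \<alpha> i * q \<alpha>) \<le> 1 / L" if i: "i \<in> I" for i
    proof -
      have "(\<Sum>\<alpha>\<in>Q. V \<alpha> i * q \<alpha>) = m i x * (1 - m i x) / L"
        unfolding q_def Q_def V_def by (rule sum_prod_Bernstein_second_moment[OF I i L0, of "\<lambda>i. m i x"])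
      also have "\<dots> \<le> 1 / L"
        using m01[OF i x] by (intro divide_right_mono mult_le_one) auto
      finally show ?thesis .
    qed
    have term_bound: "cmod (f x - c \<alpha>) \<le> e + K * (\<Sum>i\<in>I. V \<alpha> i)" for \<alpha>
    proof (cases "near \<alpha> x")
      case True
      have "0 \<le> K * (\<Sum>i\<in>I. V \<alpha> i)" using K by (simp add: V_def sum_nonneg)
      then show ?thesis using c_near[OF True] by linarith
    next
      case False
      then obtain i where i: "i \<in> I" "\<bar>real (\<alpha> i) / real L - m i x\<bar> \<ge> \<delta> / 2"
        using x by (auto simp: near_def not_less)
      have "(\<delta> / 2)\<^sup>2 \<le> \<bar>real (\<alpha> i) / real L - m i x\<bar>\<^sup>2" using i(2) \<delta> by (intro power_mono) auto
      then have "(\<delta> / 2)\<^sup>2 \<le> V \<alpha> i" by (simp add: V_def)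
      also have "\<dots> \<le> (\<Sum>i\<in>I. V \<alpha> i)" using I i(1) by (intro member_le_sum) (auto simp: V_def)
      finally have "K * (\<delta> / 2)\<^sup>2 \<le> K * (\<Sum>i\<in>I. V \<alpha> i)" using K by (intro mult_left_mono) auto
      moreover have "K * (\<delta> / 2)\<^sup>2 = 2 * B1" using \<delta> by (simp add: K_def power_divide)
      moreover have "cmod (f x - c \<alpha>) \<le> 2 * B1"
        using norm_triangle_ineq4[of "f x" "c \<alpha>"] B1(2)[OF x] c_bound[of \<alpha>] by linarith
      ultimately show ?thesis using e by linarith
    qed
    have "f x = (\<Sum>\<alpha>\<in>Q. f x * of_real (q \<alpha>))"
      by (simp only: sum_distrib_left[symmetric] of_real_sum[symmetric] sum_q of_real_1 mult_1_right)
    then have "f x - (\<Sum>\<alpha>\<in>Q. c \<alpha> * of_real (q \<alpha>)) = (\<Sum>\<alpha>\<in>Q. (f x - c \<alpha>) * of_real (q \<alpha>))"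
      by (simp only: left_diff_distrib sum_subtractf)
    then have "cmod (f x - (\<Sum>\<alpha>\<in>Q. c \<alpha> * of_real (q \<alpha>))) \<le> (\<Sum>\<alpha>\<in>Q. cmod ((f x - c \<alpha>) * of_real (q \<alpha>)))"
      by (simp only: norm_sum)
    also have "\<dots> \<le> (\<Sum>\<alpha>\<in>Q. (e + K * (\<Sum>i\<in>I. V \<alpha> i)) * q \<alpha>)"
      using q0 by (intro sum_mono) (simp add: norm_mult mult_right_mono term_bound)
    also have "\<dots> = e * (\<Sum>\<alpha>\<in>Q. q \<alpha>) + K * (\<Sum>\<alpha>\<in>Q. \<Sum>i\<in>I. V \<alpha> i * q \<alpha>)"
      by (simp add: distrib_right sum.distrib sum_distrib_left sum_distrib_right mult.assoc)
    also have "(\<Sum>\<alpha>\<in>Q. \<Sum>i\<in>I. V \<alpha> i * q \<alpha>) = (\<Sum>i\<in>I. \<Sum>\<alpha>\<in>Q. V \<alpha> i * q \<alpha>)" by (rule sum.swap)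
    also have "e * (\<Sum>\<alpha>\<in>Q. q \<alpha>) + K * (\<Sum>i\<in>I. \<Sum>\<alpha>\<in>Q. V \<alpha> i * q \<alpha>) \<le> e * 1 + K * (\<Sum>i\<in>I. 1 / L)"
      using K e by (intro add_mono mult_left_mono sum_mono sum_V) (auto simp: sum_q)
    also have "\<dots> = e + K * card I / L" by simp
    also have "\<dots> < 2 * e"
    proof -
      have "K * card I / L < e" using L L0 e by (simp add: field_simps)
      then show ?thesis by simp
    qed
    finally show ?thesis by (simp add: q_def)
  qed
  then have "\<forall>x\<in>X. cmod (f x - (\<Sum>\<alpha>\<in>PiE I (\<lambda>_. {..L}). c \<alpha> * of_real (\<Prod>i\<in>I. Bernstein L (\<alpha> i) (m i x)))) < 2 * e"
    unfolding Q_def by (rule ballI)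
  then show thesis by (rule that)
qed

lemma continuous_map_complex_mult:
  fixes f g :: "'x \<Rightarrow> complex"
  assumes "continuous_map X euclidean f" "continuous_map X euclidean g"
  shows "continuous_map X euclidean (\<lambda>x. f x * g x)"
proof -
  have "continuous_map X euclidean (\<lambda>x. (f x, g x))"
    using continuous_map_pairedI[OF assms] by simp
  then show ?thesis
    using continuous_map_euclidean_compose[of X "\<lambda>x. (f x, g x)" "\<lambda>p. fst p * snd p"]
    by (simp add: continuous_on_mult continuous_on_fst continuous_on_snd)
qed

section \<open>Multipliers of the combinations of positive definite functions\<close>

context semitopological_group
begin

abbreviation "PDC \<equiv> positive_definite_combinations G T"

lemma PDC_I: "(\<And>i. i < n \<Longrightarrow> p i \<in> PD) \<Longrightarrow> (\<lambda>x. \<Sum>i<(n::nat). c i * p i x) \<in> PDC"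
  unfolding positive_definite_combinations_def by blast

lemma PDC_E:
  assumes "f \<in> PDC"
  obtains n :: nat and c p where "f = (\<lambda>x. \<Sum>i<n. c i * p i x)" "\<forall>i<n. p i \<in> PD"
  using assms unfolding positive_definite_combinations_def by blast

lemma PDC_add:
  assumes "f \<in> PDC" "g \<in> PDC" shows "(\<lambda>x. f x + g x) \<in> PDC"
proof -
  obtain n :: nat and c p where f: "f = (\<lambda>x. \<Sum>i<n. c i * p i x)" "\<forall>i<n. p i \<in> PD"
    using assms(1) by (rule PDC_E)
  obtain m :: nat and d q where g: "g = (\<lambda>x. \<Sum>i<m. d i * q i x)" "\<forall>i<m. q i \<in> PD"
    using assms(2) by (rule PDC_E)
  define a where "a = (\<lambda>i. if i < n then c i else d (i - n))"
  define r where "r = (\<lambda>i. if i < n then p i else q (i - n))"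
  have "(\<lambda>x. \<Sum>i<n + m. a i * r i x) \<in> PDC"
    using f(2) g(2) by (intro PDC_I) (auto simp: r_def)
  moreover have "(\<lambda>x. \<Sum>i<n + m. a i * r i x) = (\<lambda>x. f x + g x)"
    unfolding f(1) g(1) sum_lessThan_add by (simp add: a_def r_def)
  ultimately show ?thesis by simp
qed

lemma PDC_map:
  assumes "f \<in> PDC" "\<And>p. p \<in> PD \<Longrightarrow> (\<lambda>x. w x * p x) \<in> PD"
  shows "(\<lambda>x. b * (w x * f x)) \<in> PDC"
proof -
  obtain n :: nat and c p where f: "f = (\<lambda>x. \<Sum>i<n. c i * p i x)" "\<forall>i<n. p i \<in> PD"
    using assms(1) by (rule PDC_E)
  have "(\<lambda>x. \<Sum>i<n. (b * c i) * (w x * p i x)) \<in> PDC"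
    using PDC_I[of n "\<lambda>i x. w x * p i x" "\<lambda>i. b * c i"] f(2) assms(2) by blast
  moreover have "(\<lambda>x. \<Sum>i<n. (b * c i) * (w x * p i x)) = (\<lambda>x. b * (w x * f x))"
    unfolding f(1) by (simp add: sum_distrib_left mult_ac)
  ultimately show ?thesis by simp
qed

lemma PD_const: "(\<lambda>x. if x \<in> carrier G then 1 else 0) \<in> PD"
proof -
  let ?p = "\<lambda>x. if x \<in> carrier G then 1 else (0::complex)"
  have cont: "continuous_map T euclidean ?p"
    by (rule continuous_map_eq[of T euclidean "\<lambda>x. 1"]) (auto simp: topspace_eq)
  have sq: "(\<Sum>i<n. \<Sum>j<n. cnj (c i) * c j * ?p (inv (g i) \<otimes> g j)) = of_real ((cmod (\<Sum>i<n. c i))\<^sup>2)"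
    if "\<forall>i<n. g i \<in> carrier G" for n :: nat and g c
  proof -
    have "(\<Sum>i<n. \<Sum>j<n. cnj (c i) * c j * ?p (inv (g i) \<otimes> g j)) = (\<Sum>i<n. \<Sum>j<n. cnj (c i) * c j)"
      using that by (intro sum.cong) auto
    also have "\<dots> = (\<Sum>i<n. cnj (c i)) * (\<Sum>j<n. c j)"
      by (simp only: sum_product)
    also have "\<dots> = (\<Sum>i<n. c i) * cnj (\<Sum>i<n. c i)"
      by (simp add: mult.commute)
    finally show ?thesis by (simp only: complex_norm_square)
  qed
  show ?thesis
    unfolding positive_definite_functions_def functions_on_def mem_Collect_eq Let_def
  proof (intro conjI allI impI cont)
    fix n :: nat and g :: "nat \<Rightarrow> 'a" and c :: "nat \<Rightarrow> complex"
    assume g: "\<forall>i<n. g i \<in> carrier G"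
    show "Im (\<Sum>i<n. \<Sum>j<n. cnj (c i) * c j * ?p (inv (g i) \<otimes> g j)) = 0"
      unfolding sq[OF g] by (rule Im_complex_of_real)
    show "0 \<le> Re (\<Sum>i<n. \<Sum>j<n. cnj (c i) * c j * ?p (inv (g i) \<otimes> g j))"
      unfolding sq[OF g] Re_complex_of_real by (rule zero_le_power2)
  qed simp
qed

text \<open>The multipliers form an algebra, so a polynomial in matrix coefficients is a multiplier
  as soon as the coefficients are. Equality is asked on the carrier only, since constant multipliers
  do not vanish off it.\<close>

definition PDC_multiplier :: "('a \<Rightarrow> complex) \<Rightarrow> bool" where
  "PDC_multiplier w \<longleftrightarrow> (\<forall>f\<in>PDC. \<exists>h\<in>PDC. \<forall>x\<in>carrier G. w x * f x = h x)"

lemma PDC_multiplierE: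
  assumes "PDC_multiplier w" "f \<in> PDC"
  obtains h where "h \<in> PDC" "\<forall>x\<in>carrier G. w x * f x = h x"
  using bspec[OF assms(1)[unfolded PDC_multiplier_def] assms(2)] by (rule bexE)

lemma PDC_multiplier_cong:
  assumes "PDC_multiplier w" "\<And>x. x \<in> carrier G \<Longrightarrow> w' x = w x"
  shows "PDC_multiplier w'"
  using assms unfolding PDC_multiplier_def by simp

lemma PDC_multiplier_const: "PDC_multiplier (\<lambda>x. b)"
  unfolding PDC_multiplier_def
proof
  fix f assume "f \<in> PDC"
  then have "(\<lambda>x. b * (1 * f x)) \<in> PDC" by (rule PDC_map) simp
  then show "\<exists>h\<in>PDC. \<forall>x\<in>carrier G. b * f x = h x" by auto
qed

lemma PDC_multiplier_add:
  assumes "PDC_multiplier v" "PDC_multiplier w"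
  shows "PDC_multiplier (\<lambda>x. v x + w x)"
  unfolding PDC_multiplier_def
proof
  fix f assume f: "f \<in> PDC"
  obtain h where h: "h \<in> PDC" "\<forall>x\<in>carrier G. v x * f x = h x" by (rule PDC_multiplierE[OF assms(1) f])
  obtain h' where h': "h' \<in> PDC" "\<forall>x\<in>carrier G. w x * f x = h' x" by (rule PDC_multiplierE[OF assms(2) f])
  show "\<exists>h\<in>PDC. \<forall>x\<in>carrier G. (v x + w x) * f x = h x"
    using h(2) h'(2) by (intro bexI[OF _ PDC_add[OF h(1) h'(1)]]) (simp add: distrib_right)
qed

lemma PDC_multiplier_mult:
  assumes "PDC_multiplier v" "PDC_multiplier w"
  shows "PDC_multiplier (\<lambda>x. v x * w x)"
  unfolding PDC_multiplier_def
proof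
  fix f assume f: "f \<in> PDC"
  obtain h where h: "h \<in> PDC" "\<forall>x\<in>carrier G. w x * f x = h x"
    by (rule PDC_multiplierE[OF assms(2) f])
  obtain h' where h': "h' \<in> PDC" "\<forall>x\<in>carrier G. v x * h x = h' x"
    by (rule PDC_multiplierE[OF assms(1) h(1)])
  show "\<exists>h\<in>PDC. \<forall>x\<in>carrier G. (v x * w x) * f x = h x"
    using h(2) h'(2) by (intro bexI[OF _ h'(1)]) (simp add: mult.assoc)
qed

lemma PDC_multiplier_power: "PDC_multiplier w \<Longrightarrow> PDC_multiplier (\<lambda>x. w x ^ n)"
  by (induction n) (simp_all add: PDC_multiplier_const PDC_multiplier_mult)

lemma PDC_multiplier_sum:
  "finite K \<Longrightarrow> (\<And>k. k \<in> K \<Longrightarrow> PDC_multiplier (w k)) \<Longrightarrow> PDC_multiplier (\<lambda>x. \<Sum>k\<in>K. w k x)"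
  by (induction K rule: finite_induct) (simp_all add: PDC_multiplier_const PDC_multiplier_add)

lemma PDC_multiplier_prod:
  "finite K \<Longrightarrow> (\<And>k. k \<in> K \<Longrightarrow> PDC_multiplier (w k)) \<Longrightarrow> PDC_multiplier (\<lambda>x. \<Prod>k\<in>K. w k x)"
  by (induction K rule: finite_induct) (simp_all add: PDC_multiplier_const PDC_multiplier_mult)

lemma PDC_multiplier_Bernstein:
  assumes "PDC_multiplier (\<lambda>x. of_real (m x))"
  shows "PDC_multiplier (\<lambda>x. of_real (Bernstein n k (m x)))"
proof -
  have "PDC_multiplier (\<lambda>x. 1 + (-1) * of_real (m x))"
    by (intro PDC_multiplier_add PDC_multiplier_mult PDC_multiplier_const assms)
  then have "PDC_multiplier (\<lambda>x. of_real (1 - m x))"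
    by (rule PDC_multiplier_cong) simp
  then have "PDC_multiplier (\<lambda>x. of_nat (n choose k) * of_real (m x) ^ k * of_real (1 - m x) ^ (n - k))"
    by (intro PDC_multiplier_mult PDC_multiplier_const PDC_multiplier_power assms)
  then show ?thesis by (rule PDC_multiplier_cong) (simp add: Bernstein_def)
qed

text \<open>The multiplier is applied to the constant function one, which is itself positive
  definite.\<close>

lemma PDC_multiplier_one:
  assumes "PDC_multiplier w"
  obtains h where "h \<in> PDC" "\<forall>x\<in>carrier G. w x = h x"
proof -
  let ?p = "\<lambda>x. if x \<in> carrier G then 1 else (0::complex)"
  have "(\<lambda>x. \<Sum>i<(1::nat). 1 * ?p x) \<in> PDC"
    by (rule PDC_I[of 1 "\<lambda>_. ?p" "\<lambda>_. 1"]) (rule PD_const)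
  then have p: "?p \<in> PDC" by simp
  obtain h where h: "h \<in> PDC" "\<forall>x\<in>carrier G. w x * ?p x = h x"
    by (rule PDC_multiplierE[OF assms p])
  show thesis using h(2) by (intro that[OF h(1)]) simp
qed

end

section \<open>Matrix coefficients of the Koopman representation\<close>

context uniform_chart
begin

text \<open>The diagonal matrix coefficient of the Koopman operator of \<open>g\<close> at the
  vector \<xi>.\<close>

definition coef :: "('a \<Rightarrow> complex) \<Rightarrow> ('a \<Rightarrow> 'a) set \<Rightarrow> complex" where
  "coef \<xi> g = (if g \<in> carrier (Aut M) then \<integral>x. \<xi> (rinv g x) * cnj (\<xi> x) \<partial>M else 0)"

lemma integrable_bounded_mult:
  assumes "f \<in> borel_measurable M" "\<And>x. cmod (f x) \<le> C" "g \<in> borel_measurable M" "\<And>x. cmod (g x) \<le> D"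
  shows "integrable M (\<lambda>x. f x * cnj (g x))"
proof (rule integrable_const_bound[of _ "C * D"])
  show "AE x in M. cmod (f x * cnj (g x)) \<le> C * D"
  proof (rule AE_I2)
    fix x
    have "0 \<le> C" using assms(2)[of x] norm_ge_zero order_trans by blast
    then show "cmod (f x * cnj (g x)) \<le> C * D"
      using assms(2,4)[of x] by (simp add: norm_mult mult_mono)
  qed
  have "(\<lambda>x. cnj (g x)) \<in> borel_measurable M"
    by (rule borel_measurable_continuous_on[OF _ assms(3)]) (intro continuous_intros)
  then show "(\<lambda>x. f x * cnj (g x)) \<in> borel_measurable M" using assms(1) by measurable
qed

lemma rinv_comp_measurable:
  "g \<in> carrier (Aut M) \<Longrightarrow> \<xi> \<in> borel_measurable M \<Longrightarrow> (\<lambda>x. \<xi> (rinv g x)) \<in> borel_measurable M"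
  by (rule measurable_compose[OF rinv_measurable])

lemma coef_continuous:
  assumes \<xi>: "\<xi> \<in> borel_measurable M" "\<And>x. cmod (\<xi> x) \<le> C"
  shows "continuous_map (weak_topology M) euclidean (coef \<xi>)"
proof -
  interpret A: semitopological_group "Aut M" "weak_topology M" by (rule semitopological_Aut)
  have S: "\<xi> \<in> SI" by (rule SI_bounded[OF \<xi>])
  have C0: "0 \<le> C" using \<xi>(2) norm_ge_zero order_trans by blast
  show ?thesis
    unfolding A.continuous_map_complex_iff
  proof (intro ballI allI impI)
    fix g and e :: real assume g: "g \<in> carrier (Aut M)" and e: "e > 0"
    define r where "r = e / (C + 1)"
    have r: "r > 0" "C * r < e" using e C0 by (auto simp: r_def field_simps)
    define U where "U = {h \<in> topspace (weak_topology M). Koopman M h (cl2 \<xi>) \<in>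
        {\<eta> \<in> L2 M. L2_dist M (Koopman M g (cl2 \<xi>)) \<eta> < r}}"
    have gL: "Koopman M g (cl2 \<xi>) \<in> L2 M" by (rule Koopman_L2[OF g cl2_L2[OF S]])
    have "openin (weak_topology M) U"
      unfolding U_def
      by (rule openin_continuous_map_preimage[OF continuous_map_Koopman[OF cl2_L2[OF S]] openin_L2_ball[OF gL]])
    moreover have "g \<in> U"
      using g gL r(1) Metric_space.mdist_zero[OF Metric_space_L2 gL] by (simp add: U_def topspace_weak_topology)
    moreover have "cmod (coef \<xi> g - coef \<xi> h) < e" if h: "h \<in> U" for h
    proof -
      have hG: "h \<in> carrier (Aut M)" using h by (simp add: U_def topspace_weak_topology)
      note ug = rinv_measurable[OF g] rinv_distr[OF g] and uh = rinv_measurable[OF hG] rinv_distr[OF hG]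
      let ?D = "\<lambda>x. \<xi> (rinv g x) - \<xi> (rinv h x)"
      have DS: "?D \<in> SI" by (intro SI_diff norm2_comp(1)[OF ug S] norm2_comp(1)[OF uh S])
      have dist: "norm2 ?D < r"
      proof -
        have "L2_dist M (Koopman M g (cl2 \<xi>)) (Koopman M h (cl2 \<xi>)) < r" using h by (simp add: U_def)
        then show ?thesis
          unfolding Koopman_cl2[OF g S] Koopman_cl2[OF hG S]
            L2_dist_cl2[OF norm2_comp(1)[OF ug S] norm2_comp(1)[OF uh S]] .
      qed
      have ig: "integrable M (\<lambda>x. \<xi> (rinv g x) * cnj (\<xi> x))"
        by (rule integrable_bounded_mult[OF rinv_comp_measurable[OF g \<xi>(1)] \<xi>(2) \<xi>])
      have ih: "integrable M (\<lambda>x. \<xi> (rinv h x) * cnj (\<xi> x))"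
        by (rule integrable_bounded_mult[OF rinv_comp_measurable[OF hG \<xi>(1)] \<xi>(2) \<xi>])
      have "coef \<xi> g - coef \<xi> h = (\<integral>x. ?D x * cnj (\<xi> x) \<partial>M)"
        using g hG Bochner_Integration.integral_diff[OF ig ih] by (simp add: coef_def left_diff_distrib)
      also have "cmod \<dots> \<le> (\<integral>x. cmod (?D x * cnj (\<xi> x)) \<partial>M)" by (rule integral_norm_bound)
      also have "\<dots> \<le> (\<integral>x. C * cmod (?D x) \<partial>M)"
      proof (rule integral_mono)
        show "integrable M (\<lambda>x. cmod (?D x * cnj (\<xi> x)))"
          using Bochner_Integration.integrable_diff[OF ig ih] by (simp add: left_diff_distrib)
        show "integrable M (\<lambda>x. C * cmod (?D x))" using norm1_le_norm2(1)[OF DS] by simp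
        show "cmod (?D x * cnj (\<xi> x)) \<le> C * cmod (?D x)" for x
          using mult_left_mono[OF \<xi>(2)[of x], of "cmod (?D x)"] by (simp add: norm_mult mult.commute)
      qed
      also have "\<dots> \<le> C * norm2 ?D"
        using norm1_le_norm2(2)[OF DS] C0 by (simp add: mult_left_mono)
      also have "\<dots> \<le> C * r" using dist C0 by (intro mult_left_mono) auto
      finally show ?thesis using r(2) by linarith
    qed
    ultimately show "\<exists>U. openin (weak_topology M) U \<and> g \<in> U \<and> (\<forall>h\<in>U. cmod (coef \<xi> g - coef \<xi> h) < e)"
      by blast
  qed
qed

text \<open>Unitarity: substituting \<open>rinv g x\<close> for \<open>x\<close> in the integral
  applies the Koopman operator of \<open>g\<close> to both vectors.\<close>

lemma coef_mult:
  assumes \<xi>: "\<xi> \<in> borel_measurable M" "\<And>x. cmod (\<xi> x) \<le> C"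
    and g: "g \<in> carrier (Aut M)" and h: "h \<in> carrier (Aut M)"
  shows "coef \<xi> (inv\<^bsub>Aut M\<^esub> g \<otimes>\<^bsub>Aut M\<^esub> h) = (\<integral>x. \<xi> (rinv h x) * cnj (\<xi> (rinv g x)) \<partial>M)"
proof -
  interpret A: group "Aut M" by (rule group_Aut)
  have gh: "inv\<^bsub>Aut M\<^esub> g \<otimes>\<^bsub>Aut M\<^esub> h \<in> carrier (Aut M)" using g h by simp
  note ug = rinv_measurable[OF g] rinv_distr[OF g]
  have cnj_meas: "(\<lambda>x. cnj (f x)) \<in> borel_measurable M" if "f \<in> borel_measurable M" for f
    by (rule borel_measurable_continuous_on[OF _ that]) (intro continuous_intros)
  let ?F = "\<lambda>x. \<xi> (rinv (inv\<^bsub>Aut M\<^esub> g \<otimes>\<^bsub>Aut M\<^esub> h) x) * cnj (\<xi> x)"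
  have Fm: "?F \<in> borel_measurable M"
    using rinv_comp_measurable[OF gh \<xi>(1)] cnj_meas[OF \<xi>(1)] by measurable
  have "inv\<^bsub>Aut M\<^esub> (inv\<^bsub>Aut M\<^esub> g \<otimes>\<^bsub>Aut M\<^esub> h) = inv\<^bsub>Aut M\<^esub> h \<otimes>\<^bsub>Aut M\<^esub> g"
    using g h by (simp add: A.inv_mult_group)
  then have "AE x in M. rinv (inv\<^bsub>Aut M\<^esub> g \<otimes>\<^bsub>Aut M\<^esub> h) x = rinv h (rep g x)"
    using rep_mult[OF A.inv_closed[OF h] g] by simp
  then have "AE x in M. rinv (inv\<^bsub>Aut M\<^esub> g \<otimes>\<^bsub>Aut M\<^esub> h) (rinv g x) = rinv h (rep g (rinv g x))"
    by (rule AE_measure_preserving[OF ug])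
  then have ae: "AE x in M. ?F (rinv g x) = \<xi> (rinv h x) * cnj (\<xi> (rinv g x))"
    using rep_inv_right[OF g] by eventually_elim simp
  have "coef \<xi> (inv\<^bsub>Aut M\<^esub> g \<otimes>\<^bsub>Aut M\<^esub> h) = (\<integral>x. ?F x \<partial>M)" using gh by (simp add: coef_def)
  also have "\<dots> = (\<integral>x. ?F (rinv g x) \<partial>M)"
    using integral_distr[OF ug(1) Fm] ug(2) by simp
  also have "\<dots> = (\<integral>x. \<xi> (rinv h x) * cnj (\<xi> (rinv g x)) \<partial>M)"
  proof (rule integral_cong_AE[OF _ _ ae])
    show "(\<lambda>x. ?F (rinv g x)) \<in> borel_measurable M" by (rule measurable_compose[OF ug(1) Fm])
    show "(\<lambda>x. \<xi> (rinv h x) * cnj (\<xi> (rinv g x))) \<in> borel_measurable M"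
      using rinv_comp_measurable[OF h \<xi>(1)] cnj_meas[OF rinv_comp_measurable[OF g \<xi>(1)]] by measurable
  qed
  finally show ?thesis .
qed

text \<open>The Schur product with a matrix coefficient needs no spectral decomposition: the quadratic
  form is the integral over \<open>x\<close> of the form of \<open>h\<close> with coefficients
  \<open>c\<^sub>j \<xi> (g\<^sub>j\<inverse> x)\<close>.\<close>

lemma coef_mult_positive_definite:
  assumes \<xi>: "\<xi> \<in> borel_measurable M" "\<And>x. cmod (\<xi> x) \<le> C"
    and h: "h \<in> positive_definite_functions (Aut M) (weak_topology M)"
  shows "(\<lambda>g. coef \<xi> g * h g) \<in> positive_definite_functions (Aut M) (weak_topology M)"
proof -
  interpret A: semitopological_group "Aut M" "weak_topology M" by (rule semitopological_Aut)
  have cont: "continuous_map (weak_topology M) euclidean (\<lambda>g. coef \<xi> g * h g)"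
    using h coef_continuous[OF \<xi>]
    by (intro continuous_map_complex_mult) (simp_all add: positive_definite_functions_def)
  have form: "Im (\<Sum>i<n. \<Sum>j<n. cnj (c i) * c j * (coef \<xi> (inv\<^bsub>Aut M\<^esub> g i \<otimes>\<^bsub>Aut M\<^esub> g j) * h (inv\<^bsub>Aut M\<^esub> g i \<otimes>\<^bsub>Aut M\<^esub> g j))) = 0"
    "0 \<le> Re (\<Sum>i<n. \<Sum>j<n. cnj (c i) * c j * (coef \<xi> (inv\<^bsub>Aut M\<^esub> g i \<otimes>\<^bsub>Aut M\<^esub> g j) * h (inv\<^bsub>Aut M\<^esub> g i \<otimes>\<^bsub>Aut M\<^esub> g j)))"
    if g: "\<forall>i<n. g i \<in> carrier (Aut M)" for n :: nat and g c
  proof -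
    let ?H = "\<lambda>i j. h (inv\<^bsub>Aut M\<^esub> g i \<otimes>\<^bsub>Aut M\<^esub> g j)"
    define X where "X = (\<lambda>i x. \<xi> (rinv (g i) x))"
    have int: "integrable M (\<lambda>x. cnj (c i) * c j * ?H i j * (X j x * cnj (X i x)))" if "i < n" "j < n" for i j
      unfolding X_def using that g \<xi>
      by (intro integrable_mult_right integrable_bounded_mult[of _ C _ C] rinv_comp_measurable) auto
    define R where "R = (\<lambda>x. \<Sum>i<n. \<Sum>j<n. cnj (c i) * c j * ?H i j * (X j x * cnj (X i x)))"
    have R_int: "integrable M R"
      unfolding R_def by (intro Bochner_Integration.integrable_sum int) auto
    have "(\<Sum>i<n. \<Sum>j<n. cnj (c i) * c j * (coef \<xi> (inv\<^bsub>Aut M\<^esub> g i \<otimes>\<^bsub>Aut M\<^esub> g j) * ?H i j))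
        = (\<Sum>i<n. \<Sum>j<n. \<integral>x. cnj (c i) * c j * ?H i j * (X j x * cnj (X i x)) \<partial>M)"
    proof (intro sum.cong refl)
      fix i j assume "i \<in> {..<n}" "j \<in> {..<n}"
      then have ce: "coef \<xi> (inv\<^bsub>Aut M\<^esub> g i \<otimes>\<^bsub>Aut M\<^esub> g j) = (\<integral>x. X j x * cnj (X i x) \<partial>M)"
        unfolding X_def using g by (intro coef_mult[OF \<xi>]) auto
      show "cnj (c i) * c j * (coef \<xi> (inv\<^bsub>Aut M\<^esub> g i \<otimes>\<^bsub>Aut M\<^esub> g j) * ?H i j)
          = (\<integral>x. cnj (c i) * c j * ?H i j * (X j x * cnj (X i x)) \<partial>M)"
        unfolding ce integral_mult_right_zero by (simp only: mult_ac)
    qed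
    also have "\<dots> = (\<integral>x. R x \<partial>M)"
      unfolding R_def using int
      by (subst Bochner_Integration.integral_sum) (auto intro!: sum.cong Bochner_Integration.integral_sum[symmetric])
    finally have eq: "(\<Sum>i<n. \<Sum>j<n. cnj (c i) * c j * (coef \<xi> (inv\<^bsub>Aut M\<^esub> g i \<otimes>\<^bsub>Aut M\<^esub> g j) * ?H i j))
        = (\<integral>x. R x \<partial>M)" .
    have R_eq: "R x = (\<Sum>i<n. \<Sum>j<n. cnj (c i * X i x) * (c j * X j x) * ?H i j)" for x
      unfolding R_def by (intro sum.cong refl) (simp add: mult_ac)
    have R_form: "Im (R x) = 0" "0 \<le> Re (R x)" for x
      unfolding R_eq using A.PD_form[OF h, of n g "\<lambda>i. c i * X i x"] g by auto
    have "Im (\<integral>x. R x \<partial>M) = (\<integral>x. Im (R x) \<partial>M)" using integral_Im[OF R_int] by simp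
    then show "Im (\<Sum>i<n. \<Sum>j<n. cnj (c i) * c j * (coef \<xi> (inv\<^bsub>Aut M\<^esub> g i \<otimes>\<^bsub>Aut M\<^esub> g j) * ?H i j)) = 0"
      unfolding eq by (simp add: R_form(1))
    have "Re (\<integral>x. R x \<partial>M) = (\<integral>x. Re (R x) \<partial>M)" using integral_Re[OF R_int] by simp
    also have "\<dots> \<ge> 0" by (intro Bochner_Integration.integral_nonneg R_form(2))
    finally show "0 \<le> Re (\<Sum>i<n. \<Sum>j<n. cnj (c i) * c j * (coef \<xi> (inv\<^bsub>Aut M\<^esub> g i \<otimes>\<^bsub>Aut M\<^esub> g j) * ?H i j))"
      unfolding eq .
  qed
  have zero: "\<forall>x. x \<notin> carrier (Aut M) \<longrightarrow> coef \<xi> x * h x = 0" by (simp add: coef_def)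
  show ?thesis
    unfolding positive_definite_functions_def functions_on_def mem_Collect_eq Let_def
    by (intro conjI cont zero allI impI form) simp_all
qed

text \<open>Polarization: the diagonal coefficients of the four vectors
  \<open>indicator B x + \<i> ^ k * indicator A x\<close>, with weights \<open>\<i> ^ k / 4\<close>,
  add up to the mixed term alone, which is the measure of \<open>A \<inter> g B\<close>.\<close>

lemma prob_coefficient_multiplier:
  assumes A: "A \<in> events" and B: "B \<in> events"
  shows "semitopological_group.PDC_multiplier (Aut M) (weak_topology M)
    (\<lambda>g. of_real (prob (pre (rep g) A \<inter> B)))"
proof -
  interpret A: semitopological_group "Aut M" "weak_topology M" by (rule semitopological_Aut)
  define X where "X = (\<lambda>k x. indicator B x + \<i> ^ k * indicator A x :: complex)"
  have X: "X k \<in> borel_measurable M" "cmod (X k x) \<le> 2" for k x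
  proof -
    show "X k \<in> borel_measurable M" unfolding X_def using A B by measurable
    have "cmod (X k x) \<le> cmod (indicator B x) + cmod (\<i> ^ k * indicator A x)"
      unfolding X_def by (rule norm_triangle_ineq)
    also have "\<dots> \<le> 1 + 1"
      by (intro add_mono) (auto simp: norm_mult norm_power indicator_def)
    finally show "cmod (X k x) \<le> 2" by simp
  qed
  have mult: "A.PDC_multiplier (coef (X k))" for k
    unfolding A.PDC_multiplier_def
  proof
    fix f assume f: "f \<in> A.PDC"
    have "(\<lambda>x. 1 * (coef (X k) x * f x)) \<in> A.PDC"
      by (rule A.PDC_map[OF f coef_mult_positive_definite[OF X]])
    then show "\<exists>h\<in>A.PDC. \<forall>x\<in>carrier (Aut M). coef (X k) x * f x = h x" by auto
  qed
  have "A.PDC_multiplier (\<lambda>g. \<Sum>k<4. (\<i> ^ k / 4) * coef (X k) g)"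
    by (intro A.PDC_multiplier_sum A.PDC_multiplier_mult A.PDC_multiplier_const mult) simp
  then show ?thesis
  proof (rule A.PDC_multiplier_cong)
    fix g assume g: "g \<in> carrier (Aut M)"
    note ug = rinv_measurable[OF g] rinv_distr[OF g]
    have int: "integrable M (\<lambda>x. (\<i> ^ k / 4) * (X k (rinv g x) * cnj (X k x)))" for k
      by (intro integrable_mult_right integrable_bounded_mult[OF rinv_comp_measurable[OF g X(1)] X(2) X])
    have "(\<Sum>k<4. (\<i> ^ k / 4) * coef (X k) g) = (\<Sum>k<4. \<integral>x. (\<i> ^ k / 4) * (X k (rinv g x) * cnj (X k x)) \<partial>M)"
      using g by (simp add: coef_def)
    also have "\<dots> = (\<integral>x. (\<Sum>k<4. (\<i> ^ k / 4) * (X k (rinv g x) * cnj (X k x))) \<partial>M)"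
      by (intro Bochner_Integration.integral_sum[symmetric] int)
    also have "\<dots> = (\<integral>x. complex_of_real (indicator (A \<inter> pre (rinv g) B) x) \<partial>M)"
    proof (rule Bochner_Integration.integral_cong[OF refl])
      fix x assume x: "x \<in> space M"
      have polar: "(\<Sum>k<4. (\<i> ^ k / 4) * ((b' + \<i> ^ k * a') * cnj (b + \<i> ^ k * a))) = b' * cnj a"
        for a b a' b' :: complex
        by (simp add: eval_nat_numeral complex_eq_iff algebra_simps)
      show "(\<Sum>k<4. (\<i> ^ k / 4) * (X k (rinv g x) * cnj (X k x))) = complex_of_real (indicator (A \<inter> pre (rinv g) B) x)"
        unfolding X_def polar using x by (auto simp: indicator_def)
    qed
    also have "\<dots> = of_real (prob (A \<inter> pre (rinv g) B))"
      using sets.sets_into_space[OF A] by (simp add: Int_absorb2 Int_assoc)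
    also have "prob (A \<inter> pre (rinv g) B) = prob (pre (rinv g) (pre (rep g) A \<inter> B))"
    proof (rule measure_eq_AE)
      show "AE x in M. x \<in> A \<inter> pre (rinv g) B \<longleftrightarrow> x \<in> pre (rinv g) (pre (rep g) A \<inter> B)"
        using rep_inv_right[OF g] AE_space
        by eventually_elim (use measurable_space[OF ug(1)] in auto)
      show "A \<inter> pre (rinv g) B \<in> events" by (intro sets.Int A pre_events[OF ug(1) B])
      show "pre (rinv g) (pre (rep g) A \<inter> B) \<in> events"
        by (intro pre_events[OF ug(1)] sets.Int B pre_events[OF rep_measurable[OF g] A])
    qed
    also have "\<dots> = prob (pre (rep g) A \<inter> B)"
      by (intro prob_pre[OF ug] sets.Int B pre_events[OF rep_measurable[OF g] A])
    finally show "of_real (prob (pre (rep g) A \<inter> B)) = (\<Sum>k<4. (\<i> ^ k / 4) * coef (X k) g)" by simp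
  qed
qed

text \<open>In the factorization \<open>h = u \<otimes> (g \<otimes> v)\<close> the right uniformity
  compares \<open>f h\<close> with \<open>f (g \<otimes> v)\<close>, and the left one compares the
  latter with \<open>f g\<close>, at a cost of \<open>e / 4\<close> each. Bernstein approximation
  doubles the resulting \<open>e / 2\<close>.\<close>

theorem Roelcke_subset_Hilbert:
  "Roelcke_algebra (Aut M) (weak_topology M) \<subseteq> Hilbert_algebra (Aut M) (weak_topology M)"
proof
  interpret A: semitopological_group "Aut M" "weak_topology M" by (rule semitopological_Aut)
  fix f assume f: "f \<in> Roelcke_algebra (Aut M) (weak_topology M)"
  have f0: "f \<in> functions_on (Aut M)" and "bounded (f ` carrier (Aut M))"
    using f by (auto simp: Roelcke_algebra_def bounded_functions_def)
  then obtain B where B: "\<And>g. g \<in> carrier (Aut M) \<Longrightarrow> cmod (f g) \<le> B" by (auto simp: bounded_iff)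
  have "\<exists>h\<in>A.PDC. \<forall>g\<in>carrier (Aut M). cmod (f g - h g) < e" if e: "e > 0" for e
  proof -
    have e4: "e / 4 > 0" using e by simp
    have "uniformly_continuous_wrt (right_uniformity (Aut M) (weak_topology M)) f"
      "uniformly_continuous_wrt (left_uniformity (Aut M) (weak_topology M)) f"
      using f by (auto simp: Roelcke_algebra_def)
    then obtain U V where U: "openin (weak_topology M) U" "\<one>\<^bsub>Aut M\<^esub> \<in> U"
        "\<forall>x y. x \<in> carrier (Aut M) \<and> y \<in> carrier (Aut M) \<and> x \<otimes>\<^bsub>Aut M\<^esub> inv\<^bsub>Aut M\<^esub> y \<in> U \<longrightarrow> cmod (f x - f y) < e / 4"
      and V: "openin (weak_topology M) V" "\<one>\<^bsub>Aut M\<^esub> \<in> V"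
        "\<forall>x y. x \<in> carrier (Aut M) \<and> y \<in> carrier (Aut M) \<and> inv\<^bsub>Aut M\<^esub> x \<otimes>\<^bsub>Aut M\<^esub> y \<in> V \<longrightarrow> cmod (f x - f y) < e / 4"
      unfolding A.right_uniformly_continuous_iff A.left_uniformly_continuous_iff using e4 by meson
    have "openin (weak_topology M) (U \<inter> V)" "\<one>\<^bsub>Aut M\<^esub> \<in> U \<inter> V" using U V by auto
    then obtain n \<delta> where \<delta>: "\<delta> > 0" and factor: "\<forall>g\<in>carrier (Aut M). \<forall>h\<in>carrier (Aut M).
      (\<forall>i<2 ^ n. \<forall>j<2 ^ n. \<bar>prob (pre (rep g) (dyadic n {i}) \<inter> dyadic n {j})
         - prob (pre (rep h) (dyadic n {i}) \<inter> dyadic n {j})\<bar> < \<delta>) \<longrightarrow>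
      (\<exists>u\<in>U \<inter> V. \<exists>v\<in>U \<inter> V. u \<in> carrier (Aut M) \<and> v \<in> carrier (Aut M) \<and> h = u \<otimes>\<^bsub>Aut M\<^esub> (g \<otimes>\<^bsub>Aut M\<^esub> v))"
      by (rule Roelcke_factorization)
    define I where "I = {..<(2::nat) ^ n} \<times> {..<(2::nat) ^ n}"
    define m where "m = (\<lambda>(i, j) g. prob (pre (rep g) (dyadic n {i}) \<inter> dyadic n {j}))"
    have osc: "cmod (f g - f h) < e / 2"
      if g: "g \<in> carrier (Aut M)" and h: "h \<in> carrier (Aut M)" and close: "\<And>p. p \<in> I \<Longrightarrow> \<bar>m p g - m p h\<bar> < \<delta>" for g h
    proof -
      have "\<forall>i<2 ^ n. \<forall>j<2 ^ n. \<bar>prob (pre (rep g) (dyadic n {i}) \<inter> dyadic n {j})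
         - prob (pre (rep h) (dyadic n {i}) \<inter> dyadic n {j})\<bar> < \<delta>"
        using close by (auto simp: I_def m_def)
      then obtain u v where u: "u \<in> U" "u \<in> carrier (Aut M)" and v: "v \<in> V" "v \<in> carrier (Aut M)"
        and h_eq: "h = u \<otimes>\<^bsub>Aut M\<^esub> (g \<otimes>\<^bsub>Aut M\<^esub> v)"
        using factor g h by blast
      have gv: "g \<otimes>\<^bsub>Aut M\<^esub> v \<in> carrier (Aut M)" using g v by simp
      have "h \<otimes>\<^bsub>Aut M\<^esub> inv\<^bsub>Aut M\<^esub> (g \<otimes>\<^bsub>Aut M\<^esub> v) = u"
        unfolding h_eq using u gv by (simp add: A.m_assoc del: A.inv_mult_group)
      then have 1: "cmod (f h - f (g \<otimes>\<^bsub>Aut M\<^esub> v)) < e / 4" using U(3) h gv u by simp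
      have "inv\<^bsub>Aut M\<^esub> g \<otimes>\<^bsub>Aut M\<^esub> (g \<otimes>\<^bsub>Aut M\<^esub> v) = v"
        using g v by (simp add: A.m_assoc[symmetric])
      then have 2: "cmod (f g - f (g \<otimes>\<^bsub>Aut M\<^esub> v)) < e / 4" using V(3) g gv v by simp
      show ?thesis
        using norm_triangle_ineq4[of "f g - f (g \<otimes>\<^bsub>Aut M\<^esub> v)" "f h - f (g \<otimes>\<^bsub>Aut M\<^esub> v)"] 1 2 by simp
    qed
    have e2: "e / 2 > 0" using e by simp
    obtain L :: nat and c where approx: "\<forall>g\<in>carrier (Aut M). cmod (f g -
        (\<Sum>\<alpha>\<in>PiE I (\<lambda>_. {..L}). c \<alpha> * of_real (\<Prod>i\<in>I. Bernstein L (\<alpha> i) (m i g)))) < 2 * (e / 2)"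
    proof (rule Bernstein_multivariate_approximation[of I "carrier (Aut M)" m f B \<delta> "e / 2"])
      show "finite I" by (simp add: I_def)
      show "0 \<le> m i g \<and> m i g \<le> 1" for i g by (simp add: m_def case_prod_beta)
    qed (use B \<delta> e2 osc in blast)+
    have mm: "A.PDC_multiplier (\<lambda>g. of_real (m p g))" for p
    proof -
      obtain i j where "p = (i, j)" by (rule prod.exhaust)
      then show ?thesis
        using prob_coefficient_multiplier[OF dyadic_events[of n "{i}"] dyadic_events[of n "{j}"]]
        by (simp add: m_def)
    qed
    have "A.PDC_multiplier (\<lambda>g. \<Sum>\<alpha>\<in>PiE I (\<lambda>_. {..L}). c \<alpha> * of_real (\<Prod>i\<in>I. Bernstein L (\<alpha> i) (m i g)))"
      unfolding of_real_prod
      by (intro A.PDC_multiplier_sum A.PDC_multiplier_mult A.PDC_multiplier_const A.PDC_multiplier_prod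
          A.PDC_multiplier_Bernstein mm finite_PiE) (simp_all add: I_def)
    then obtain h where h: "h \<in> A.PDC" "\<forall>g\<in>carrier (Aut M).
        (\<Sum>\<alpha>\<in>PiE I (\<lambda>_. {..L}). c \<alpha> * of_real (\<Prod>i\<in>I. Bernstein L (\<alpha> i) (m i g))) = h g"
      by (rule A.PDC_multiplier_one)
    show ?thesis
      using approx h by (intro bexI[of _ h]) auto
  qed
  then show "f \<in> Hilbert_algebra (Aut M) (weak_topology M)"
    using f0 by (simp add: Hilbert_algebra_def)
qed

end

theorem corollary1p2:
  fixes M :: "'a measure"
  assumes "prob_space M" and "standard_borel M" and "atomless M"
  defines "G \<equiv> Aut M" and "T \<equiv> weak_topology M"
  shows "compactifications_coincide G (Roelcke_algebra G T) (WAP_algebra G T)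
    \<and> Roelcke_algebra G T = WAP_algebra G T
    \<and> (\<forall>f \<in> Roelcke_algebra G T. \<forall>\<epsilon>>0.
          \<exists>h \<in> positive_definite_combinations G T. \<forall>x \<in> carrier G. cmod (f x - h x) < \<epsilon>)
    \<and> (\<forall>f \<in> WAP_algebra G T. \<forall>\<epsilon>>0.
          \<exists>h \<in> positive_definite_combinations G T. \<forall>x \<in> carrier G. cmod (f x - h x) < \<epsilon>)
    \<and> Roelcke_algebra G T = Hilbert_algebra G T"
proof -
  obtain \<psi> :: "'a \<Rightarrow> real" and \<kappa> :: "real \<Rightarrow> 'a"
    where chart: "\<psi> \<in> borel_measurable M" "\<kappa> \<in> measurable borel M" "AE x in M. \<kappa> (\<psi> x) = x"
      "\<forall>B\<in>sets borel. emeasure M (\<psi> -` B \<inter> space M) = emeasure lborel (B \<inter> {0<..<1})"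
    by (rule uniform_chart_exists[OF assms(1-3)])
  interpret prob_space M by fact
  interpret uniform_chart M \<psi> \<kappa>
    using chart by unfold_locales auto
  interpret A: semitopological_group "Aut M" "weak_topology M" by (rule semitopological_Aut)
  obtain d :: "nat \<Rightarrow> ('a \<Rightarrow> 'a) set" where d: "\<forall>i. d i \<in> carrier (Aut M)"
    "\<forall>V. openin (weak_topology M) V \<longrightarrow> V \<noteq> {} \<longrightarrow> (\<exists>i. d i \<in> V)"
    by (rule separable_Aut)
  have "WAP_algebra G T \<subseteq> Roelcke_algebra G T"
    unfolding G_def T_def by (rule A.WAP_subset_Roelcke[of d]) (use d in auto)
  moreover have "Roelcke_algebra G T \<subseteq> Hilbert_algebra G T"
    unfolding G_def T_def by (rule Roelcke_subset_Hilbert)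
  moreover have "Hilbert_algebra G T \<subseteq> WAP_algebra G T"
    unfolding G_def T_def by (rule A.Hilbert_subset_WAP)
  ultimately have eq: "Roelcke_algebra G T = WAP_algebra G T" "Roelcke_algebra G T = Hilbert_algebra G T"
    by auto
  \<comment> \<open>The algebras being equal, both compactifications are the same space and the
    identity is the homeomorphism over the group.\<close>
  have "compactifications_coincide G (Roelcke_algebra G T) (WAP_algebra G T)"
    unfolding compactifications_coincide_def eq(1)
    by (rule exI[of _ "\<lambda>z. z"]) (simp add: homeomorphic_map_id[unfolded id_def])
  moreover have "\<forall>f \<in> Hilbert_algebra G T. \<forall>\<epsilon>>0.
      \<exists>h \<in> positive_definite_combinations G T. \<forall>x \<in> carrier G. cmod (f x - h x) < \<epsilon>"
    by (simp add: Hilbert_algebra_def)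
  ultimately show ?thesis using eq by simp
qed

end
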